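(* Roman Vertex Cover is NP-complete.
   Context: For a graph $G=(V,E)$, a Roman vertex cover is a pair $(R_1,R_2)$ with $R_1\subseteq E$ and $R_2\subseteq V$ such that every edge $e\in E$ satisfies $e\in R_1$ or $e\cap R_2\ne\emptyset$; its weight is $\omega(R_1,R_2)=|R_1|+2|R_2|$. Roman Vertex Cover: given a graph $G$ and $k\in\mathbb N$, decide whether $G$ has a Roman vertex cover of weight at most $k$. *)

theory Defs
  imports "HOL-Computational_Algebra.Polynomial"
begin

section \<open>Turing machines\<close>

text \<open>
  Machines are nondeterministic and have any fixed number of two-way infinite tapes.
  States and tape symbols are natural numbers; the program is a finite set of transitions, so
  that only finitely many states and symbols matter. The symbol 0 is the blank.
  A transition \<open>(q, rs, q', as)\<close> is applicable in state \<open>q\<close> when \<open>rs\<close> lists the symbols under the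
  heads; the \<open>i\<close>-th entry \<open>(w, d)\<close> of \<open>as\<close> is the symbol written on tape \<open>i\<close> and the movement of
  its head.
\<close>

type_synonym transition = "nat \<times> nat list \<times> nat \<times> (nat \<times> int) list"

record tm =
  num_tapes :: nat
  start_state :: nat
  accept_state :: nat
  program :: "transition set"

definition wf_tm :: "tm \<Rightarrow> bool" where
  "wf_tm M \<longleftrightarrow> num_tapes M \<ge> 1 \<and> finite (program M) \<and>
     (\<forall>(q, rs, q', as) \<in> program M.
        length rs = num_tapes M \<and> length as = num_tapes M \<and> (\<forall>(w, d) \<in> set as. d \<in> {-1, 0, 1}))"

definition deterministic_tm :: "tm \<Rightarrow> bool" where
  "deterministic_tm M \<longleftrightarrow>
     (\<forall>q rs q1 as1 q2 as2. (q, rs, q1, as1) \<in> program M \<longrightarrow> (q, rs, q2, as2) \<in> program M \<longrightarrow>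
        q1 = q2 \<and> as1 = as2)"

type_synonym tape = "(int \<Rightarrow> nat) \<times> int"  \<comment> \<open>cell contents and head position\<close>

type_synonym config = "nat \<times> tape list"

fun scanned :: "tape \<Rightarrow> nat" where
  "scanned (f, h) = f h"

fun act :: "tape \<Rightarrow> nat \<times> int \<Rightarrow> tape" where
  "act (f, h) (w, d) = (f(h := w), h + d)"

definition step :: "tm \<Rightarrow> (config \<times> config) set" where
  "step M = {((q, ts), (q', map2 act ts as)) | q ts q' as.
     (q, map scanned ts, q', as) \<in> program M}"

definition halting :: "tm \<Rightarrow> config \<Rightarrow> bool" where
  "halting M c \<longleftrightarrow> (\<nexists>c'. (c, c') \<in> step M)"

definition bit_symbol :: "bool \<Rightarrow> nat" where
  "bit_symbol b = (if b then 2 else 1)"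

definition input_tape :: "bool list \<Rightarrow> tape" where
  "input_tape x =
     ((\<lambda>i. if 0 \<le> i \<and> i < int (length x) then bit_symbol (x ! nat i) else 0), 0)"

definition initial :: "tm \<Rightarrow> bool list \<Rightarrow> config" where
  "initial M x =
     (start_state M, input_tape x # replicate (num_tapes M - 1) ((\<lambda>_. 0), 0))"

text \<open>
  The output is the string on the first tape that starts at the head and extends to the first
  blank. Other cells, and the other tapes, may hold arbitrary symbols.
\<close>

definition outputs :: "config \<Rightarrow> bool list \<Rightarrow> bool" where
  "outputs c y \<longleftrightarrow>
     (case c of (q, ts) \<Rightarrow> case hd ts of (f, h) \<Rightarrow>
        (\<forall>i < length y. f (h + int i) = bit_symbol (y ! i)) \<and> f (h + int (length y)) = 0)"


section \<open>Polynomial time, NP and NP-completeness\<close>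

definition polytime_computable :: "(bool list \<Rightarrow> bool list) \<Rightarrow> bool" where
  "polytime_computable f \<longleftrightarrow>
     (\<exists>M (p :: nat poly). wf_tm M \<and> deterministic_tm M \<and>
        (\<forall>x. \<exists>n \<le> poly p (length x). \<exists>c.
           (initial M x, c) \<in> step M ^^ n \<and> halting M c \<and> outputs c (f x)))"

definition accepts :: "tm \<Rightarrow> bool list \<Rightarrow> bool" where
  "accepts M x \<longleftrightarrow>
     (\<exists>c. (initial M x, c) \<in> (step M)\<^sup>* \<and> halting M c \<and> fst c = accept_state M)"

text \<open>The time bound in \<open>NP\<close> applies to every computation path, accepting or not.\<close>

definition NP :: "bool list set set" where
  "NP = {L. \<exists>M (p :: nat poly). wf_tm M \<and>
     (\<forall>x n c. (initial M x, c) \<in> step M ^^ n \<longrightarrow> n \<le> poly p (length x)) \<and>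
     L = {x. accepts M x}}"

definition polytime_reducible :: "bool list set \<Rightarrow> bool list set \<Rightarrow> bool" where
  "polytime_reducible L L' \<longleftrightarrow>
     (\<exists>f. polytime_computable f \<and> (\<forall>x. x \<in> L \<longleftrightarrow> f x \<in> L'))"

definition NP_hard :: "bool list set \<Rightarrow> bool" where
  "NP_hard L \<longleftrightarrow> (\<forall>L' \<in> NP. polytime_reducible L' L)"

definition NP_complete :: "bool list set \<Rightarrow> bool" where
  "NP_complete L \<longleftrightarrow> L \<in> NP \<and> NP_hard L"


section \<open>Roman vertex covers\<close>

definition graph :: "'v set \<Rightarrow> 'v set set \<Rightarrow> bool" where
  "graph V E \<longleftrightarrow> finite V \<and> (\<forall>e \<in> E. e \<subseteq> V \<and> card e = 2)"

definition roman_vertex_cover :: "'v set \<Rightarrow> 'v set set \<Rightarrow> 'v set set \<Rightarrow> 'v set \<Rightarrow> bool" where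
  "roman_vertex_cover V E R1 R2 \<longleftrightarrow>
     R1 \<subseteq> E \<and> R2 \<subseteq> V \<and> (\<forall>e \<in> E. e \<in> R1 \<or> e \<inter> R2 \<noteq> {})"

definition rvc_weight :: "'v set set \<Rightarrow> 'v set \<Rightarrow> nat" where
  "rvc_weight R1 R2 = card R1 + 2 * card R2"

definition has_rvc_of_weight_at_most :: "'v set \<Rightarrow> 'v set set \<Rightarrow> nat \<Rightarrow> bool" where
  "has_rvc_of_weight_at_most V E k \<longleftrightarrow>
     (\<exists>R1 R2. roman_vertex_cover V E R1 R2 \<and> rvc_weight R1 R2 \<le> k)"


section \<open>The decision problem as a language\<close>

fun binary :: "nat \<Rightarrow> bool list" where  \<comment> \<open>least significant bit first, no leading zeros\<close>
  "binary k = (if k = 0 then [] else odd k # binary (k div 2))"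

declare binary.simps [simp del]

definition adjacency_matrix :: "nat \<Rightarrow> nat set set \<Rightarrow> bool list" where  \<comment> \<open>row by row\<close>
  "adjacency_matrix n E = concat (map (\<lambda>i. map (\<lambda>j. {i, j} \<in> E) [0..<n]) [0..<n])"

text \<open>
  An instance is a graph with vertex set \<open>{..<n}\<close> together with a number \<open>k\<close>. The unary prefix
  for \<open>n\<close>, ended by \<^term>\<open>False\<close>, makes the concatenation uniquely decodable.
\<close>

definition encode_instance :: "nat \<Rightarrow> nat set set \<Rightarrow> nat \<Rightarrow> bool list" where
  "encode_instance n E k = replicate n True @ False # adjacency_matrix n E @ binary k"

definition Roman_Vertex_Cover :: "bool list set" where
  "Roman_Vertex_Cover =
     {encode_instance n E k | n E k. graph {..<n} E \<and> has_rvc_of_weight_at_most {..<n} E k}"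

lemma binary_inject: "binary k = binary l \<longleftrightarrow> k = l"
proof
  show "binary k = binary l \<Longrightarrow> k = l"
  proof (induction k arbitrary: l rule: less_induct)
    case (less k)
    show ?case
    proof (cases "k = 0 \<or> l = 0")
      case True
      with less.prems show ?thesis
        by (auto simp: binary.simps[of k] binary.simps[of l] split: if_splits)
    next
      case False
      with less.prems have "odd k = odd l" and "binary (k div 2) = binary (l div 2)"
        by (simp_all add: binary.simps[of k] binary.simps[of l])
      with less.IH[of "k div 2" "l div 2"] False have "k div 2 = l div 2" by simp
      with \<open>odd k = odd l\<close> show ?thesis by presburger
    qed
  qed
qed simp

lemma length_adjacency_matrix: "length (adjacency_matrix n E) = n * n"
  by (simp add: adjacency_matrix_def length_concat comp_def sum_list_triv)

lemma adjacency_matrix_inject: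
  assumes "graph {..<n} E" "graph {..<n} F" "adjacency_matrix n E = adjacency_matrix n F"
  shows "E = F"
proof -
  have "map (\<lambda>i. map (\<lambda>j. {i, j} \<in> E) [0..<n]) [0..<n] = map (\<lambda>i. map (\<lambda>j. {i, j} \<in> F) [0..<n]) [0..<n]"
    using assms(3) unfolding adjacency_matrix_def
    by (rule concat_injective) (auto simp: zip_map_map)
  then have *: "{i, j} \<in> E \<longleftrightarrow> {i, j} \<in> F" if "i < n" "j < n" for i j
    using that by auto
  have "e \<in> E \<longleftrightarrow> e \<in> F" for e
  proof (cases "e \<subseteq> {..<n} \<and> card e = 2")
    case True
    then obtain i j where "e = {i, j}" by (auto simp: card_2_iff)
    with True * show ?thesis by auto
  next
    case False
    with assms show ?thesis by (auto simp: graph_def)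
  qed
  then show ?thesis by blast
qed

lemma encode_instance_inject:
  assumes "graph {..<n} E" "graph {..<m} F" "encode_instance n E k = encode_instance m F l"
  shows "n = m \<and> E = F \<and> k = l"
proof -
  have pre: "takeWhile id (replicate n True @ False # xs) = replicate n True" for n xs
    by (induction n) auto
  have nm: "n = m"
    using arg_cong[OF assms(3), of "\<lambda>xs. length (takeWhile id xs)"]
    by (simp add: encode_instance_def pre)
  with assms(3) have "adjacency_matrix n E = adjacency_matrix n F \<and> binary k = binary l"
    by (simp add: encode_instance_def length_adjacency_matrix)
  with nm assms(1,2) adjacency_matrix_inject[of n E F] show ?thesis
    by (simp add: binary_inject)
qed

end

(*
  Membership: guess the vertices R2, written as marks on the input, and check deterministically
  that the uncovered edges and twice the number of marks do not exceed the bound.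

  Hardness: an accepting computation of length T of a nondeterministic machine is a T x 2T table
  of cells, each holding the symbols of all tapes at one position, flags for the heads, and the
  transition taken at that time. All conditions on the table concern one cell or two cells, so
  that accepting computations are the solutions of a constraint problem with unary and binary
  constraints. Its solutions are the independent sets of maximal size in the graph on the pairs
  (cell, content) whose edges join incompatible pairs. After adding a pendant edge at every vertex,
  leaving a vertex out of R2 costs 1 and taking it costs 2, so cheap Roman vertex covers
  correspond to small vertex covers, hence to large independent sets.

  Both the verifier and the reduction are given by expressions over the input, built from sums,
  products, truncated differences and bounded sums. Such expressions are compiled to
  programs on unary counters, a counter being the head position on a tape with marked origin, and
  these to Turing machines. Bounded sums are the only loops, so the running time is polynomial.
*)
theory Submission
  imports Defs
begin

section \<open>Counter programs and their compilation to Turing machines\<close>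

text \<open>The bound k is given in binary, so it may be exponential in the input length and no
  counter can hold it. The verifier therefore never decodes k: the weight w of a guessed cover is
  polynomial, and w <= k is decided from the bits of k below the length of w and from the presence
  of any higher bit (\<open>le_nval_iff\<close>). Conversely, the reduction has to emit its bound in
  binary although expressions have no division or exponentiation; bits are found by searching for
  quotients, and powers of two as the numbers all of whose divisors are 1 or even. The width 2T
  keeps a head that starts in the middle and moves by at most one per step inside the table. As the
  machine is fixed, the number c of cell contents is a constant, and conditions on contents are
  settled while the expression is built; only times, positions and input symbols remain to be
  computed. With m cells and M = m * c vertices, the weight bound 2M - m is the cost m + 2(M - m) of
  leaving out an independent set of size m.\<close>

datatype com = Nop | Inc nat | Dec nat | Wr nat | Seq com com | IfSym nat com | Loop nat com

text \<open>
  A state consists of an array, which lives on the first tape, and of counters. Counter 0 is the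
  head position on the first tape; every counter \<open>i\<close> is also the head position on tape \<open>i + 1\<close>,
  whose cell 0 is marked, so that a test for zero reads a single cell.
\<close>

type_synonym env = "nat \<Rightarrow> nat"

type_synonym state = "(int \<Rightarrow> nat) \<times> env"

definition dec :: "nat \<Rightarrow> state \<Rightarrow> state" where
  "dec i s = (fst s, (snd s)(i := snd s i - 1))"

text \<open>\<open>Loop i c\<close> means: while counter \<open>i\<close> is nonzero, decrement it
  and run \<open>c\<close>. Iterating as often as the initial value says the same once
  \<open>wf_com\<close> forbids \<open>c\<close> to modify \<open>i\<close>, and it keeps
  \<open>sem\<close> primitive recursive.\<close>

primrec sem :: "com \<Rightarrow> state \<Rightarrow> state" where
  "sem Nop s = s"
| "sem (Inc i) s = (fst s, (snd s)(i := Suc (snd s i)))"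
| "sem (Dec i) s = dec i s"
| "sem (Wr w) s = ((fst s)(int (snd s 0) := w), snd s)"
| "sem (Seq c d) s = sem d (sem c s)"
| "sem (IfSym w c) s = (if fst s (int (snd s 0)) = w then sem c s else s)"
| "sem (Loop i c) s = ((\<lambda>s. sem c (dec i s)) ^^ snd s i) s"

text \<open>Exact step counts: a round of a loop pays one step for the test with decrement and one
  for the jump back; the final failed test pays one more.\<close>

primrec time :: "com \<Rightarrow> state \<Rightarrow> nat" where
  "time Nop s = 0"
| "time (Inc i) s = 1"
| "time (Dec i) s = 1"
| "time (Wr w) s = 1"
| "time (Seq c d) s = time c s + time d (sem c s)"
| "time (IfSym w c) s = (if fst s (int (snd s 0)) = w then Suc (time c s) else 1)"
| "time (Loop i c) s =
     Suc (\<Sum>k<snd s i. time c (dec i (((\<lambda>s. sem c (dec i s)) ^^ k) s)) + 2)"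

primrec mods :: "com \<Rightarrow> nat set" where
  "mods Nop = {}"
| "mods (Inc i) = {i}"
| "mods (Dec i) = {i}"
| "mods (Wr w) = {}"
| "mods (Seq c d) = mods c \<union> mods d"
| "mods (IfSym w c) = mods c"
| "mods (Loop i c) = insert i (mods c)"

text \<open>The five symbols are the blank 0, the bits 1 and 2, and the same bits with a guessed
  mark, 3 and 4.\<close>

primrec wf_com :: "com \<Rightarrow> bool" where
  "wf_com Nop = True"
| "wf_com (Inc i) = True"
| "wf_com (Dec i) = True"
| "wf_com (Wr w) = (w < 5)"
| "wf_com (Seq c d) = (wf_com c \<and> wf_com d)"
| "wf_com (IfSym w c) = wf_com c"
| "wf_com (Loop i c) = (i \<notin> mods c \<and> wf_com c)"

lemma sem_unmodified: "i \<notin> mods c \<Longrightarrow> snd (sem c s) i = snd s i"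
proof (induction c arbitrary: s)
  case (Loop j c)
  have "snd (((\<lambda>s. sem c (dec j s)) ^^ k) s) i = snd s i" for k s
    using Loop by (induction k) (auto simp: split_beta dec_def)
  then show ?case by simp
qed (auto simp: dec_def)

lemma loop_counter:
  assumes "i \<notin> mods c" "k \<le> snd s i"
  shows "snd (((\<lambda>s. sem c (dec i s)) ^^ k) s) i = snd s i - k"
  using assms(2)
proof (induction k)
  case (Suc k)
  then show ?case using sem_unmodified[OF assms(1)] by (auto simp: dec_def)
qed simp

lemma sem_symbols:
  "wf_com c \<Longrightarrow> (\<And>p. fst s p < 5) \<Longrightarrow> fst (sem c s) p < 5"
proof (induction c arbitrary: s p)
  case (Loop j c)
  have "fst (((\<lambda>s. sem c (dec j s)) ^^ k) s) p < 5" for k p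
  proof (induction k arbitrary: p)
    case (Suc k)
    then show ?case using Loop.IH[of "dec j (((\<lambda>s. sem c (dec j s)) ^^ k) s)"] Loop.prems
      by (auto simp: dec_def)
  qed (use Loop.prems in auto)
  then show ?case by simp
qed (auto simp: dec_def)

definition vecs :: "nat \<Rightarrow> nat list set" where
  "vecs K = {rs. set rs \<subseteq> {..<5} \<and> length rs = Suc K}"

definition trans :: "nat \<Rightarrow> nat \<Rightarrow> (nat list \<Rightarrow> bool) \<Rightarrow> (nat \<Rightarrow> nat \<Rightarrow> nat) \<Rightarrow> (nat \<Rightarrow> int) \<Rightarrow> nat
    \<Rightarrow> transition set" where
  "trans K q g w d q' =
     {(q, rs, q', map (\<lambda>j. (w j (rs ! j), d j)) [0..<Suc K]) | rs. rs \<in> vecs K \<and> g rs}"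

definition keep :: "nat \<Rightarrow> nat \<Rightarrow> nat" where "keep j s = s"

text \<open>Counter 0 lives on two tapes: as the head of the array tape 0, and as a mirror on tape
  1, whose marked origin allows the test for zero. Both heads move together.\<close>

definition mov :: "nat \<Rightarrow> int \<Rightarrow> nat \<Rightarrow> int" where
  "mov i e j = (if j = Suc i \<or> i = 0 \<and> j = 0 then e else 0)"

primrec len :: "com \<Rightarrow> nat" where
  "len Nop = 0"
| "len (Inc i) = 1"
| "len (Dec i) = 1"
| "len (Wr w) = 1"
| "len (Seq c d) = len c + len d"
| "len (IfSym w c) = Suc (len c)"
| "len (Loop i c) = Suc (Suc (len c))"

text \<open>The block for \<open>c\<close> owns the states from \<open>q\<close> up to, but
  excluding, \<open>q + len c\<close> and is left by reaching \<open>q + len c\<close>, so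
  sequencing is juxtaposition. \<open>Dec\<close> does not move at the mark 1, which gives truncated
  subtraction.\<close>

primrec code :: "nat \<Rightarrow> com \<Rightarrow> nat \<Rightarrow> transition set" where
  "code K Nop q = {}"
| "code K (Inc i) q = trans K q (\<lambda>_. True) keep (mov i 1) (Suc q)"
| "code K (Dec i) q = trans K q (\<lambda>rs. rs ! Suc i = 1) keep (\<lambda>_. 0) (Suc q)
     \<union> trans K q (\<lambda>rs. rs ! Suc i \<noteq> 1) keep (mov i (-1)) (Suc q)"
| "code K (Wr w) q = trans K q (\<lambda>_. True) (\<lambda>j s. if j = 0 then w else s) (\<lambda>_. 0) (Suc q)"
| "code K (Seq c d) q = code K c q \<union> code K d (q + len c)"
| "code K (IfSym w c) q = trans K q (\<lambda>rs. rs ! 0 = w) keep (\<lambda>_. 0) (Suc q)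
     \<union> trans K q (\<lambda>rs. rs ! 0 \<noteq> w) keep (\<lambda>_. 0) (Suc q + len c) \<union> code K c (Suc q)"
| "code K (Loop i c) q = trans K q (\<lambda>rs. rs ! Suc i = 1) keep (\<lambda>_. 0) (q + len c + 2)
     \<union> trans K q (\<lambda>rs. rs ! Suc i \<noteq> 1) keep (mov i (-1)) (Suc q) \<union> code K c (Suc q)
     \<union> trans K (Suc q + len c) (\<lambda>_. True) keep (\<lambda>_. 0) q"

definition mark :: "int \<Rightarrow> nat" where "mark = (\<lambda>_. 0)(0 := 1)"

definition conf :: "nat \<Rightarrow> nat \<Rightarrow> state \<Rightarrow> config" where
  "conf K q s = (q, (fst s, int (snd s 0)) # map (\<lambda>j. (mark, int (snd s j))) [0..<K])"

definition reads :: "nat \<Rightarrow> state \<Rightarrow> nat list" where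
  "reads K s = fst s (int (snd s 0)) # map (\<lambda>j. if snd s j = 0 then 1 else 0) [0..<K]"

lemma scanned_conf: "map scanned (snd (conf K q s)) = reads K s"
  by (simp add: conf_def reads_def mark_def)

lemma nth_reads: "j < K \<Longrightarrow> reads K s ! Suc j = (if snd s j = 0 then 1 else 0)"
  by (simp add: reads_def)

lemma reads_0: "reads K s ! 0 = fst s (int (snd s 0))"
  by (simp add: reads_def)

lemma reads_vecs: "(\<And>p. fst s p < 5) \<Longrightarrow> reads K s \<in> vecs K"
  by (auto simp: reads_def vecs_def)

lemma finite_trans: "finite (trans K q g w d q')"
proof -
  have "finite (vecs K)"
    unfolding vecs_def by (rule finite_lists_length_eq) simp
  then have "finite ((\<lambda>rs. (q, rs, q', map (\<lambda>j. (w j (rs ! j), d j)) [0..<Suc K])) ` vecs K)"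
    by simp
  then show ?thesis by (rule rev_finite_subset) (auto simp: trans_def)
qed

lemma act_trans:
  assumes "fst s' = (fst s)(int (snd s 0) := w 0 (fst s (int (snd s 0))))"
    and "int (snd s' 0) = int (snd s 0) + d 0"
    and "\<And>j. j < K \<Longrightarrow> int (snd s' j) = int (snd s j) + d (Suc j)"
    and "\<And>j x. j < K \<Longrightarrow> w (Suc j) x = x"
  shows "map2 act (snd (conf K q s)) (map (\<lambda>j. (w j (reads K s ! j), d j)) [0..<Suc K])
    = snd (conf K q' s')" (is "?l = _")
proof (rule nth_equalityI)
  fix i assume "i < length ?l"
  then have "i < Suc K" by (simp add: conf_def)
  then show "?l ! i = snd (conf K q' s') ! i"
    using assms by (cases i) (auto simp: conf_def reads_0 nth_reads mark_def simp del: upt_Suc)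
qed (simp add: conf_def)

lemma step_trans:
  assumes sub: "trans K q g w d q' \<subseteq> program M"
    and sym: "\<And>p. fst s p < 5" and g: "g (reads K s)"
    and res: "fst s' = (fst s)(int (snd s 0) := w 0 (fst s (int (snd s 0))))"
      "int (snd s' 0) = int (snd s 0) + d 0"
      "\<And>j. j < K \<Longrightarrow> int (snd s' j) = int (snd s j) + d (Suc j)"
      "\<And>j x. j < K \<Longrightarrow> w (Suc j) x = x"
  shows "(conf K q s, conf K q' s') \<in> step M"
proof -
  let ?as = "map (\<lambda>j. (w j (reads K s ! j), d j)) [0..<Suc K]"
  have "(q, reads K s, q', ?as) \<in> trans K q g w d q'"
    using reads_vecs[OF sym] g unfolding trans_def by blast
  then have 1: "(q, map scanned (snd (conf K q s)), q', ?as) \<in> program M"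
    using sub scanned_conf by auto
  have "map2 act (snd (conf K q s)) ?as = snd (conf K q' s')"
    using res by (rule act_trans)
  then show ?thesis
    using 1 unfolding step_def conf_def by force
qed

lemma relpow_trans': "(x, y) \<in> R ^^ m \<Longrightarrow> (y, z) \<in> R ^^ n \<Longrightarrow> (x, z) \<in> R ^^ (m + n)"
  by (auto simp: relpow_add)

lemma relpow_step: "(x, y) \<in> R \<Longrightarrow> (y, z) \<in> R ^^ n \<Longrightarrow> (x, z) \<in> R ^^ Suc n"
  by (rule relpow_Suc_I2)

lemma code_correct:
  assumes "code K c q \<subseteq> program M" "mods c \<subseteq> {..<K}" "wf_com c" "\<And>p. fst s p < 5" "0 < K"
  shows "(conf K q s, conf K (q + len c) (sem c s)) \<in> step M ^^ time c s"
  using assms(1-4)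
proof (induction c arbitrary: q s)
  case (Inc i)
  then show ?case using assms(5)
    by (auto intro!: step_trans[of _ _ "\<lambda>_. True" keep "mov i 1"] simp: mov_def keep_def)
next
  case (Dec i)
  have i: "i < K" using Dec by simp
  show ?case
  proof (cases "snd s i = 0")
    case True
    then have "(conf K q s, conf K (Suc q) (sem (Dec i) s)) \<in> step M" using Dec i
      by (intro step_trans[of _ _ "\<lambda>rs. rs ! Suc i = 1" keep "\<lambda>_. 0"])
        (auto simp: keep_def nth_reads dec_def)
    then show ?thesis by simp
  next
    case False
    then have "(conf K q s, conf K (Suc q) (sem (Dec i) s)) \<in> step M" using Dec i
      by (intro step_trans[of _ _ "\<lambda>rs. rs ! Suc i \<noteq> 1" keep "mov i (-1)"])
        (auto simp: keep_def nth_reads dec_def mov_def)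
    then show ?thesis by simp
  qed
next
  case (Wr w)
  have "(conf K q s, conf K (Suc q) (sem (Wr w) s)) \<in> step M" using Wr
      by (intro step_trans[of _ _ "\<lambda>_. True" "\<lambda>j s. if j = 0 then w else s" "\<lambda>_. 0"]) auto
  then show ?case by simp
next
  case (Seq c d)
  have "(conf K q s, conf K (q + len c) (sem c s)) \<in> step M ^^ time c s"
    using Seq.prems by (intro Seq.IH) auto
  moreover have "(conf K (q + len c) (sem c s), conf K (q + len c + len d) (sem d (sem c s)))
      \<in> step M ^^ time d (sem c s)"
    using Seq.prems by (intro Seq.IH) (auto intro: sem_symbols)
  ultimately show ?case by (auto intro: relpow_trans' simp: add.assoc)
next
  case (IfSym w c)
  show ?case
  proof (cases "fst s (int (snd s 0)) = w")
    case True
    then have "(conf K q s, conf K (Suc q) s) \<in> step M" using IfSym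
      by (intro step_trans[of _ _ "\<lambda>rs. rs ! 0 = w" keep "\<lambda>_. 0"]) (auto simp: keep_def reads_0)
    moreover have "(conf K (Suc q) s, conf K (Suc q + len c) (sem c s)) \<in> step M ^^ time c s"
      using IfSym.prems by (intro IfSym.IH) auto
    ultimately show ?thesis using True relpow_step[of "conf K q s" "conf K (Suc q) s"]
      by simp
  next
    case False
    then have "(conf K q s, conf K (Suc q + len c) s) \<in> step M" using IfSym
      by (intro step_trans[of _ _ "\<lambda>rs. rs ! 0 \<noteq> w" keep "\<lambda>_. 0"]) (auto simp: keep_def reads_0)
    then show ?thesis using False by simp
  qed
next
  case (Loop i c)
  let ?F = "\<lambda>s. sem c (dec i s)"
  have i: "i < K" "i \<notin> mods c" and c: "mods c \<subseteq> {..<K}" "wf_com c" using Loop.prems by auto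
  have sym: "fst ((?F ^^ k) s) p < 5" for k p
  proof (induction k arbitrary: p)
    case (Suc k)
    then show ?case using sem_symbols[OF c(2), of "dec i ((?F ^^ k) s)"]
      by (auto simp: dec_def)
  qed (use Loop.prems in auto)
  \<comment> \<open>\<open>k\<close> rounds lead from state \<open>q\<close> back to
    \<open>q\<close>. By \<open>loop_counter\<close> the remaining value of \<open>i\<close> is
    known, so the test succeeds as long as \<open>k < snd s i\<close>.\<close>
  have iter: "(conf K q s, conf K q ((?F ^^ k) s)) \<in>
      step M ^^ (\<Sum>j<k. time c (dec i ((?F ^^ j) s)) + 2)" if "k \<le> snd s i" for k
    using that
  proof (induction k)
    case (Suc k)
    let ?s = "(?F ^^ k) s"
    have nz: "snd ?s i \<noteq> 0" using loop_counter[OF i(2), of k s] Suc.prems by simp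
    have "(conf K q ?s, conf K (Suc q) (dec i ?s)) \<in> step M" using Loop.prems i nz sym[of k]
      by (intro step_trans[of _ _ "\<lambda>rs. rs ! Suc i \<noteq> 1" keep "mov i (-1)"])
        (auto simp: keep_def nth_reads dec_def mov_def)
    moreover have "(conf K (Suc q) (dec i ?s), conf K (Suc q + len c) (?F ?s))
        \<in> step M ^^ time c (dec i ?s)"
      using Loop.prems sym[of k] by (intro Loop.IH) (auto simp: dec_def)
    moreover have "(conf K (Suc q + len c) (?F ?s), conf K q (?F ?s)) \<in> step M"
      using Loop.prems sym[of "Suc k"]
      by (intro step_trans[of _ _ "\<lambda>_. True" keep "\<lambda>_. 0"]) (auto simp: keep_def)
    ultimately have "(conf K q ?s, conf K q (?F ?s)) \<in> step M ^^ (Suc (Suc (time c (dec i ?s))))"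
      by (intro relpow_step relpow_Suc_I)
    then have "(conf K q ?s, conf K q (?F ?s)) \<in> step M ^^ (time c (dec i ?s) + 2)" by simp
    from relpow_trans'[OF Suc.IH[OF Suc_leD[OF Suc.prems]] this]
    show ?case by simp
  qed simp
  let ?s = "sem (Loop i c) s"
  have "snd ?s i = 0" using loop_counter[OF i(2), of "snd s i" s] by simp
  then have "(conf K q ?s, conf K (q + len c + 2) ?s) \<in> step M" using Loop.prems i sym
    by (intro step_trans[of _ _ "\<lambda>rs. rs ! Suc i = 1" keep "\<lambda>_. 0"])
      (auto simp: keep_def nth_reads)
  then have "(conf K q s, conf K (q + len c + 2) ?s) \<in>
      step M ^^ Suc (\<Sum>j<snd s i. time c (dec i ((?F ^^ j) s)) + 2)"
    using iter[of "snd s i"] by (intro relpow_Suc_I[of _ "conf K q ?s"]) simp_all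
  then show ?case by simp
qed simp

subsection \<open>Determinism\<close>

definition srcs :: "transition set \<Rightarrow> (nat \<times> nat list) set" where
  "srcs P = (\<lambda>(q, rs, _). (q, rs)) ` P"

definition det :: "transition set \<Rightarrow> bool" where
  "det P \<longleftrightarrow> (\<forall>q rs q1 as1 q2 as2. (q, rs, q1, as1) \<in> P \<longrightarrow> (q, rs, q2, as2) \<in> P \<longrightarrow>
     q1 = q2 \<and> as1 = as2)"

lemma srcs_I: "(q, rs, q', as) \<in> P \<Longrightarrow> (q, rs) \<in> srcs P"
  by (force simp: srcs_def)

lemma det_Un: "det P \<Longrightarrow> det Q \<Longrightarrow> srcs P \<inter> srcs Q = {} \<Longrightarrow> det (P \<union> Q)"
  unfolding det_def disjoint_iff by (metis UnE srcs_I)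

lemma det_trans: "det (trans K q g w d q')"
  by (auto simp: det_def trans_def)

lemma srcs_Un: "srcs (P \<union> Q) = srcs P \<union> srcs Q"
  by (simp add: srcs_def image_Un)

lemma srcs_trans: "srcs (trans K q g w d q') \<subseteq> {q} \<times> Collect g"
  by (auto simp: srcs_def trans_def)

text \<open>Different blocks start from disjoint intervals of states, so for determinism only the
  transitions at one state remain, and there the guards exclude each other.\<close>

lemma srcs_code: "srcs (code K c q) \<subseteq> {q..<q + len c} \<times> UNIV"
proof (induction c arbitrary: q)
  case Nop then show ?case by (simp add: srcs_def)
next
  case (Seq c d) then show ?case using Seq(1)[of q] Seq(2)[of "q + len c"] by (fastforce simp: srcs_Un)
next
  case (IfSym w c) then show ?case using IfSym[of "Suc q"] by (fastforce simp: srcs_Un dest!: srcs_trans[THEN subsetD])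
next
  case (Loop i c) then show ?case using Loop[of "Suc q"] by (fastforce simp: srcs_Un dest!: srcs_trans[THEN subsetD])
qed (auto simp: srcs_Un dest!: srcs_trans[THEN subsetD])

lemma det_code: "det (code K c q)"
proof (induction c arbitrary: q)
  case Nop then show ?case by (simp add: det_def)
next
  case (Seq c d)
  then show ?case using srcs_code[of K c q] srcs_code[of K d "q + len c"]
    by (fastforce intro!: det_Un)
next
  case (IfSym w c)
  then show ?case using srcs_code[of K c "Suc q"]
    by (fastforce intro!: det_Un det_trans simp: srcs_Un dest!: srcs_trans[THEN subsetD])
next
  case (Loop i c)
  then show ?case using srcs_code[of K c "Suc q"]
    by (fastforce intro!: det_Un det_trans simp: srcs_Un dest!: srcs_trans[THEN subsetD])
qed (auto intro!: det_Un det_trans simp: srcs_Un dest!: srcs_trans[THEN subsetD])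

definition wf_prog :: "nat \<Rightarrow> transition set \<Rightarrow> bool" where
  "wf_prog K P \<longleftrightarrow> finite P \<and> (\<forall>(q, rs, q', as) \<in> P.
     length rs = Suc K \<and> length as = Suc K \<and> (\<forall>(w, d) \<in> set as. d \<in> {-1, 0, 1}))"

lemma wf_prog_Un: "wf_prog K P \<Longrightarrow> wf_prog K Q \<Longrightarrow> wf_prog K (P \<union> Q)"
  by (auto simp: wf_prog_def)

lemma wf_prog_trans: "(\<And>j. d j \<in> {-1, 0, 1}) \<Longrightarrow> wf_prog K (trans K q g w d q')"
  using finite_trans unfolding wf_prog_def by (auto simp: trans_def vecs_def)

lemma wf_prog_code: "wf_prog K (code K c q)"
proof (induction c arbitrary: q)
  case Nop then show ?case by (simp add: wf_prog_def)
qed (simp_all add: wf_prog_Un wf_prog_trans mov_def)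

text \<open>No transition leads back before the block; hence a run that has entered the code never
  returns to the scan in state 1, where guessing takes place.\<close>

lemma code_targets: "(q1, rs, q2, as) \<in> code K c q \<Longrightarrow> q \<le> q2"
  by (induction c arbitrary: q) (auto simp: trans_def dest!: Suc_leD, (fastforce dest: Suc_leD)+)

text \<open>
  State 0 writes the markers. State 1 moves to the end of the input and stores its length in the
  counters 0 and 1; if \<open>guess\<close> is set, it may add 2 to any symbol on its way. After the code of
  \<open>c\<close>, which begins in state 2, a nonzero counter 3 leads to the accepting state.
\<close>

definition mach_prog :: "bool \<Rightarrow> nat \<Rightarrow> com \<Rightarrow> transition set" where
  "mach_prog guess K c =
     (trans K 0 (\<lambda>_. True) (\<lambda>j s. if j = 0 then s else 1) (\<lambda>_. 0) 1
      \<union> (trans K 1 (\<lambda>rs. rs ! 0 = 0) keep (\<lambda>_. 0) 2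
      \<union> trans K 1 (\<lambda>rs. rs ! 0 \<noteq> 0) keep (\<lambda>j. if j \<le> 2 then 1 else 0) 1))
      \<union> (if guess then trans K 1 (\<lambda>rs. rs ! 0 \<in> {1, 2}) (\<lambda>j s. if j = 0 then s + 2 else s)
           (\<lambda>j. if j \<le> 2 then 1 else 0) 1 else {})
      \<union> (code K c 2 \<union> trans K (2 + len c) (\<lambda>rs. rs ! 4 \<noteq> 1) keep (\<lambda>_. 0) (3 + len c))"

definition mach :: "bool \<Rightarrow> nat \<Rightarrow> com \<Rightarrow> tm" where
  "mach guess K c = \<lparr>num_tapes = Suc K, start_state = 0, accept_state = 3 + len c,
     program = mach_prog guess K c\<rparr>"

definition masked :: "bool list \<Rightarrow> nat set \<Rightarrow> int \<Rightarrow> nat" where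
  "masked x Y p = (if 0 \<le> p \<and> p < int (length x)
     then bit_symbol (x ! nat p) + (if nat p \<in> Y then 2 else 0) else 0)"

text \<open>Three heads move during the scan: that of the array, its mirror for counter 0 on tape 1,
  and counter 1 on tape 2.\<close>

definition cnt :: "nat \<Rightarrow> nat \<Rightarrow> nat" where "cnt k = (\<lambda>_. 0)(0 := k, 1 := k)"

lemma masked_less: "masked x Y p < 5"
  by (auto simp: masked_def bit_symbol_def)

lemma wf_mach: "wf_tm (mach guess K c)"
proof -
  have "wf_prog K (mach_prog guess K c)"
    unfolding mach_prog_def
    by (auto intro!: wf_prog_Un wf_prog_trans wf_prog_code simp: wf_prog_def[of _ "{}"] split: if_splits)
  then show ?thesis by (simp add: wf_prog_def wf_tm_def mach_def)
qed

lemma deterministic_mach: "deterministic_tm (mach False K c)"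
proof -
  have "det (mach_prog False K c)"
    using srcs_code[of K c 2] unfolding mach_prog_def if_False Un_empty_right
    by (intro det_Un det_trans det_code) (fastforce simp: srcs_Un dest!: srcs_trans[THEN subsetD])+
  then show ?thesis by (simp add: deterministic_tm_def det_def mach_def)
qed

lemma step_conf_inv:
  assumes "(conf K q s, d) \<in> step M"
  shows "\<exists>q' as. (q, reads K s, q', as) \<in> program M \<and> d = (q', map2 act (snd (conf K q s)) as)"
  using assms scanned_conf[of K q s] unfolding step_def by (auto simp: conf_def)

section \<open>Runs of the compiled machine: scan of the input, then the code\<close>

context
  fixes guess :: bool and K :: nat and c :: com and M :: tm
  assumes K: "4 \<le> K" and M: "M = mach guess K c"
begin

definition pre :: "bool list \<Rightarrow> nat set \<Rightarrow> nat \<Rightarrow> config" where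
  "pre x Y k = conf K 1 (masked x Y, cnt k)"

lemma program_M: "program M = mach_prog guess K c"
  by (simp add: M mach_def)

lemma initial_step: "(initial M x, d) \<in> step M \<longleftrightarrow> d = pre x {} 0"
proof -
  let ?as = "\<lambda>rs. map (\<lambda>j. (if j = 0 then rs ! j else 1, 0 :: int)) [0..<Suc K]"
  let ?rs = "map scanned (snd (initial M x))"
  have tapes: "snd (initial M x) = (masked x {}, 0) # replicate K (\<lambda>_. 0, 0)"
    by (auto simp: initial_def input_tape_def masked_def M mach_def)
  have rs: "?rs \<in> vecs K"
    using masked_less[of x "{}" 0] by (auto simp: tapes vecs_def)
  have prog: "(0, rs, q', as) \<in> program M \<longleftrightarrow> rs \<in> vecs K \<and> q' = 1 \<and> as = ?as rs" for rs q' as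
    using srcs_code[of K c 2]
    by (auto simp: program_M mach_prog_def trans_def dest: srcs_I simp del: upt_Suc)
  have "map2 act (snd (initial M x)) (?as ?rs) = snd (pre x {} 0)" (is "?l = _")
  proof (rule nth_equalityI)
    fix i assume "i < length ?l"
    then have "i < Suc K" by (simp add: tapes)
    then show "?l ! i = snd (pre x {} 0) ! i"
      by (cases i) (auto simp: tapes pre_def conf_def mark_def cnt_def nth_Cons' simp del: upt_Suc)
  qed (simp add: tapes pre_def conf_def)
  moreover have "fst (pre x {} 0) = 1" by (simp add: pre_def conf_def)
  moreover have "fst (initial M x) = 0" by (simp add: initial_def M mach_def)
  ultimately have *: "initial M x = (0, snd (initial M x))"
    "pre x {} 0 = (1, map2 act (snd (initial M x)) (?as ?rs))"
    by (metis prod.collapse)+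
  show ?thesis
    unfolding *(2) using rs by (subst *(1)) (auto simp: step_def prog simp del: upt_Suc)
qed

lemma program_1:
  assumes "(1, rs, q', as) \<in> program M"
  shows "as = map (\<lambda>j. (keep j (rs ! j), 0)) [0..<Suc K] \<and> q' = 2 \<and> rs ! 0 = 0
    \<or> as = map (\<lambda>j. (keep j (rs ! j), if j \<le> 2 then 1 else 0)) [0..<Suc K] \<and> q' = 1 \<and> rs ! 0 \<noteq> 0
    \<or> as = map (\<lambda>j. (if j = 0 then rs ! j + 2 else rs ! j, if j \<le> 2 then 1 else 0)) [0..<Suc K]
      \<and> guess \<and> q' = 1 \<and> rs ! 0 \<in> {1, 2}"
  using assms srcs_code[of K c 2]
  by (auto simp: program_M mach_prog_def trans_def dest: srcs_I simp del: upt_Suc split: if_splits)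

lemma pre_step:
  assumes "k < length x"
  shows "(pre x Y k, pre x Y (Suc k)) \<in> step M"
  unfolding pre_def
  by (rule step_trans[of _ _ "\<lambda>rs. rs ! 0 \<noteq> 0" keep "\<lambda>j. if j \<le> 2 then 1 else 0"])
    (use K assms in \<open>auto simp: program_M mach_prog_def masked_less reads_0 keep_def cnt_def
      masked_def bit_symbol_def\<close>)

lemma masked_insert:
  assumes "k < length x" "Y \<subseteq> {..<k}"
  shows "masked x (insert k Y) = (masked x Y)(int k := masked x Y (int k) + 2)"
  using assms by (auto simp: fun_eq_iff masked_def)

lemma pre_step_guess:
  assumes "k < length x" "Y \<subseteq> {..<k}" guess
  shows "(pre x Y k, pre x (insert k Y) (Suc k)) \<in> step M"
  unfolding pre_def
  by (rule step_trans[of _ _ "\<lambda>rs. rs ! 0 \<in> {1, 2}" "\<lambda>j s. if j = 0 then s + 2 else s"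
        "\<lambda>j. if j \<le> 2 then 1 else 0"])
    (use K assms in \<open>auto simp: program_M mach_prog_def masked_less reads_0 cnt_def
      masked_insert masked_def bit_symbol_def\<close>)

lemma pre_last: "(pre x Y (length x), conf K 2 (masked x Y, cnt (length x))) \<in> step M"
  unfolding pre_def
  by (rule step_trans[of _ _ "\<lambda>rs. rs ! 0 = 0" keep "\<lambda>_. 0"])
    (use K in \<open>auto simp: program_M mach_prog_def masked_less reads_0 keep_def cnt_def\<close>, simp add: masked_def)

text \<open>Marks sit only to the left of the head, so the cell under the head still carries a plain
  bit and a guessing step amounts to inserting \<open>k\<close> into \<open>Y\<close>.\<close>

lemma pre_step_inv:
  assumes "(pre x Y k, d) \<in> step M" "Y \<subseteq> {..<k}" "k \<le> length x"
  shows "if k < length x then \<exists>Y' \<subseteq> {..<Suc k}. d = pre x Y' (Suc k)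
    else d = conf K 2 (masked x Y, cnt (length x))"
proof -
  let ?s = "(masked x Y, cnt k)"
  have r0: "reads K ?s ! 0 = 0 \<longleftrightarrow> k = length x"
    using assms(3) by (auto simp: reads_0 cnt_def masked_def bit_symbol_def)
  obtain q' as where "(1, reads K ?s, q', as) \<in> program M"
    and d: "d = (q', map2 act (snd (conf K 1 ?s)) as)"
    using step_conf_inv[OF assms(1)[unfolded pre_def]] by auto
  from program_1[OF this(1)] show ?thesis
  proof (elim disjE conjE, goal_cases)
    case a: 1
    have "map2 act (snd (conf K 1 ?s)) as = snd (conf K 2 (masked x Y, cnt (length x)))"
      unfolding a(1) using a r0 by (intro act_trans) (auto simp: keep_def)
    then show ?thesis using a r0 d by (simp add: conf_def)
  next
    case b: 2
    have "map2 act (snd (conf K 1 ?s)) as = snd (pre x Y (Suc k))"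
      unfolding b(1) pre_def using K by (intro act_trans) (auto simp: keep_def cnt_def)
    then have "d = pre x Y (Suc k)" using b d by (simp add: conf_def pre_def)
    moreover have "Y \<subseteq> {..<Suc k}" using assms by auto
    moreover have "k < length x" using assms b r0 by auto
    ultimately show ?thesis by auto
  next
    case c: 3
    have k: "k < length x" using assms c r0 by auto
    have "map2 act (snd (conf K 1 ?s)) as = snd (pre x (insert k Y) (Suc k))"
      unfolding c(1) pre_def using K k assms by (intro act_trans) (auto simp: masked_insert cnt_def)
    then have "d = pre x (insert k Y) (Suc k)" using c d by (simp add: conf_def pre_def)
    moreover have "insert k Y \<subseteq> {..<Suc k}" using assms by auto
    ultimately show ?thesis using k by (simp del: insert_subset) blast
  qed
qed

lemma pre_reach:
  assumes "Y \<subseteq> {..<length x}" "guess \<or> Y = {}" "k \<le> length x"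
  shows "(initial M x, pre x (Y \<inter> {..<k}) k) \<in> step M ^^ Suc k"
  using assms(3)
proof (induction k)
  case 0
  show ?case using initial_step by simp
next
  case (Suc k)
  have "(pre x (Y \<inter> {..<k}) k, pre x (Y \<inter> {..<Suc k}) (Suc k)) \<in> step M"
  proof (cases "k \<in> Y")
    case True
    then have "Y \<inter> {..<Suc k} = insert k (Y \<inter> {..<k})" by auto
    with True show ?thesis using pre_step_guess[of k x "Y \<inter> {..<k}"] assms Suc by auto
  next
    case False
    then have "Y \<inter> {..<Suc k} = Y \<inter> {..<k}" by (auto simp: less_Suc_eq)
    then show ?thesis using pre_step[of k x] Suc by auto
  qed
  then show ?case using Suc relpow_Suc_I by (metis Suc_leD)
qed

lemma start_reach:
  assumes "Y \<subseteq> {..<length x}" "guess \<or> Y = {}"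
  shows "(initial M x, conf K 2 (masked x Y, cnt (length x))) \<in> step M ^^ (length x + 2)"
proof -
  have "Y \<inter> {..<length x} = Y" using assms by auto
  then have "(initial M x, pre x Y (length x)) \<in> step M ^^ Suc (length x)"
    using pre_reach[OF assms, of "length x"] by simp
  from relpow_Suc_I[OF this pre_last] show ?thesis by simp
qed

text \<open>All paths are classified, not only accepting ones, because \<open>NP\<close> bounds them
  all. In the first case the state is too small to be accepting; in the second the guess is complete
  and the rest is a run of the code.\<close>

lemma paths:
  assumes "(initial M x, d) \<in> step M ^^ m"
  shows "m \<le> length x + 1 \<and> fst d < 2 \<or>
    length x + 2 \<le> m \<and> (\<exists>Y \<subseteq> {..<length x}.
      (conf K 2 (masked x Y, cnt (length x)), d) \<in> step M ^^ (m - (length x + 2)))"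
proof -
  have "m = 0 \<and> d = initial M x \<or>
    (\<exists>k Y. m = Suc k \<and> k \<le> length x \<and> Y \<subseteq> {..<k} \<and> d = pre x Y k) \<or>
    length x + 2 \<le> m \<and> (\<exists>Y \<subseteq> {..<length x}.
      (conf K 2 (masked x Y, cnt (length x)), d) \<in> step M ^^ (m - (length x + 2)))"
    using assms
  proof (induction m arbitrary: d)
    case (Suc m)
    obtain e where e: "(initial M x, e) \<in> step M ^^ m" and ed: "(e, d) \<in> step M"
      using Suc.prems by auto
    from Suc.IH[OF e] consider (a) "m = 0" "e = initial M x"
      | (b) k Y where "m = Suc k" "k \<le> length x" "Y \<subseteq> {..<k}" "e = pre x Y k"
      | (c) Y where "length x + 2 \<le> m" "Y \<subseteq> {..<length x}"
         "(conf K 2 (masked x Y, cnt (length x)), e) \<in> step M ^^ (m - (length x + 2))"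
      by blast
    then show ?case
    proof cases
      case a then show ?thesis using ed initial_step by auto
    next
      case b
      show ?thesis
      proof (cases "k < length x")
        case True
        then show ?thesis using pre_step_inv[of x Y k d] b ed by auto
      next
        case False
        then have k: "k = length x" using b by simp
        then have d: "d = conf K 2 (masked x Y, cnt (length x))"
          using pre_step_inv[of x Y k d] b ed by auto
        show ?thesis
          by (intro disjI2 conjI exI[of _ Y]) (use b k d in auto)
      qed
    next
      case c
      have "(conf K 2 (masked x Y, cnt (length x)), d) \<in> step M ^^ Suc (m - (length x + 2))"
        using c(3) ed by (rule relpow_Suc_I)
      moreover have "Suc (m - (length x + 2)) = Suc m - (length x + 2)" using c by simp
      ultimately show ?thesis using c by (metis le_SucI)
    qed
  qed auto
  then show ?thesis
    by (auto simp: initial_def M mach_def pre_def conf_def)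
qed

text \<open>Tape 4, tested by the last transition, belongs to counter 3. If this counter is zero,
  the machine is stuck right after the code; otherwise one more step accepts.\<close>

definition final :: "state \<Rightarrow> config" where
  "final s = (if snd (sem c s) 3 = 0 then conf K (2 + len c) (sem c s)
    else conf K (3 + len c) (sem c s))"

lemma program_2:
  assumes "(q, rs, q', as) \<in> program M" "2 \<le> q"
  shows "(q, rs, q', as) \<in> code K c 2 \<union> trans K (2 + len c) (\<lambda>rs. rs ! 4 \<noteq> 1) keep (\<lambda>_. 0) (3 + len c)"
  using assms by (auto simp: program_M mach_prog_def trans_def simp del: upt_Suc split: if_splits)

lemma halting_final: "halting M (final s)"
proof -
  have "False" if "(final s, d) \<in> step M" for d
  proof (cases "snd (sem c s) 3 = 0")
    case True
    then have "final s = conf K (2 + len c) (sem c s)" by (simp add: final_def)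
    with that have "(conf K (2 + len c) (sem c s), d) \<in> step M" by simp
    from step_conf_inv[OF this] obtain q' as where
      "(2 + len c, reads K (sem c s), q', as) \<in> program M" by blast
    from program_2[OF this] show False
      using True K nth_reads[of 3 K "sem c s"] srcs_code[of K c 2]
      by (auto simp: trans_def dest!: srcs_I)
  next
    case False
    then have "final s = conf K (3 + len c) (sem c s)" by (simp add: final_def)
    with that have "(conf K (3 + len c) (sem c s), d) \<in> step M" by simp
    from step_conf_inv[OF this] obtain q' as where
      "(3 + len c, reads K (sem c s), q', as) \<in> program M" by blast
    from program_2[OF this] show False
      using srcs_code[of K c 2]
      by (auto simp: trans_def dest!: srcs_I)
  qed
  then show ?thesis by (auto simp: halting_def)
qed

lemma final_reach:
  assumes "mods c \<subseteq> {..<K}" "wf_com c" "\<And>p. fst s p < 5"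
  shows "\<exists>t \<le> Suc (time c s). (conf K 2 s, final s) \<in> step M ^^ t"
proof -
  have 1: "(conf K 2 s, conf K (2 + len c) (sem c s)) \<in> step M ^^ time c s"
    using assms K by (intro code_correct) (auto simp: program_M mach_prog_def)
  show ?thesis
  proof (cases "snd (sem c s) 3 = 0")
    case True
    then show ?thesis using 1 by (auto simp: final_def intro!: exI[of _ "time c s"])
  next
    case False
    have "(conf K (2 + len c) (sem c s), conf K (3 + len c) (sem c s)) \<in> step M"
      by (rule step_trans[of _ _ "\<lambda>rs. rs ! 4 \<noteq> 1" keep "\<lambda>_. 0"])
        (use K False sem_symbols[OF assms(2,3)] nth_reads[of 3 K "sem c s"] in
          \<open>auto simp: program_M mach_prog_def keep_def\<close>)
    from relpow_Suc_I[OF 1 this] show ?thesis using False by (auto simp: final_def simp del: relpow.simps)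
  qed
qed

text \<open>Guessing happens in state 1 only, so the machine is deterministic from state 2 on even
  if \<open>guess\<close> is set.\<close>

lemma step_unique:
  assumes "(d, e) \<in> step M" "(d, f) \<in> step M" "2 \<le> fst d"
  shows "e = f"
proof -
  define P where "P = code K c 2 \<union> trans K (2 + len c) (\<lambda>rs. rs ! 4 \<noteq> 1) keep (\<lambda>_. 0) (3 + len c)"
  have "det P" unfolding P_def
    using srcs_code[of K c 2]
    by (intro det_Un det_trans det_code) (fastforce dest!: srcs_trans[THEN subsetD])
  obtain q ts q1 as1 where 1: "d = (q, ts)" "e = (q1, map2 act ts as1)"
      "(q, map scanned ts, q1, as1) \<in> program M"
    using assms(1) by (auto simp: step_def)
  obtain q2 as2 where 2: "f = (q2, map2 act ts as2)"
      "(q, map scanned ts, q2, as2) \<in> program M"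
    using assms(2) 1 by (auto simp: step_def)
  have "2 \<le> q" using assms(3) 1 by simp
  then have "(q, map scanned ts, q1, as1) \<in> P" "(q, map scanned ts, q2, as2) \<in> P"
    unfolding P_def by (rule program_2[OF 1(3)], rule program_2[OF 2(2)])
  with \<open>det P\<close> have "q1 = q2 \<and> as1 = as2" unfolding det_def by blast
  then show ?thesis using 1 2 by simp
qed

lemma step_states: "(d, e) \<in> step M \<Longrightarrow> 2 \<le> fst d \<Longrightarrow> 2 \<le> fst e"
proof -
  assume "(d, e) \<in> step M" "2 \<le> fst d"
  then obtain rs as where "(fst d, rs, fst e, as) \<in> program M" by (auto simp: step_def)
  from program_2[OF this \<open>2 \<le> fst d\<close>] show ?thesis
    by (auto simp: trans_def dest: code_targets)
qed

text \<open>Without branching, every path from \<open>d\<close> is a prefix of the halting run, so a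
  bound for this one run bounds all paths.\<close>

lemma unique_run:
  assumes "(d, f) \<in> step M ^^ n" "halting M f" "2 \<le> fst d" "(d, e) \<in> step M ^^ m"
  shows "m \<le> n \<and> (e, f) \<in> step M ^^ (n - m)"
  using assms
proof (induction n arbitrary: d m)
  case 0
  then have "d = f" by simp
  show ?case
  proof (cases m)
    case (Suc k)
    then show ?thesis using 0 \<open>d = f\<close> relpow_Suc_D2 unfolding halting_def by metis
  qed (use 0 in auto)
next
  case (Suc n)
  show ?case
  proof (cases m)
    case (Suc m')
    obtain d1 where d1: "(d, d1) \<in> step M" "(d1, f) \<in> step M ^^ n"
      using Suc.prems(1) relpow_Suc_D2 by metis
    obtain d2 where d2: "(d, d2) \<in> step M" "(d2, e) \<in> step M ^^ m'"
      using Suc.prems(4) relpow_Suc_D2 unfolding Suc by metis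
    have "d2 = d1" using step_unique d1 d2 Suc.prems by blast
    then show ?thesis using Suc.IH[of d1 m'] Suc d1 d2 Suc.prems step_states by auto
  qed (use Suc in auto)
qed

end

section \<open>From counter programs to polynomial time and NP\<close>

lemma enough_tapes: "\<exists>K \<ge> 4. mods c \<subseteq> {..<K}"
proof -
  have "finite (mods c)" by (induction c) auto
  then obtain k where "mods c \<subseteq> {..<k}" using finite_nat_bounded by blast
  then show ?thesis by (intro exI[of _ "max 4 k"]) auto
qed

theorem polytime_computable_com:
  fixes f :: "bool list \<Rightarrow> bool list" and p :: "nat poly"
  assumes wf: "wf_com c"
    and run: "\<And>x. let s = (masked x {}, cnt (length x)); s' = sem c s in
      time c s \<le> poly p (length x) \<and> snd s' 3 = 0 \<and>
      (\<forall>i < length (f x). fst s' (int (snd s' 0) + int i) = bit_symbol (f x ! i)) \<and>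
      fst s' (int (snd s' 0) + int (length (f x))) = 0"
  shows "polytime_computable f"
proof -
  obtain K where K: "4 \<le> K" "mods c \<subseteq> {..<K}" using enough_tapes by blast
  \<comment> \<open>Before the code there are \<open>length x + 2\<close> steps: one for the
    markers, one per input symbol and one at the blank.\<close>
  let ?M = "mach False K c" and ?q = "p + [:2, 1:]"
  have "\<exists>n \<le> poly ?q (length x). \<exists>d. (initial ?M x, d) \<in> step ?M ^^ n \<and> halting ?M d \<and> outputs d (f x)"
    for x
  proof -
    let ?s = "(masked x {}, cnt (length x))"
    have f: "final K c ?s = conf K (2 + len c) (sem c ?s)"
      using run[of x] by (simp add: final_def[OF K(1) refl] Let_def)
    have 1: "(initial ?M x, conf K 2 ?s) \<in> step ?M ^^ (length x + 2)"
      by (rule start_reach[OF K(1) refl]) auto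
    have 2: "(conf K 2 ?s, conf K (2 + len c) (sem c ?s)) \<in> step ?M ^^ time c ?s"
      using K wf by (intro code_correct) (auto simp: mach_def mach_prog_def masked_less)
    have "(initial ?M x, final K c ?s) \<in> step ?M ^^ (length x + 2 + time c ?s)"
      using relpow_trans'[OF 1 2] f by simp
    moreover have "outputs (final K c ?s) (f x)"
      using run[of x] unfolding f by (auto simp: outputs_def conf_def Let_def)
    moreover have "length x + 2 + time c ?s \<le> poly ?q (length x)"
      using run[of x] by (simp add: Let_def)
    ultimately show ?thesis using halting_final[OF K(1) refl] by blast
  qed
  then show ?thesis unfolding polytime_computable_def
    using wf_mach deterministic_mach by blast
qed

theorem NP_com:
  fixes p :: "nat poly"
  assumes wf: "wf_com c"
    and bound: "\<And>x Y. time c (masked x Y, cnt (length x)) \<le> poly p (length x)"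
  shows "{x. \<exists>Y \<subseteq> {..<length x}. snd (sem c (masked x Y, cnt (length x))) 3 \<noteq> 0} \<in> NP"
proof -
  obtain K where K: "4 \<le> K" "mods c \<subseteq> {..<K}" using enough_tapes by blast
  \<comment> \<open>One step more than in the deterministic case, for the transition into the
    accepting state.\<close>
  let ?M = "mach True K c" and ?q = "p + [:3, 1:]"
  let ?s = "\<lambda>x Y. (masked x Y, cnt (length x))"
  have fin: "\<exists>t \<le> Suc (time c (?s x Y)). (conf K 2 (?s x Y), final K c (?s x Y)) \<in> step ?M ^^ t" for x Y
    using K wf by (intro final_reach[OF _ refl]) (auto simp: masked_less)
  have acc: "fst (final K c s) = accept_state ?M \<longleftrightarrow> snd (sem c s) 3 \<noteq> 0" for s
    by (simp add: final_def[OF K(1) refl] conf_def mach_def)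
  have uniq: "m \<le> t \<and> (d, final K c (?s x Y)) \<in> step ?M ^^ (t - m)"
    if "(conf K 2 (?s x Y), final K c (?s x Y)) \<in> step ?M ^^ t" "(conf K 2 (?s x Y), d) \<in> step ?M ^^ m"
    for x Y t m d
    using that halting_final[OF K(1) refl] by (intro unique_run[OF K(1) refl]) (auto simp: conf_def)
  have "n \<le> poly ?q (length x)" if run: "(initial ?M x, d) \<in> step ?M ^^ n" for x n d
  proof -
    consider "n \<le> length x + 1" | Y where "length x + 2 \<le> n"
      "(conf K 2 (?s x Y), d) \<in> step ?M ^^ (n - (length x + 2))"
      using paths[OF K(1) refl run] by blast
    then show ?thesis
    proof cases
      case 2
      then have "n - (length x + 2) \<le> Suc (time c (?s x Y))" using fin uniq le_trans by meson
      then show ?thesis using 2 bound[of x Y] by simp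
    qed simp
  qed
  moreover have "accepts ?M x \<longleftrightarrow> (\<exists>Y \<subseteq> {..<length x}. snd (sem c (?s x Y)) 3 \<noteq> 0)" for x
  proof
    assume "accepts ?M x"
    then obtain d n where d: "(initial ?M x, d) \<in> step ?M ^^ n" "halting ?M d" "fst d = accept_state ?M"
      by (auto simp: accepts_def dest: rtrancl_imp_relpow)
    have "\<not> fst d < 2" using d by (simp add: mach_def)
    with paths[OF K(1) refl d(1)] obtain Y where Y: "Y \<subseteq> {..<length x}"
      "(conf K 2 (?s x Y), d) \<in> step ?M ^^ (n - (length x + 2))" by blast
    obtain t where "(conf K 2 (?s x Y), final K c (?s x Y)) \<in> step ?M ^^ t" using fin by blast
    with uniq[OF this Y(2)] have "(d, final K c (?s x Y)) \<in> (step ?M)\<^sup>*"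
      by (auto dest: relpow_imp_rtrancl)
    then have "d = final K c (?s x Y)" using d(2)
      by (cases rule: converse_rtranclE) (auto simp: halting_def)
    then show "\<exists>Y \<subseteq> {..<length x}. snd (sem c (?s x Y)) 3 \<noteq> 0" using Y d acc by auto
  next
    assume "\<exists>Y \<subseteq> {..<length x}. snd (sem c (?s x Y)) 3 \<noteq> 0"
    then obtain Y where Y: "Y \<subseteq> {..<length x}" "snd (sem c (?s x Y)) 3 \<noteq> 0" by blast
    obtain t where "(conf K 2 (?s x Y), final K c (?s x Y)) \<in> step ?M ^^ t" using fin by blast
    then have "(initial ?M x, final K c (?s x Y)) \<in> (step ?M)\<^sup>*"
      using start_reach[OF K(1) refl, of Y x True c] Y relpow_imp_rtrancl rtrancl_trans by metis
    then show "accepts ?M x" using halting_final[OF K(1) refl] acc Y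
      unfolding accepts_def by blast
  qed
  ultimately show ?thesis unfolding NP_def using wf_mach by blast
qed

section \<open>Arithmetic expressions and output expressions\<close>

text \<open>The while-loop reading of a loop. This recursion and the one for \<open>time\<close>
  replace the unfolding into \<open>funpow\<close> and sums, which leaves the simplifier
  below.\<close>

lemma sem_Loop_rec:
  assumes "i \<notin> mods c"
  shows "sem (Loop i c) s = (if snd s i = 0 then s else sem (Loop i c) (sem c (dec i s)))"
proof (cases "snd s i")
  case (Suc n)
  have "snd (sem c (dec i s)) i = n"
    using sem_unmodified[OF assms, of "dec i s"] Suc by (simp add: dec_def)
  then show ?thesis using Suc by (simp add: funpow_Suc_right del: funpow.simps)
qed simp

lemma time_Loop_rec:
  assumes "i \<notin> mods c"
  shows "time (Loop i c) s = (if snd s i = 0 then 1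
    else time c (dec i s) + 2 + time (Loop i c) (sem c (dec i s)))"
proof (cases "snd s i")
  case (Suc n)
  have "snd (sem c (dec i s)) i = n"
    using sem_unmodified[OF assms, of "dec i s"] Suc by (simp add: dec_def)
  then show ?thesis using Suc
    by (simp add: sum.lessThan_Suc_shift funpow_Suc_right del: funpow.simps sum.lessThan_Suc)
qed simp

declare sem.simps(7) [simp del] time.simps(7) [simp del]

text \<open>Invariant rule for loops without a closed form: \<open>P k\<close> describes the state
  after \<open>k\<close> rounds, and \<open>t\<close> bounds the cost of every round.\<close>

lemma loop_rule:
  assumes "i \<notin> mods c" "P 0 s"
    and "\<And>k s'. k < snd s i \<Longrightarrow> snd s' i = snd s i - k \<Longrightarrow> P k s' \<Longrightarrow>
      P (Suc k) (sem c (dec i s')) \<and> time c (dec i s') \<le> t"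
  shows "P (snd s i) (sem (Loop i c) s) \<and> snd (sem (Loop i c) s) i = 0 \<and>
    time (Loop i c) s \<le> 1 + snd s i * (t + 2)"
proof -
  have "P (k + n) (sem (Loop i c) s') \<and> snd (sem (Loop i c) s') i = 0 \<and>
      time (Loop i c) s' \<le> 1 + n * (t + 2)"
    if "P k s'" "snd s' i = n" "k + n = snd s i" for k n s'
    using that
  proof (induction n arbitrary: k s')
    case 0
    then show ?case using sem_Loop_rec[OF assms(1), of s'] time_Loop_rec[OF assms(1), of s'] by simp
  next
    case (Suc n)
    have *: "P (Suc k) (sem c (dec i s')) \<and> time c (dec i s') \<le> t"
      using Suc.prems by (intro assms(3)) auto
    have "snd (sem c (dec i s')) i = n"
      using sem_unmodified[OF assms(1), of "dec i s'"] Suc.prems by (simp add: dec_def)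
    from Suc.IH[OF conjunct1[OF *] this] * Suc.prems show ?case
      unfolding sem_Loop_rec[OF assms(1), of s'] time_Loop_rec[OF assms(1), of s'] by auto
  qed
  from this[of 0 s "snd s i"] assms(2) show ?thesis by simp
qed

text \<open>\<open>F\<close> is the intended end result as a function of the current state. Since no
  round changes it, its value at the start is its value at the end, where it is the
  identity.\<close>

lemma loop_closed:
  assumes i: "i \<notin> mods c" and zero: "\<And>s. snd s i = 0 \<Longrightarrow> F s = s"
    and step: "\<And>s. snd s i \<noteq> 0 \<Longrightarrow> F (sem c (dec i s)) = F s \<and> time c (dec i s) = t"
  shows "sem (Loop i c) s = F s \<and> time (Loop i c) s = 1 + (t + 2) * snd s i"
proof (induction "snd s i" arbitrary: s)
  case 0
  then show ?case using zero[of s] unfolding sem_Loop_rec[OF i, of s] time_Loop_rec[OF i, of s] by simp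
next
  case (Suc n)
  have s: "snd s i = Suc n" using Suc(2) by simp
  then have n: "n = snd (sem c (dec i s)) i"
    using sem_unmodified[OF i, of "dec i s"] by (simp add: dec_def)
  show ?case using Suc(1)[OF n] step[of s] s n[symmetric]
    unfolding sem_Loop_rec[OF i, of s] time_Loop_rec[OF i, of s]
    by (simp)
qed

abbreviation clr :: "nat \<Rightarrow> com" where "clr r \<equiv> Loop r Nop"

lemma loop_clr: "sem (clr r) (a, v) = (a, v(r := 0)) \<and> time (clr r) (a, v) = 1 + 2 * v r"
  using loop_closed[of r Nop "\<lambda>s. (fst s, (snd s)(r := 0))" 0 "(a, v)"]
  by (simp add: dec_def prod_eq_iff fun_eq_iff)

lemmas sem_clr = loop_clr[THEN conjunct1] and time_clr = loop_clr[THEN conjunct2]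

lemma loop_add:
  assumes "d \<noteq> i"
  shows "sem (Loop i (Inc d)) (a, v) = (a, v(d := v d + v i, i := 0)) \<and>
    time (Loop i (Inc d)) (a, v) = 1 + 3 * v i"
  using assms loop_closed[of i "Inc d" "\<lambda>s. (fst s, (snd s)(d := snd s d + snd s i, i := 0))" 1 "(a, v)"]
  by (simp add: dec_def prod_eq_iff fun_eq_iff)

lemmas sem_add = loop_add[THEN conjunct1] and time_add = loop_add[THEN conjunct2]

lemma loop_sub:
  assumes "d \<noteq> i"
  shows "sem (Loop i (Dec d)) (a, v) = (a, v(d := v d - v i, i := 0)) \<and>
    time (Loop i (Dec d)) (a, v) = 1 + 3 * v i"
  using assms loop_closed[of i "Dec d" "\<lambda>s. (fst s, (snd s)(d := snd s d - snd s i, i := 0))" 1 "(a, v)"]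
  by (simp add: dec_def prod_eq_iff fun_eq_iff)

lemmas sem_sub = loop_sub[THEN conjunct1] and time_sub = loop_sub[THEN conjunct2]

lemma loop_add2:
  assumes "d \<noteq> i" "t \<noteq> i" "d \<noteq> t"
  shows "sem (Loop i (Seq (Inc d) (Inc t))) (a, v) = (a, v(d := v d + v i, t := v t + v i, i := 0)) \<and>
    time (Loop i (Seq (Inc d) (Inc t))) (a, v) = 1 + 4 * v i"
  using assms loop_closed[of i "Seq (Inc d) (Inc t)"
      "\<lambda>s. (fst s, (snd s)(d := snd s d + snd s i, t := snd s t + snd s i, i := 0))" 2 "(a, v)"]
  by (simp add: dec_def prod_eq_iff fun_eq_iff)

lemmas sem_add2 = loop_add2[THEN conjunct1] and time_add2 = loop_add2[THEN conjunct2]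

text \<open>Loops consume their counter, so \<open>i\<close> is moved to both \<open>d\<close> and
  \<open>t\<close> and then restored from \<open>t\<close>. The copy is added to \<open>d\<close>;
  \<open>t\<close> is cleared first because scratch counters hold garbage.\<close>

definition cp :: "nat \<Rightarrow> nat \<Rightarrow> nat \<Rightarrow> com" where
  "cp d i t = Seq (clr t) (Seq (Loop i (Seq (Inc d) (Inc t))) (Loop t (Inc i)))"

lemma sem_cp:
  assumes "d \<noteq> i" "t \<noteq> i" "d \<noteq> t"
  shows "sem (cp d i t) (a, v) = (a, v(d := v d + v i, t := 0))"
  using assms by (auto simp: cp_def sem_clr sem_add2 sem_add fun_eq_iff)

lemma time_cp:
  assumes "d \<noteq> i" "t \<noteq> i" "d \<noteq> t"
  shows "time (cp d i t) (a, v) = 3 + 2 * v t + 7 * v i"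
  using assms
  by (auto simp: cp_def sem_clr sem_add2 sem_add time_clr time_add2 time_add)

lemma wf_cp: "d \<noteq> i \<Longrightarrow> t \<noteq> i \<Longrightarrow> d \<noteq> t \<Longrightarrow> wf_com (cp d i t)"
  by (simp add: cp_def)

lemma mods_cp: "mods (cp d i t) = {d, i, t}"
  by (auto simp: cp_def)

primrec incs :: "nat \<Rightarrow> nat \<Rightarrow> com" where
  "incs r 0 = Nop"
| "incs r (Suc n) = Seq (Inc r) (incs r n)"

lemma sem_incs: "sem (incs r n) (a, v) = (a, v(r := v r + n))"
  by (induction n arbitrary: v) auto

lemma time_incs: "time (incs r n) s = n"
  by (induction n arbitrary: s) auto

lemma wf_incs: "wf_com (incs r n)"
  by (induction n) auto

lemma mods_incs: "mods (incs r n) \<subseteq> {r}"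
  by (induction n) auto

text \<open>A minimum by truncated subtraction: \<open>min a n = a - (a - n)\<close>, where
  \<open>n\<close> is counter 1.\<close>

definition clamp :: "nat \<Rightarrow> com" where
  "clamp r = Seq (clr (r+1)) (Seq (cp (r+1) r (r+2)) (Seq (cp (r+2) 1 (r+3))
     (Seq (Loop (r+2) (Dec (r+1))) (Loop (r+1) (Dec r)))))"

lemma sem_clamp:
  "1 < r \<Longrightarrow> sem (clamp r) (a, v) =
    (a, v(r := min (v r) (v 1), r+1 := 0, r+2 := 0, r+3 := 0))"
  by (auto simp: clamp_def sem_clr sem_cp sem_sub fun_eq_iff min_def)

lemma time_clamp: "1 < r \<Longrightarrow> (\<And>i. v i \<le> G) \<Longrightarrow> time (clamp r) (a, v) \<le> 9 + 26 * G"
proof -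
  assume "1 < r" and *: "\<And>i. v i \<le> G"
  then have "time (clamp r) (a, v) \<le> 9 + 2 * v (r+1) + 2 * v (r+2) + 2 * v (r+3) + 10 * v r + 10 * v 1"
    by (auto simp: clamp_def sem_clr sem_cp sem_sub time_clr time_cp time_sub)
  then show ?thesis using *[of r] *[of 1] *[of "r+1"] *[of "r+2"] *[of "r+3"] by linarith
qed

text \<open>Moving \<open>r\<close> into counter 0 places the array head and empties
  \<open>r\<close>. At most one of the four tests succeeds and adds the symbol found; the blank
  leaves 0.\<close>

definition load :: "nat \<Rightarrow> com" where
  "load r = Seq (clr 0) (Seq (Loop r (Inc 0)) (Seq (IfSym 1 (incs r 1)) (Seq (IfSym 2 (incs r 2))
     (Seq (IfSym 3 (incs r 3)) (IfSym 4 (incs r 4))))))"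

lemma sem_load:
  assumes "0 < r" "\<And>p. a p < 5"
  shows "sem (load r) (a, v) = (a, v(0 := v r, r := a (int (v r))))"
proof -
  have "a (int (v r)) \<in> {0, 1, 2, 3, 4}" using assms(2)[of "int (v r)"] by auto
  then show ?thesis using assms(1)
    by (auto simp: load_def sem_clr sem_add sem_incs fun_eq_iff simp del: incs.simps)
qed

lemma time_load:
  assumes "0 < r" "\<And>i. v i \<le> G"
  shows "time (load r) (a, v) \<le> 20 + 5 * G"
proof -
  have "time (load r) (a, v) \<le> 20 + 2 * v 0 + 3 * v r" using assms(1)
    by (auto simp: load_def sem_clr time_clr sem_add time_add sem_incs time_incs
        simp del: incs.simps)
  then show ?thesis using assms(2)[of 0] assms(2)[of r] by linarith
qed

section \<open>Arithmetic expressions: values, bounds, compilation\<close>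

datatype exp = V nat | C nat | In exp | Add exp exp | Mul exp exp | Sub exp exp | Sum nat exp exp

primrec eval :: "exp \<Rightarrow> env \<Rightarrow> env \<Rightarrow> nat" where
  "eval (V k) X v = v k"
| "eval (C n) X v = n"
| "eval (In e) X v = X (eval e X v)"
| "eval (Add e f) X v = eval e X v + eval f X v"
| "eval (Mul e f) X v = eval e X v * eval f X v"
| "eval (Sub e f) X v = eval e X v - eval f X v"
| "eval (Sum k e f) X v = (\<Sum>i<eval e X v. eval f X (v(k := i)))"

text \<open>Bounds the values of all subexpressions too, hence a sum even for \<open>Sub\<close>. In
  \<open>Sum\<close> the bound variable stays below the value of \<open>e\<close>, so
  \<open>f\<close> is evaluated with variables up to \<open>B + poly (bnd e) B\<close>; this is the
  \<open>pcompose\<close>. The 4 in \<open>In\<close> is the largest symbol.\<close>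

primrec bnd :: "exp \<Rightarrow> nat poly" where
  "bnd (V k) = [:0, 1:]"
| "bnd (C n) = [:n:]"
| "bnd (In e) = bnd e + [:4, 1:]"
| "bnd (Add e f) = bnd e + bnd f"
| "bnd (Mul e f) = bnd e + bnd f + bnd e * bnd f"
| "bnd (Sub e f) = bnd e + bnd f"
| "bnd (Sum k e f) = bnd e + pcompose (bnd f) ([:0, 1:] + bnd e)
     + bnd e * pcompose (bnd f) ([:0, 1:] + bnd e)"

lemma eval_le_bnd:
  "(\<And>p. X p < 5) \<Longrightarrow> (\<And>k. v k \<le> B) \<Longrightarrow> eval e X v \<le> poly (bnd e) B"
proof (induction e arbitrary: v B)
  case (In e)
  have "X (eval e X v) < 5" by (rule In.prems)
  then show ?case by simp
next
  case (Mul e f)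
  have "eval e X v * eval f X v \<le> poly (bnd e) B * poly (bnd f) B"
    using Mul by (intro mult_mono) auto
  then show ?case by simp
next
  case (Sub e f)
  have "eval e X v \<le> poly (bnd e) B" by (rule Sub.IH(1)) (use Sub.prems in auto)
  then show ?case by simp
next
  case (Sum k e f)
  let ?B = "B + poly (bnd e) B"
  have e: "eval e X v \<le> poly (bnd e) B" using Sum by auto
  have "eval f X (v(k := i)) \<le> poly (bnd f) ?B" if "i < eval e X v" for i
    using Sum.prems e that by (intro Sum.IH(2)) (auto intro: add_increasing2 trans_le_add1)
  then have "eval (Sum k e f) X v \<le> (\<Sum>i<eval e X v. poly (bnd f) ?B)"
    unfolding eval.simps by (intro sum_mono) auto
  also have "\<dots> \<le> poly (bnd e) B * poly (bnd f) ?B" using e by simp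
  finally show ?case by (simp add: poly_pcompose)
qed (auto intro: add_mono)

text \<open>
  The value of an expression is left in counter \<open>r\<close>. Variable \<open>k\<close> lives in counter \<open>\<rho> k < r\<close>, the
  counters above \<open>r\<close> are scratch, and counter 1 holds the length of the input. Positions are clamped
  to this length, where the array is blank, since the output is going to be written behind it.
\<close>

primrec cexp :: "env \<Rightarrow> nat \<Rightarrow> exp \<Rightarrow> com" where
  "cexp \<rho> r (V k) = Seq (clr r) (cp r (\<rho> k) (r+1))"
| "cexp \<rho> r (C n) = Seq (clr r) (incs r n)"
| "cexp \<rho> r (In e) = Seq (cexp \<rho> r e) (Seq (clamp r) (load r))"
| "cexp \<rho> r (Add e f) = Seq (cexp \<rho> r e) (Seq (cexp \<rho> (r+1) f) (Loop (r+1) (Inc r)))"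
| "cexp \<rho> r (Mul e f) = Seq (cexp \<rho> (r+1) e) (Seq (cexp \<rho> (r+2) f)
     (Seq (clr r) (Loop (r+1) (cp r (r+2) (r+3)))))"
| "cexp \<rho> r (Sub e f) = Seq (cexp \<rho> r e) (Seq (cexp \<rho> (r+1) f) (Loop (r+1) (Dec r)))"
| "cexp \<rho> r (Sum k e f) = Seq (cexp \<rho> (r+1) e) (Seq (clr r) (Seq (clr (r+2))
     (Loop (r+1) (Seq (cexp (\<rho>(k := r+2)) (r+3) f) (Seq (Loop (r+3) (Inc r)) (Inc (r+2)))))))"

lemma mods_cexp: "mods (cexp \<rho> r e) \<subseteq> {0, 1} \<union> range \<rho> \<union> {r..}"
proof (induction e arbitrary: \<rho> r)
  case (C n)
  show ?case using mods_incs[of r n] by auto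
next
  case (In e)
  have "mods (cexp \<rho> r (In e)) \<subseteq> mods (cexp \<rho> r e) \<union> {0, 1} \<union> {r..}"
    using mods_incs[of r 1] mods_incs[of r 2] mods_incs[of r 3] mods_incs[of r 4]
    by (auto simp: clamp_def load_def mods_cp simp del: incs.simps)
  with In[of \<rho> r] show ?case by blast
next
  case (Add e f)
  have "{r+1..} \<subseteq> {r..}" by auto
  with Add(1)[of \<rho> r] Add(2)[of \<rho> "r+1"] have
    "mods (cexp \<rho> r e) \<union> mods (cexp \<rho> (r+1) f) \<union> {r, r+1} \<subseteq> {0, 1} \<union> range \<rho> \<union> {r..}" by auto
  then show ?case by simp
next
  case (Sub e f)
  have "{r+1..} \<subseteq> {r..}" by auto
  with Sub(1)[of \<rho> r] Sub(2)[of \<rho> "r+1"] have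
    "mods (cexp \<rho> r e) \<union> mods (cexp \<rho> (r+1) f) \<union> {r, r+1} \<subseteq> {0, 1} \<union> range \<rho> \<union> {r..}" by auto
  then show ?case by simp
next
  case (Mul e f)
  have "{r+1..} \<subseteq> {r..}" "{r+2..} \<subseteq> {r..}" by auto
  with Mul(1)[of \<rho> "r+1"] Mul(2)[of \<rho> "r+2"] have
    "mods (cexp \<rho> (r+1) e) \<union> mods (cexp \<rho> (r+2) f) \<union> {r, r+1, r+2, r+3}
      \<subseteq> {0, 1} \<union> range \<rho> \<union> {r..}" by auto
  then show ?case by (simp add: mods_cp)
next
  case (Sum k e f)
  have "mods (cexp \<rho> (r+1) e) \<subseteq> {0, 1} \<union> range \<rho> \<union> {r..}"
    by (rule subset_trans[OF Sum(1)]) auto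
  moreover have "mods (cexp (\<rho>(k := r+2)) (r+3) f) \<subseteq> {0, 1} \<union> range \<rho> \<union> {r..}"
    by (rule subset_trans[OF Sum(2)]) (auto split: if_splits)
  ultimately show ?case by auto
qed (auto simp: mods_cp)

text \<open>Counter 0 is excluded since every array access overwrites it. Variables may share a
  counter: at the top level all of them are counter 1, the input length.\<close>

definition regs :: "env \<Rightarrow> nat \<Rightarrow> bool" where
  "regs \<rho> r \<longleftrightarrow> 2 \<le> r \<and> (\<forall>k. 0 < \<rho> k \<and> \<rho> k < r)"

lemma regs_mono: "regs \<rho> r \<Longrightarrow> r \<le> r' \<Longrightarrow> regs \<rho> r'"
  unfolding regs_def by (meson le_trans less_le_trans)

lemma regs_upd: "regs \<rho> r \<Longrightarrow> r \<le> j \<Longrightarrow> j < r' \<Longrightarrow> regs (\<rho>(k := j)) r'"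
  unfolding regs_def by (auto intro: less_trans less_le_trans)

lemma regs_notin_mods: "regs \<rho> r \<Longrightarrow> r \<le> i \<Longrightarrow> i < r' \<Longrightarrow> i \<noteq> j \<Longrightarrow> i \<notin> mods (cexp (\<rho>(k := j)) r' e)"
proof
  assume *: "regs \<rho> r" "r \<le> i" "i < r'" "i \<noteq> j" and "i \<in> mods (cexp (\<rho>(k := j)) r' e)"
  then have "i \<in> {0, 1} \<union> range (\<rho>(k := j)) \<union> {r'..}" using mods_cexp by blast
  then obtain l where "i = (\<rho>(k := j)) l"
    using * by (auto simp: regs_def simp del: fun_upd_apply)
  then have "i = \<rho> l" using * by (auto split: if_splits)
  moreover have "\<rho> l < r" using *(1) by (simp add: regs_def)
  ultimately show False using * by simp
qed

lemma wf_cexp: "regs \<rho> r \<Longrightarrow> wf_com (cexp \<rho> r e)"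
proof (induction e arbitrary: \<rho> r)
  case (V k)
  have "0 < \<rho> k" "\<rho> k < r" using V by (auto simp: regs_def)
  then have "wf_com (cp r (\<rho> k) (r+1))" by (intro wf_cp) auto
  then show ?case by simp
next
  case (C n)
  then show ?case by (simp add: wf_incs)
next
  case (In e)
  then show ?case by (auto simp: clamp_def load_def wf_incs regs_def intro!: wf_cp)
next
  case (Mul e f)
  then show ?case by (simp add: Mul.IH regs_mono[OF Mul.prems] wf_cp mods_cp)
next
  case (Sum k e f)
  have "wf_com (cexp \<rho> (r+1) e)" using Sum.prems by (simp add: Sum.IH regs_mono[OF Sum.prems])
  moreover have "wf_com (cexp (\<rho>(k := r+2)) (r+3) f)"
    using Sum.prems by (intro Sum.IH regs_upd) auto
  moreover have "r + 1 \<notin> mods (cexp (\<rho>(k := r+2)) (r+3) f)"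
    using Sum.prems by (intro regs_notin_mods) auto
  ultimately show ?case by simp
next
  case (Add e f)
  then show ?case by (simp add: Add.IH regs_mono[OF Add.prems])
next
  case (Sub e f)
  then show ?case by (simp add: Sub.IH regs_mono[OF Sub.prems])
qed

definition inp :: "(int \<Rightarrow> nat) \<Rightarrow> nat \<Rightarrow> nat \<Rightarrow> nat" where
  "inp a n p = a (int (min p n))"

definition ok :: "env \<Rightarrow> nat \<Rightarrow> (int \<Rightarrow> nat) \<Rightarrow> env \<Rightarrow> nat \<Rightarrow> nat \<Rightarrow> bool" where
  "ok \<rho> r a v B G \<longleftrightarrow> regs \<rho> r \<and> (\<forall>p. a p < 5) \<and> (\<forall>k. v (\<rho> k) \<le> B) \<and> v 1 \<le> B \<and> (\<forall>i. v i \<le> G)"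

text \<open>Counter 0 is exempt because reading the input moves the array head.\<close>

definition same :: "nat \<Rightarrow> env \<Rightarrow> env \<Rightarrow> bool" where
  "same r v v' \<longleftrightarrow> (\<forall>i. 0 < i \<and> i < r \<longrightarrow> v' i = v i)"

text \<open>
  \<open>B\<close> bounds the variables and \<open>G\<close> bounds all counters, including the scratch counters, which
  hold garbage. Since \<open>G\<close> need only dominate a polynomial in \<open>B\<close>, it is invariant under iteration.
\<close>

definition computes :: "nat poly \<Rightarrow> exp \<Rightarrow> env \<Rightarrow> nat \<Rightarrow> (int \<Rightarrow> nat) \<Rightarrow> env \<Rightarrow> nat \<Rightarrow> bool" where
  "computes p e \<rho> r a v G \<longleftrightarrow>
     (\<exists>v'. sem (cexp \<rho> r e) (a, v) = (a, v') \<and> v' r = eval e (inp a (v 1)) (v \<circ> \<rho>) \<and>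
        same r v v' \<and> (\<forall>i. v' i \<le> G) \<and> time (cexp \<rho> r e) (a, v) \<le> poly p G)"

text \<open>The time polynomial is taken at \<open>G\<close> rather than at \<open>B\<close>,
  because clearing a scratch counter costs as much as the garbage in it.\<close>

definition good :: "exp \<Rightarrow> nat poly \<Rightarrow> bool" where
  "good e p \<longleftrightarrow> (\<forall>\<rho> r a v B G. ok \<rho> r a v B G \<longrightarrow> poly (bnd e) B \<le> G \<longrightarrow>
     computes p e \<rho> r a v G)"

lemma goodE:
  assumes "good e p" "ok \<rho> r a v B G" "poly (bnd e) B \<le> G"
  obtains v' where "sem (cexp \<rho> r e) (a, v) = (a, v')" "v' r = eval e (inp a (v 1)) (v \<circ> \<rho>)"
    "same r v v'" "\<And>i. v' i \<le> G" "time (cexp \<rho> r e) (a, v) \<le> poly p G"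
  using assms unfolding good_def computes_def by blast

lemma same_trans: "same r v v' \<Longrightarrow> same r' v' v'' \<Longrightarrow> r \<le> r' \<Longrightarrow> same r v v''"
  by (auto simp: same_def)

lemma same_upd: "same r v v' \<Longrightarrow> j = 0 \<or> r \<le> j \<Longrightarrow> same r v (v'(j := x))"
  by (auto simp: same_def)

lemma same_comp: "same r v v' \<Longrightarrow> regs \<rho> r \<Longrightarrow> v' \<circ> \<rho> = v \<circ> \<rho>"
  by (auto simp: same_def regs_def)

lemma same_one: "same r v v' \<Longrightarrow> regs \<rho> r \<Longrightarrow> v' (Suc 0) = v (Suc 0)"
  by (auto simp: same_def regs_def)

lemma ok_same: "ok \<rho> r a v B G \<Longrightarrow> same r v v' \<Longrightarrow> (\<And>i. v' i \<le> G) \<Longrightarrow> r \<le> r' \<Longrightarrow> ok \<rho> r' a v' B G"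
  using same_comp[of r v v' \<rho>] same_one[of r v v' \<rho>] regs_mono[of \<rho> r r']
  by (auto simp: ok_def comp_def fun_eq_iff)

lemma ok_regs: "ok \<rho> r a v B G \<Longrightarrow> regs \<rho> r"
  by (simp add: ok_def)

lemma same_refl: "same r v v"
  by (simp add: same_def)

lemma inp_less: "(\<And>p. a p < 5) \<Longrightarrow> inp a n p < 5"
  by (simp add: inp_def)

lemma eval_le:
  "ok \<rho> r a v B G \<Longrightarrow> eval e (inp a (v 1)) (v \<circ> \<rho>) \<le> poly (bnd e) B"
  by (rule eval_le_bnd) (auto simp: ok_def inp_def)

lemma good_bin:
  assumes e: "good e p" and f: "good f q"
    and o: "ok \<rho> r a v B G" "poly (bnd e) B \<le> G" "poly (bnd f) B \<le> G"
  obtains v' where "sem (Seq (cexp \<rho> r e) (cexp \<rho> (r+1) f)) (a, v) = (a, v')"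
    "v' r = eval e (inp a (v 1)) (v \<circ> \<rho>)" "v' (r+1) = eval f (inp a (v 1)) (v \<circ> \<rho>)"
    "same r v v'" "\<And>i. v' i \<le> G"
    "time (Seq (cexp \<rho> r e) (cexp \<rho> (r+1) f)) (a, v) \<le> poly p G + poly q G"
proof -
  obtain v1 where v1: "sem (cexp \<rho> r e) (a, v) = (a, v1)" "v1 r = eval e (inp a (v 1)) (v \<circ> \<rho>)"
    "same r v v1" "\<And>i. v1 i \<le> G" "time (cexp \<rho> r e) (a, v) \<le> poly p G"
    using goodE[OF e o(1,2)] by blast
  have o1: "ok \<rho> (r+1) a v1 B G" using ok_same[OF o(1) v1(3,4)] by simp
  obtain v2 where v2: "sem (cexp \<rho> (r+1) f) (a, v1) = (a, v2)"
    "v2 (r+1) = eval f (inp a (v1 1)) (v1 \<circ> \<rho>)"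
    "same (r+1) v1 v2" "\<And>i. v2 i \<le> G" "time (cexp \<rho> (r+1) f) (a, v1) \<le> poly q G"
    using goodE[OF f o1 o(3)] by blast
  have "0 < r" using ok_regs[OF o(1)] by (simp add: regs_def)
  then have "v2 r = v1 r" using v2(3) by (simp add: same_def)
  moreover have "same r v v2" using same_trans[OF v1(3) v2(3)] by simp
  ultimately show thesis
    using that[of v2] v1 v2 same_comp[OF v1(3) ok_regs[OF o(1)]] same_one[OF v1(3) ok_regs[OF o(1)]]
    by simp
qed

lemma good_Sum:
  assumes e: "good e p" and f: "good f q"
  shows "good (Sum k e f) (p + [:3, 4:] + [:0, 1:] * (q + [:4, 3:]))"
  unfolding good_def
proof (intro allI impI)
  fix \<rho> r a v B G
  assume o: "ok \<rho> r a v B G" and G: "poly (bnd (Sum k e f)) B \<le> G"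
  let ?X = "inp a (v 1)" and ?w = "v \<circ> \<rho>"
  let ?B = "B + poly (bnd e) B" and ?\<rho> = "\<rho>(k := r+2)"
  let ?body = "Seq (cexp ?\<rho> (r+3) f) (Seq (Loop (r+3) (Inc r)) (Inc (r+2)))"
  let ?t = "poly q G + 3 * G + 2"
  define N where "N = eval e ?X ?w"
  define g where "g i = eval f ?X (?w(k := i))" for i
  have r: "regs \<rho> r" "2 \<le> r" using ok_regs[OF o] by (auto simp: regs_def)
  have G': "poly (bnd e) B \<le> G" "poly (bnd f) ?B \<le> G" "poly (bnd e) B * poly (bnd f) ?B \<le> G"
    using G by (auto simp: poly_pcompose)
  have N: "N \<le> poly (bnd e) B" unfolding N_def by (rule eval_le[OF o])
  have g: "g i \<le> poly (bnd f) ?B" if "i < N" for i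
    unfolding g_def using o N that by (intro eval_le_bnd) (auto simp: ok_def inp_less trans_le_add1)
  \<comment> \<open>Partial sums stay below \<open>G\<close>, so \<open>G\<close> bounds all
    counters again after each round and the cost of a round does not grow.\<close>
  have gsum: "(\<Sum>i<j. g i) \<le> G" if "j \<le> N" for j
  proof -
    have "(\<Sum>i<j. g i) \<le> (\<Sum>i<j. poly (bnd f) ?B)" using g that by (intro sum_mono) auto
    also have "\<dots> \<le> poly (bnd e) B * poly (bnd f) ?B" using that N by simp
    finally show ?thesis using G' by simp
  qed
  have "ok \<rho> (r+1) a v B G" using ok_same[OF o same_refl] o by (auto simp: ok_def)
  from goodE[OF e this G'(1)] obtain v1 where v1: "sem (cexp \<rho> (r+1) e) (a, v) = (a, v1)"
    "v1 (r+1) = N" "same (r+1) v v1" "\<And>i. v1 i \<le> G" "time (cexp \<rho> (r+1) e) (a, v) \<le> poly p G"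
    unfolding N_def by metis
  let ?s = "(a, v1(r := 0, r+2 := 0))"
  \<comment> \<open>Counter \<open>r + 1\<close> controls the loop by counting down, while
    \<open>r + 2\<close> counts up and serves as the summation variable.\<close>
  let ?P = "\<lambda>j s. fst s = a \<and> snd s r = (\<Sum>i<j. g i) \<and> snd s (r+2) = j \<and> same r v (snd s) \<and>
    (\<forall>i. snd s i \<le> G)"
  have notin: "r + 1 \<notin> mods (cexp ?\<rho> (r+3) f)" using r by (intro regs_notin_mods) auto
  have loop: "?P (snd ?s (r+1)) (sem (Loop (r+1) ?body) ?s) \<and> snd (sem (Loop (r+1) ?body) ?s) (r+1) = 0 \<and>
      time (Loop (r+1) ?body) ?s \<le> 1 + snd ?s (r+1) * (?t + 2)"
  proof (rule loop_rule)
    show "r + 1 \<notin> mods ?body" using notin by simp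
    show "?P 0 ?s" using v1 by (auto simp: same_def)
    fix j and s' :: state
    assume j: "j < snd ?s (r+1)" and c: "snd s' (r+1) = snd ?s (r+1) - j" and P: "?P j s'"
    have jN: "j < N" using j v1 by simp
    define u where "u = (snd s')(r+1 := snd s' (r+1) - 1)"
    have s': "dec (r+1) s' = (a, u)" using P by (simp add: dec_def u_def prod_eq_iff)
    have u: "u r = (\<Sum>i<j. g i)" "u (r+2) = j" "same r v u" "\<And>i. u i \<le> G"
      using P by (auto simp: u_def same_upd intro: le_trans[OF diff_le_self])
    have uc: "u \<circ> ?\<rho> = ?w(k := j)" "u (Suc 0) = v (Suc 0)"
      using same_comp[OF u(3) r(1)] same_one[OF u(3) r(1)] u(2) by (auto simp: fun_eq_iff)
    have "ok ?\<rho> (r+3) a u ?B G"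
      unfolding ok_def
    proof (intro conjI allI)
      show "regs ?\<rho> (r+3)" using r by (intro regs_upd) auto
      show "u (?\<rho> i) \<le> ?B" for i
        using fun_cong[OF uc(1), of i] o jN N by (auto simp: ok_def trans_le_add1 split: if_splits)
      show "u 1 \<le> ?B" using uc o by (auto simp: ok_def)
    qed (use o u in \<open>auto simp: ok_def\<close>)
    from goodE[OF f this G'(2)] obtain u1 where u1: "sem (cexp ?\<rho> (r+3) f) (a, u) = (a, u1)"
      "u1 (r+3) = g j" "same (r+3) u u1" "\<And>i. u1 i \<le> G" "time (cexp ?\<rho> (r+3) f) (a, u) \<le> poly q G"
      unfolding g_def uc by (metis One_nat_def uc(2))
    have u1': "u1 r = (\<Sum>i<j. g i)" "u1 (r+2) = j" "same r v u1"
      using u1(3) u r same_trans[OF u(3) u1(3)] by (auto simp: same_def)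
    let ?u2 = "u1(r := u1 r + u1 (r+3), r+3 := 0, r+2 := Suc j)"
    have se: "sem ?body (a, u) = (a, ?u2)"
      using u1 u1' by (auto simp: sem_add fun_eq_iff)
    have ti: "time ?body (a, u) \<le> ?t"
      using u1 u1(4)[of "r+3"] by (auto simp: time_add)
    have "?P (Suc j) (a, ?u2)"
      using u1' u1 gsum[of "Suc j"] jN N G' by (auto simp: same_def)
    then show "?P (Suc j) (sem ?body (dec (r+1) s')) \<and> time ?body (dec (r+1) s') \<le> ?t"
      using ti unfolding s' se by (rule conjI)
  qed
  let ?s2 = "sem (Loop (r+1) ?body) ?s"
  have sN: "snd ?s (r+1) = N" using v1 by simp
  have "sem (cexp \<rho> r (Sum k e f)) (a, v) = ?s2"
    using v1(1) by (simp add: sem_clr)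
  moreover have "time (cexp \<rho> r (Sum k e f)) (a, v) \<le> poly p G + (1 + 2 * G) + (1 + 2 * G) + (1 + G * (?t + 2))"
  proof -
    have "time (cexp \<rho> r (Sum k e f)) (a, v) = time (cexp \<rho> (r+1) e) (a, v) + (1 + 2 * v1 r)
        + (1 + 2 * v1 (r+2)) + time (Loop (r+1) ?body) ?s"
      using v1(1) by (simp add: sem_clr time_clr)
    moreover have "N * (?t + 2) \<le> G * (?t + 2)" using N G' by (intro mult_right_mono) auto
    ultimately show ?thesis
      using loop v1(4)[of r] v1(4)[of "r+2"] v1(5) unfolding sN by linarith
  qed
  moreover have "eval (Sum k e f) ?X ?w = (\<Sum>i<N. g i)" by (simp add: N_def g_def)
  ultimately show "computes (p + [:3, 4:] + [:0, 1:] * (q + [:4, 3:])) (Sum k e f) \<rho> r a v G"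
      unfolding computes_def
    using loop unfolding sN
    by (intro exI[of _ "snd ?s2"]) (simp add: prod_eq_iff algebra_simps del: sem.simps cexp.simps eval.simps)
qed

lemma good_Mul:
  assumes e: "good e p" and f: "good f q"
  shows "good (Mul e f) (p + q + [:2, 2:] + [:0, 1:] * [:5, 9:])"
  unfolding good_def
proof (intro allI impI)
  fix \<rho> r a v B G
  assume o: "ok \<rho> r a v B G" and G: "poly (bnd (Mul e f)) B \<le> G"
  let ?X = "inp a (v 1)" and ?w = "v \<circ> \<rho>"
  let ?body = "cp r (r+2) (r+3)"
  define M N where "M = eval e ?X ?w" and "N = eval f ?X ?w"
  have r: "regs \<rho> r" "2 \<le> r" using ok_regs[OF o] by (auto simp: regs_def)
  have G': "poly (bnd e) B \<le> G" "poly (bnd f) B \<le> G" "poly (bnd e) B * poly (bnd f) B \<le> G"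
    using G by auto
  have MN: "M \<le> poly (bnd e) B" "N \<le> poly (bnd f) B" unfolding M_def N_def by (rule eval_le[OF o])+
  have prod: "j * N \<le> G" if "j \<le> M" for j
    using mult_mono[of j "poly (bnd e) B" N "poly (bnd f) B"] that MN G' by auto
  have "ok \<rho> (r+1) a v B G" using ok_same[OF o same_refl] o by (auto simp: ok_def)
  from good_bin[OF e f this G'(1,2)] obtain v1 where v1:
    "sem (Seq (cexp \<rho> (r+1) e) (cexp \<rho> (r+2) f)) (a, v) = (a, v1)"
    "v1 (r+1) = M" "v1 (r+2) = N" "same (r+1) v v1" "\<And>i. v1 i \<le> G"
    "time (Seq (cexp \<rho> (r+1) e) (cexp \<rho> (r+2) f)) (a, v) \<le> poly p G + poly q G"
    unfolding M_def N_def by (auto simp: numeral_2_eq_2)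
  let ?s = "(a, v1(r := 0))"
  let ?P = "\<lambda>j s. fst s = a \<and> snd s r = j * N \<and> snd s (r+2) = N \<and> same r v (snd s) \<and>
    (\<forall>i. snd s i \<le> G)"
  have loop: "?P (snd ?s (r+1)) (sem (Loop (r+1) ?body) ?s) \<and> snd (sem (Loop (r+1) ?body) ?s) (r+1) = 0 \<and>
      time (Loop (r+1) ?body) ?s \<le> 1 + snd ?s (r+1) * ((3 + 9 * G) + 2)"
  proof (rule loop_rule)
    show "r + 1 \<notin> mods ?body" by (simp add: mods_cp)
    show "?P 0 ?s" using v1 by (auto simp: same_def)
    fix j and s' :: state
    assume j: "j < snd ?s (r+1)" and P: "?P j s'"
    define u where "u = (snd s')(r+1 := snd s' (r+1) - 1)"
    have s': "dec (r+1) s' = (a, u)" using P by (simp add: dec_def u_def prod_eq_iff)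
    have u: "u r = j * N" "u (r+2) = N" "same r v u" "\<And>i. u i \<le> G"
      using P by (auto simp: u_def same_upd intro: le_trans[OF diff_le_self])
    have "time ?body (a, u) \<le> 3 + 9 * G"
      using u(4)[of "r+2"] u(4)[of "r+3"] by (auto simp: time_cp)
    moreover have "?P (Suc j) (sem ?body (a, u))"
      using u prod[of "Suc j"] j v1 by (auto simp: sem_cp same_def)
    ultimately show "?P (Suc j) (sem ?body (dec (r+1) s')) \<and> time ?body (dec (r+1) s') \<le> 3 + 9 * G"
      unfolding s' by simp
  qed
  let ?s2 = "sem (Loop (r+1) ?body) ?s"
  have sM: "snd ?s (r+1) = M" using v1 by simp
  have "sem (cexp \<rho> r (Mul e f)) (a, v) = ?s2"
    using v1(1) by (simp add: sem_clr)
  moreover have "time (cexp \<rho> r (Mul e f)) (a, v) \<le> poly p G + poly q G + (1 + 2 * G) + (1 + G * (5 + 9 * G))"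
  proof -
    have "time (cexp \<rho> r (Mul e f)) (a, v) = time (Seq (cexp \<rho> (r+1) e) (cexp \<rho> (r+2) f)) (a, v)
        + (1 + 2 * v1 r) + time (Loop (r+1) ?body) ?s"
      using v1(1) by (simp add: sem_clr time_clr)
    moreover have "M * ((3 + 9 * G) + 2) \<le> G * (5 + 9 * G)" using MN G' by (intro mult_mono) auto
    ultimately show ?thesis
      using loop v1(5)[of r] v1(6) unfolding sM by linarith
  qed
  moreover have "eval (Mul e f) ?X ?w = M * N" by (simp add: N_def M_def)
  ultimately show "computes (p + q + [:2, 2:] + [:0, 1:] * [:5, 9:]) (Mul e f) \<rho> r a v G"
      unfolding computes_def
    using loop unfolding sM
    by (intro exI[of _ "snd ?s2"]) (simp add: prod_eq_iff algebra_simps del: sem.simps cexp.simps eval.simps)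
qed

lemma cexp_correct: "\<exists>p. good e p"
proof (induction e)
  case (V k)
  have "good (V k) [:4, 11:]" unfolding good_def
  proof (intro allI impI)
    fix \<rho> r a v B G assume o: "ok \<rho> r a v B G"
    have r: "0 < \<rho> k" "\<rho> k < r" using ok_regs[OF o] by (auto simp: regs_def)
    have v: "\<And>i. v i \<le> G" using o by (auto simp: ok_def)
    have "time (cexp \<rho> r (V k)) (a, v) = 4 + 2 * v r + (2 * v (r+1) + 7 * v (\<rho> k))"
      using r by (simp add: sem_clr time_clr time_cp)
    then have "time (cexp \<rho> r (V k)) (a, v) \<le> poly [:4, 11:] G"
      using v[of r] v[of "r+1"] v[of "\<rho> k"] by simp
    then show "computes [:4, 11:] (V k) \<rho> r a v G"
      unfolding computes_def
      using r v by (auto simp: sem_clr sem_cp same_def simp del: time.simps)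
  qed
  then show ?case ..
next
  case (C n)
  have "good (C n) [:1 + n, 2:]" unfolding good_def
  proof (intro allI impI)
    fix \<rho> r a v B G assume o: "ok \<rho> r a v B G" and G: "poly (bnd (C n)) B \<le> G"
    have v: "\<And>i. v i \<le> G" using o by (auto simp: ok_def)
    show "computes [:1 + n, 2:] (C n) \<rho> r a v G"
      unfolding computes_def
      using v[of r] v G
      by (auto simp: sem_clr sem_incs time_clr time_incs same_def)
  qed
  then show ?case ..
next
  case (In e)
  then obtain p where e: "good e p" ..
  \<comment> \<open>29 and 31 add up the constants of \<open>time_clamp\<close> and
    \<open>time_load\<close>.\<close>
  have "good (In e) (p + [:29, 31:])" unfolding good_def
  proof (intro allI impI)
    fix \<rho> r a v B G assume o: "ok \<rho> r a v B G" and G: "poly (bnd (In e)) B \<le> G"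
    have r: "regs \<rho> r" "1 < r" using ok_regs[OF o] by (auto simp: regs_def)
    have a: "\<And>p. a p < 5" "a i \<le> G" for i
      using o G less_Suc_eq_le[of "a i" 4] by (auto simp: ok_def intro: le_trans[of _ 4])
    from G have "poly (bnd e) B \<le> G" by simp
    from goodE[OF e o this] obtain v1 where v1: "sem (cexp \<rho> r e) (a, v) = (a, v1)"
      "v1 r = eval e (inp a (v 1)) (v \<circ> \<rho>)"
      "same r v v1" "\<And>i. v1 i \<le> G" "time (cexp \<rho> r e) (a, v) \<le> poly p G" by blast
    define v2 where "v2 = v1(r := min (v1 r) (v1 1), r+1 := 0, r+2 := 0, r+3 := 0)"
    have v2: "same r v v2" "\<And>i. v2 i \<le> G"
      unfolding v2_def using v1(3,4) by (auto intro!: same_upd simp: min.coboundedI1)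
    have v2r: "v2 r = min (v1 r) (v 1)" unfolding v2_def using same_one[OF v1(3) r(1)] by simp
    let ?v3 = "v2(0 := v2 r, r := a (int (v2 r)))"
    have se: "sem (cexp \<rho> r (In e)) (a, v) = (a, ?v3)"
      using r a v1(1) by (simp add: sem_clamp sem_load v2_def)
    moreover have "?v3 r = eval (In e) (inp a (v 1)) (v \<circ> \<rho>)"
      using v1(2) v2r r by (simp add: inp_def)
    moreover have "same r v ?v3" using v2 by (auto intro: same_upd)
    moreover have "\<forall>i. ?v3 i \<le> G" using v2 a by simp
    moreover have "time (cexp \<rho> r (In e)) (a, v) \<le> poly (p + [:29, 31:]) G"
      using v1(1,5) time_clamp[OF r(2), of v1 G a] v1(4) time_load[of r v2 G a] v2(2) r
      by (simp add: sem_clamp v2_def)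
    ultimately show "computes (p + [:29, 31:]) (In e) \<rho> r a v G"
      unfolding computes_def
      by blast
  qed
  then show ?case ..
next
  case (Add e f)
  then obtain p q where e: "good e p" and f: "good f q" by blast
  have "good (Add e f) (p + q + [:1, 3:])" unfolding good_def
  proof (intro allI impI)
    fix \<rho> r a v B G assume o: "ok \<rho> r a v B G" and G: "poly (bnd (Add e f)) B \<le> G"
    from G have "poly (bnd e) B \<le> G" "poly (bnd f) B \<le> G" by auto
    from good_bin[OF e f o this] obtain v1 where v1:
      "sem (Seq (cexp \<rho> r e) (cexp \<rho> (r+1) f)) (a, v) = (a, v1)"
      "v1 r = eval e (inp a (v 1)) (v \<circ> \<rho>)" "v1 (r+1) = eval f (inp a (v 1)) (v \<circ> \<rho>)"
      "same r v v1" "\<And>i. v1 i \<le> G"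
      "time (Seq (cexp \<rho> r e) (cexp \<rho> (r+1) f)) (a, v) \<le> poly p G + poly q G" by blast
    have "v1 r + v1 (r+1) \<le> G"
      using G eval_le[OF o, of e] eval_le[OF o, of f] unfolding v1 by simp
    then show "computes (p + q + [:1, 3:]) (Add e f) \<rho> r a v G"
      unfolding computes_def
      using v1 v1(5)[of "r+1"]
      by (auto simp: sem_add time_add same_def)
  qed
  then show ?case ..
next
  case (Sub e f)
  then obtain p q where e: "good e p" and f: "good f q" by blast
  have "good (Sub e f) (p + q + [:1, 3:])" unfolding good_def
  proof (intro allI impI)
    fix \<rho> r a v B G assume o: "ok \<rho> r a v B G" and G: "poly (bnd (Sub e f)) B \<le> G"
    from G have "poly (bnd e) B \<le> G" "poly (bnd f) B \<le> G" by auto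
    from good_bin[OF e f o this] obtain v1 where v1:
      "sem (Seq (cexp \<rho> r e) (cexp \<rho> (r+1) f)) (a, v) = (a, v1)"
      "v1 r = eval e (inp a (v 1)) (v \<circ> \<rho>)" "v1 (r+1) = eval f (inp a (v 1)) (v \<circ> \<rho>)"
      "same r v v1" "\<And>i. v1 i \<le> G"
      "time (Seq (cexp \<rho> r e) (cexp \<rho> (r+1) f)) (a, v) \<le> poly p G + poly q G" by blast
    have "v1 r - v1 (r+1) \<le> G" using v1(5)[of r] by simp
    then show "computes (p + q + [:1, 3:]) (Sub e f) \<rho> r a v G"
      unfolding computes_def
      using v1 v1(5)[of "r+1"]
      by (auto simp: sem_sub time_sub same_def)
  qed
  then show ?case ..
next
  case (Mul e f)
  then show ?case using good_Mul by blast
next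
  case (Sum k e f)
  then show ?case using good_Sum by blast
qed

section \<open>Output expressions: strings, lengths, compilation\<close>

datatype oexp = Emit exp | Cat oexp oexp | For nat exp oexp

primrec out :: "oexp \<Rightarrow> env \<Rightarrow> env \<Rightarrow> bool list" where
  "out (Emit e) X v = [eval e X v \<noteq> 0]"
| "out (Cat s t) X v = out s X v @ out t X v"
| "out (For k e s) X v = concat (map (\<lambda>i. out s X (v(k := i))) [0..<eval e X v])"

primrec obnd :: "oexp \<Rightarrow> nat poly" where
  "obnd (Emit e) = bnd e"
| "obnd (Cat s t) = obnd s + obnd t"
| "obnd (For k e s) = bnd e + pcompose (obnd s) ([:0, 1:] + bnd e)"

primrec olen :: "oexp \<Rightarrow> nat poly" where
  "olen (Emit e) = 1"
| "olen (Cat s t) = olen s + olen t"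
| "olen (For k e s) = bnd e * pcompose (olen s) ([:0, 1:] + bnd e)"

lemma length_out:
  "(\<And>p. X p < 5) \<Longrightarrow> (\<And>k. v k \<le> B) \<Longrightarrow> length (out s X v) \<le> poly (olen s) B"
proof (induction s arbitrary: v B)
  case (Cat s t)
  then show ?case by (auto intro: add_mono)
next
  case (For k e s)
  let ?B = "B + poly (bnd e) B"
  have e: "eval e X v \<le> poly (bnd e) B" using For by (intro eval_le_bnd) auto
  have "length (out s X (v(k := i))) \<le> poly (olen s) ?B" if "i < eval e X v" for i
    using For.prems e that by (intro For.IH) (auto intro: add_increasing2 trans_le_add1)
  then have "(\<Sum>i\<in>{0..<eval e X v}. length (out s X (v(k := i)))) \<le> (\<Sum>i\<in>{0..<eval e X v}. poly (olen s) ?B)"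
    by (intro sum_mono) auto
  also have "\<dots> \<le> poly (bnd e) B * poly (olen s) ?B" using e by simp
  finally show ?case by (simp add: poly_pcompose length_concat comp_def interv_sum_list_conv_sum_set_nat)
qed auto

text \<open>Counter 2 holds the position of the next output cell.\<close>

primrec cout :: "env \<Rightarrow> nat \<Rightarrow> oexp \<Rightarrow> com" where
  "cout \<rho> r (Emit e) = Seq (cexp \<rho> r e) (Seq (clr 0) (Seq (cp 0 2 (r+1)) (Seq (Wr 1)
     (Seq (Loop r (Wr 2)) (Inc 2)))))"
| "cout \<rho> r (Cat s t) = Seq (cout \<rho> r s) (cout \<rho> r t)"
| "cout \<rho> r (For k e s) = Seq (cexp \<rho> r e) (Seq (clr (r+1))
     (Loop r (Seq (cout (\<rho>(k := r+1)) (r+2) s) (Inc (r+1)))))"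

lemma mods_cout: "mods (cout \<rho> r s) \<subseteq> {0, 1, 2} \<union> range \<rho> \<union> {r..}"
proof (induction s arbitrary: \<rho> r)
  case (Emit e)
  then show ?case using mods_cexp[of \<rho> r e] by (auto simp: mods_cp)
next
  case (Cat s t)
  then show ?case using Cat[of \<rho> r] by auto
next
  case (For k e s)
  have "mods (cexp \<rho> r e) \<subseteq> {0, 1, 2} \<union> range \<rho> \<union> {r..}"
    by (rule subset_trans[OF mods_cexp]) auto
  moreover have "mods (cout (\<rho>(k := r+1)) (r+2) s) \<subseteq> {0, 1, 2} \<union> range \<rho> \<union> {r..}"
    by (rule subset_trans[OF For]) (auto split: if_splits)
  ultimately show ?case by auto
qed

lemma notin_mods_cout: "regs \<rho> r \<Longrightarrow> 3 \<le> r \<Longrightarrow> r \<notin> mods (cout (\<rho>(k := r+1)) (r+2) s)"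
proof
  assume *: "regs \<rho> r" "3 \<le> r" and "r \<in> mods (cout (\<rho>(k := r+1)) (r+2) s)"
  then have "r \<in> {0, 1, 2} \<union> range (\<rho>(k := r+1)) \<union> {r+2..}" using mods_cout by blast
  then obtain l where "r = (\<rho>(k := r+1)) l"
    using * by (auto simp: regs_def simp del: fun_upd_apply)
  then have "r = \<rho> l" by (auto split: if_splits)
  moreover have "\<rho> l < r" using *(1) by (simp add: regs_def)
  ultimately show False by simp
qed

lemma wf_cout: "regs \<rho> r \<Longrightarrow> 3 \<le> r \<Longrightarrow> wf_com (cout \<rho> r s)"
proof (induction s arbitrary: \<rho> r)
  case (Emit e)
  then show ?case by (auto intro!: wf_cp simp: wf_cexp)
next
  case (For k e s)
  have "wf_com (cout (\<rho>(k := r+1)) (r+2) s)"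
    using For.prems by (intro For.IH regs_upd) auto
  then show ?case using For.prems notin_mods_cout[of \<rho> r k s] by (simp add: wf_cexp)
qed auto

definition over :: "(int \<Rightarrow> nat) \<Rightarrow> nat \<Rightarrow> bool list \<Rightarrow> int \<Rightarrow> nat" where
  "over a n xs p = (if int n \<le> p \<and> p < int n + int (length xs)
     then bit_symbol (xs ! nat (p - int n)) else a p)"

lemma over_Nil: "over a n [] = a"
  by (auto simp: over_def)

lemma over_append: "over (over a n xs) (n + length xs) ys = over a n (xs @ ys)"
proof
  fix p
  have "nat (p - int n) - length xs = nat (p - (int n + int (length xs)))" by auto
  then show "over (over a n xs) (n + length xs) ys p = over a n (xs @ ys) p"
    by (auto simp: over_def nth_append)
qed

lemma over_single: "over a n [b] = a(int n := bit_symbol b)"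
  by (auto simp: over_def fun_eq_iff)

lemma over_less: "(\<And>p. a p < 5) \<Longrightarrow> over a n xs p < 5"
  by (auto simp: over_def bit_symbol_def)

text \<open>Reads are clamped to position \<open>m\<close>, so cells written from
  \<open>n > m\<close> on are invisible to them. Hence expressions keep seeing the original input
  although the output shares its tape.\<close>

lemma inp_over: "m < n \<Longrightarrow> inp (over a n xs) m = inp a m"
  by (auto simp: over_def inp_def fun_eq_iff)

text \<open>A loop around a write is a conditional write that also clears \<open>r\<close>, as all
  rounds hit the same cell. After a preceding \<open>Wr 1\<close> it turns any nonzero value into
  the symbol of \<open>True\<close>.\<close>

lemma loop_set:
  assumes "0 < r"
  shows "sem (Loop r (Wr w)) (a, v) = (if v r = 0 then a else a(int (v 0) := w), v(r := 0)) \<and>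
    time (Loop r (Wr w)) (a, v) = 1 + 3 * v r"
  using assms loop_closed[of r "Wr w"
      "\<lambda>s. (if snd s r = 0 then fst s else (fst s)(int (snd s 0) := w), (snd s)(r := 0))" 1 "(a, v)"]
  by (simp add: dec_def prod_eq_iff fun_eq_iff)

lemmas sem_set = loop_set[THEN conjunct1] and time_set = loop_set[THEN conjunct2]

definition same2 :: "nat \<Rightarrow> env \<Rightarrow> env \<Rightarrow> bool" where
  "same2 r v v' \<longleftrightarrow> (\<forall>i. 0 < i \<and> i < r \<and> i \<noteq> 2 \<longrightarrow> v' i = v i)"

definition oregs :: "env \<Rightarrow> nat \<Rightarrow> bool" where
  "oregs \<rho> r \<longleftrightarrow> regs \<rho> r \<and> 3 \<le> r \<and> (\<forall>k. \<rho> k \<noteq> 2)"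

lemma same2_comp: "same2 r v v' \<Longrightarrow> oregs \<rho> r \<Longrightarrow> v' \<circ> \<rho> = v \<circ> \<rho>"
  by (auto simp: same2_def regs_def oregs_def)

lemma same2_one: "same2 r v v' \<Longrightarrow> oregs \<rho> r \<Longrightarrow> v' (Suc 0) = v (Suc 0)"
  by (auto simp: same2_def regs_def oregs_def)

lemma same2_trans: "same2 r v v' \<Longrightarrow> same2 r' v' v'' \<Longrightarrow> r \<le> r' \<Longrightarrow> same2 r v v''"
  by (auto simp: same2_def)

lemma ok_same2:
  "ok \<rho> r a v B G \<Longrightarrow> oregs \<rho> r \<Longrightarrow> same2 r v v' \<Longrightarrow> (\<And>i. v' i \<le> G) \<Longrightarrow> ok \<rho> r (over a n xs) v' B G"
  using same2_comp[of r v v' \<rho>] same2_one[of r v v' \<rho>]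
  by (auto simp: ok_def comp_def fun_eq_iff over_less)

definition emits :: "nat poly \<Rightarrow> oexp \<Rightarrow> env \<Rightarrow> nat \<Rightarrow> (int \<Rightarrow> nat) \<Rightarrow> env \<Rightarrow> nat \<Rightarrow> bool" where
  "emits p s \<rho> r a v G \<longleftrightarrow>
     (\<exists>v'. sem (cout \<rho> r s) (a, v) = (over a (v 2) (out s (inp a (v 1)) (v \<circ> \<rho>)), v') \<and>
        v' 2 = v 2 + length (out s (inp a (v 1)) (v \<circ> \<rho>)) \<and>
        same2 r v v' \<and> (\<forall>i. v' i \<le> G) \<and> time (cout \<rho> r s) (a, v) \<le> poly p G)"

text \<open>Counter 2 ends behind the output, so \<open>G\<close> has to dominate the final output
  position as well.\<close>

definition ogood :: "oexp \<Rightarrow> nat poly \<Rightarrow> bool" where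
  "ogood s p \<longleftrightarrow> (\<forall>\<rho> r a v B G. ok \<rho> r a v B G \<longrightarrow> oregs \<rho> r \<longrightarrow> v 1 < v 2 \<longrightarrow>
     poly (obnd s) B \<le> G \<longrightarrow> v 2 + length (out s (inp a (v 1)) (v \<circ> \<rho>)) \<le> G \<longrightarrow>
     emits p s \<rho> r a v G)"

lemma ogoodE:
  assumes "ogood s p" "ok \<rho> r a v B G" "oregs \<rho> r" "v 1 < v 2" "poly (obnd s) B \<le> G"
    "v 2 + length (out s (inp a (v 1)) (v \<circ> \<rho>)) \<le> G"
  obtains v' where "sem (cout \<rho> r s) (a, v) = (over a (v 2) (out s (inp a (v 1)) (v \<circ> \<rho>)), v')"
    "v' 2 = v 2 + length (out s (inp a (v 1)) (v \<circ> \<rho>))"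
    "same2 r v v'" "\<And>i. v' i \<le> G" "time (cout \<rho> r s) (a, v) \<le> poly p G"
  using assms unfolding ogood_def emits_def by blast

lemma ogood_Emit:
  assumes e: "good e p"
  shows "ogood (Emit e) (p + [:7, 14:])"
  unfolding ogood_def
proof (intro allI impI)
  fix \<rho> :: env and r a and v :: env and B G
  let ?o = "out (Emit e) (inp a (v 1)) (v \<circ> \<rho>)"
  assume o: "ok \<rho> r a v B G" and r: "oregs \<rho> r" and lt: "v 1 < v 2"
    and G: "poly (obnd (Emit e)) B \<le> G" "v 2 + length ?o \<le> G"
  have r3: "3 \<le> r" using r by (simp add: oregs_def)
  from G have "poly (bnd e) B \<le> G" by simp
  from goodE[OF e o this] obtain v1 where v1: "sem (cexp \<rho> r e) (a, v) = (a, v1)"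
    "v1 r = eval e (inp a (v 1)) (v \<circ> \<rho>)"
    "same r v v1" "\<And>i. v1 i \<le> G" "time (cexp \<rho> r e) (a, v) \<le> poly p G" by blast
  have v12: "v1 2 = v 2" using v1(3) r3 by (simp add: same_def)
  let ?v2 = "v1(0 := v1 2, r+1 := 0, r := 0, 2 := Suc (v1 2))"
  have "sem (cout \<rho> r (Emit e)) (a, v) = (over a (v 2) ?o, ?v2)"
    using r3 v1(1,2) v12
    by (auto simp: sem_clr sem_cp sem_set over_single bit_symbol_def fun_eq_iff)
  moreover have "?v2 2 = v 2 + length ?o" using v12 by simp
  moreover have "same2 r v ?v2" using v1(3) by (auto simp: same_def same2_def)
  moreover have "\<forall>i. ?v2 i \<le> G" using v1(4) G v12 by auto
  moreover have "time (cout \<rho> r (Emit e)) (a, v) \<le> poly (p + [:7, 14:]) G"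
  proof -
    have "time (cout \<rho> r (Emit e)) (a, v) =
        time (cexp \<rho> r e) (a, v) + (7 + 2 * v1 0 + 2 * v1 (r+1) + 7 * v1 2 + 3 * v1 r)"
      using r3 v1(1)
      by (auto simp: sem_clr sem_cp sem_set time_clr time_cp time_set)
    moreover have "poly (p + [:7, 14:]) G = poly p G + 7 + 14 * G" by simp
    ultimately show ?thesis
      using v1(5) v1(4)[of 0] v1(4)[of "r+1"] v1(4)[of 2] v1(4)[of r] by linarith
  qed
  ultimately show "emits (p + [:7, 14:]) (Emit e) \<rho> r a v G"
    unfolding emits_def
    by blast
qed

lemma ogood_Cat:
  assumes s: "ogood s p" and t: "ogood t q"
  shows "ogood (Cat s t) (p + q)"
  unfolding ogood_def
proof (intro allI impI)
  fix \<rho> :: env and r a and v :: env and B G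
  let ?X = "inp a (v 1)" and ?w = "v \<circ> \<rho>"
  let ?o = "out (Cat s t) ?X ?w"
  assume o: "ok \<rho> r a v B G" and r: "oregs \<rho> r" and lt: "v 1 < v 2"
    and G: "poly (obnd (Cat s t)) B \<le> G" "v 2 + length ?o \<le> G"
  from G have G1: "poly (obnd s) B \<le> G" "v 2 + length (out s ?X ?w) \<le> G" and G2: "poly (obnd t) B \<le> G"
    by auto
  from ogoodE[OF s o r lt G1] obtain v1 where v1: "sem (cout \<rho> r s) (a, v) = (over a (v 2) (out s ?X ?w), v1)"
    "v1 2 = v 2 + length (out s ?X ?w)" "same2 r v v1" "\<And>i. v1 i \<le> G"
    "time (cout \<rho> r s) (a, v) \<le> poly p G" by blast
  let ?a1 = "over a (v 2) (out s ?X ?w)"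
  have c: "v1 \<circ> \<rho> = ?w" "v1 (Suc 0) = v (Suc 0)" using same2_comp[OF v1(3) r] same2_one[OF v1(3) r] by auto
  have X: "inp ?a1 (v1 1) = ?X" using c lt by (simp add: inp_over)
  have o1: "ok \<rho> r ?a1 v1 B G" by (rule ok_same2[OF o r v1(3,4)])
  have lt1: "v1 1 < v1 2" using c lt v1(2) by simp
  have "v1 2 + length (out t (inp ?a1 (v1 1)) (v1 \<circ> \<rho>)) \<le> G" using G v1(2) unfolding X c by simp
  from ogoodE[OF t o1 r lt1 G2 this] obtain v2 where v2:
    "sem (cout \<rho> r t) (?a1, v1) = (over ?a1 (v1 2) (out t ?X ?w), v2)"
    "v2 2 = v1 2 + length (out t ?X ?w)" "same2 r v1 v2" "\<And>i. v2 i \<le> G"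
    "time (cout \<rho> r t) (?a1, v1) \<le> poly q G" unfolding X c by blast
  show "emits (p + q) (Cat s t) \<rho> r a v G"
    unfolding emits_def
    using v1 v2 same2_trans[OF v1(3) v2(3)] by (intro exI[of _ v2]) (simp add: over_append)
qed

lemma ogood_For:
  assumes e: "good e p" and s: "ogood s q"
  shows "ogood (For k e s) (p + [:2, 2:] + [:0, 1:] * (q + [:3:]))"
  unfolding ogood_def
proof (intro allI impI)
  fix \<rho> :: env and r a and v :: env and B G
  let ?X = "inp a (v 1)" and ?w = "v \<circ> \<rho>"
  let ?o = "out (For k e s) ?X ?w" and ?\<rho> = "\<rho>(k := r+1)" and ?B = "B + poly (bnd e) B"
  let ?body = "Seq (cout ?\<rho> (r+2) s) (Inc (r+1))"
  assume o: "ok \<rho> r a v B G" and r: "oregs \<rho> r" and lt: "v 1 < v 2"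
    and G: "poly (obnd (For k e s)) B \<le> G" "v 2 + length ?o \<le> G"
  define N where "N = eval e ?X ?w"
  define g where "g i = out s ?X (?w(k := i))" for i
  define pr where "pr j = concat (map g [0..<j])" for j
  have r': "regs \<rho> r" "3 \<le> r" using r by (auto simp: oregs_def)
  have G': "poly (bnd e) B \<le> G" "poly (obnd s) ?B \<le> G" using G by (auto simp: poly_pcompose)
  have prN: "?o = pr N" by (simp add: pr_def g_def[abs_def] N_def)
  have pr_le: "v 2 + length (pr j) \<le> G" if "j \<le> N" for j
  proof -
    have "[0..<N] = [0..<j] @ [j..<N]" using upt_add_eq_append[of 0 j "N - j"] that by simp
    then have "length (pr j) \<le> length (pr N)" by (simp add: pr_def)
    then show ?thesis using G(2) unfolding prN by simp
  qed
  have N: "N \<le> poly (bnd e) B" unfolding N_def by (rule eval_le[OF o])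
  from goodE[OF e o G'(1)] obtain v1 where v1: "sem (cexp \<rho> r e) (a, v) = (a, v1)"
    "v1 r = N" "same r v v1" "\<And>i. v1 i \<le> G" "time (cexp \<rho> r e) (a, v) \<le> poly p G"
    unfolding N_def by blast
  let ?s = "(a, v1(r+1 := 0))"
  let ?P = "\<lambda>j s. fst s = over a (v 2) (pr j) \<and> snd s (r+1) = j \<and> snd s 2 = v 2 + length (pr j) \<and>
    same2 r v (snd s) \<and> (\<forall>i. snd s i \<le> G)"
  have loop: "?P (snd ?s r) (sem (Loop r ?body) ?s) \<and> snd (sem (Loop r ?body) ?s) r = 0 \<and>
      time (Loop r ?body) ?s \<le> 1 + snd ?s r * ((poly q G + 1) + 2)"
  proof (rule loop_rule)
    show "r \<notin> mods ?body" using notin_mods_cout[OF r'] by simp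
    have "v1 2 = v 2" using v1(3) r' by (simp add: same_def)
    then show "?P 0 ?s" using v1(3,4) r' by (auto simp: same2_def same_def pr_def over_Nil)
    fix j and s' :: state
    assume j: "j < snd ?s r" and P: "?P j s'"
    have jN: "j < N" using j v1 by simp
    define u where "u = (snd s')(r := snd s' r - 1)"
    let ?a = "over a (v 2) (pr j)"
    have s': "dec r s' = (?a, u)" using P by (simp add: dec_def u_def prod_eq_iff)
    have u: "u 2 = v 2 + length (pr j)" "u (r+1) = j" "same2 r v u" "\<And>i. u i \<le> G"
      using P r' by (auto simp: u_def same2_def intro: le_trans[OF diff_le_self])
    have uc: "u \<circ> ?\<rho> = ?w(k := j)" "u (Suc 0) = v (Suc 0)"
      using same2_comp[OF u(3) r] same2_one[OF u(3) r] u(2) by (auto simp: fun_eq_iff)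
    have X: "inp ?a (u 1) = ?X" using uc lt by (simp add: inp_over)
    have r2: "oregs ?\<rho> (r+2)" using r r' regs_upd[OF r'(1), of "r+1" "r+2" k] by (auto simp: oregs_def)
    have o2: "ok ?\<rho> (r+2) ?a u ?B G"
      unfolding ok_def
    proof (intro conjI allI)
      show "regs ?\<rho> (r+2)" using r2 by (simp add: oregs_def)
      show "u (?\<rho> i) \<le> ?B" for i
        using fun_cong[OF uc(1), of i] o jN N by (auto simp: ok_def trans_le_add1 split: if_splits)
      show "u 1 \<le> ?B" using uc o by (auto simp: ok_def)
    qed (use o u in \<open>auto simp: ok_def over_less\<close>)
    have lt2: "u 1 < u 2" using uc lt u by simp
    have pS: "pr (Suc j) = pr j @ g j" by (simp add: pr_def)
    have "u 2 + length (out s (inp ?a (u 1)) (u \<circ> ?\<rho>)) \<le> G"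
      using pr_le[of "Suc j"] jN unfolding X uc(1) pS u(1) by (simp add: g_def)
    from ogoodE[OF s o2 r2 lt2 G'(2) this] obtain u1 where u1:
      "sem (cout ?\<rho> (r+2) s) (?a, u) = (over ?a (u 2) (g j), u1)"
      "u1 2 = u 2 + length (g j)" "same2 (r+2) u u1" "\<And>i. u1 i \<le> G"
      "time (cout ?\<rho> (r+2) s) (?a, u) \<le> poly q G" unfolding X uc(1) g_def by blast
    have u1': "u1 (r+1) = j" "same2 r v u1"
      using u1(3) u r' same2_trans[OF u(3) u1(3)] by (auto simp: same2_def)
    let ?u2 = "u1(r+1 := Suc j)"
    have se: "sem ?body (?a, u) = (over a (v 2) (pr (Suc j)), ?u2)"
      using u1(1) u1'(1) by (simp add: pS u(1) over_append)
    have ti: "time ?body (?a, u) \<le> poly q G + 1" using u1(5) by simp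
    have "?P (Suc j) (over a (v 2) (pr (Suc j)), ?u2)"
      using u1' u1 u(1) jN N G' r' by (auto simp: same2_def pS)
    then show "?P (Suc j) (sem ?body (dec r s')) \<and> time ?body (dec r s') \<le> poly q G + 1"
      using ti unfolding s' se by (rule conjI)
  qed
  let ?s2 = "sem (Loop r ?body) ?s"
  have sN: "snd ?s r = N" using v1 by simp
  have "sem (cout \<rho> r (For k e s)) (a, v) = ?s2"
    using v1(1) by (simp add: sem_clr)
  moreover have "time (cout \<rho> r (For k e s)) (a, v) \<le> poly p G + (1 + 2 * G) + (1 + G * (poly q G + 1 + 2))"
  proof -
    have "time (cout \<rho> r (For k e s)) (a, v) = time (cexp \<rho> r e) (a, v) + (1 + 2 * v1 (r+1))
        + time (Loop r ?body) ?s"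
      using v1(1) by (simp add: sem_clr time_clr)
    moreover have "N * (poly q G + 1 + 2) \<le> G * (poly q G + 1 + 2)"
      using N G' by (intro mult_right_mono) auto
    ultimately show ?thesis
      using loop v1(4)[of "r+1"] v1(5) unfolding sN by linarith
  qed
  ultimately show "emits (p + [:2, 2:] + [:0, 1:] * (q + [:3:])) (For k e s) \<rho> r a v G"
    unfolding emits_def
    using loop unfolding sN prN
    by (intro exI[of _ "snd ?s2"]) (simp add: prod_eq_iff algebra_simps del: sem.simps cout.simps out.simps)
qed

lemma cout_correct: "\<exists>p. ogood s p"
proof (induction s)
  case (Emit e)
  then show ?case using ogood_Emit cexp_correct by blast
next
  case (Cat s t)
  then show ?case using ogood_Cat by blast
next
  case (For k e s)
  then show ?case using ogood_For cexp_correct by blast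
qed

section \<open>Functions in polynomial time and languages in NP given by expressions\<close>

definition sym :: "bool list \<Rightarrow> nat set \<Rightarrow> nat \<Rightarrow> nat" where
  "sym x Y p = (if p < length x then bit_symbol (x ! p) + (if p \<in> Y then 2 else 0) else 0)"

lemma inp_masked: "inp (masked x Y) (length x) = sym x Y"
  by (auto simp: inp_def masked_def sym_def fun_eq_iff min_def)

theorem polytime_computable_out:
  "polytime_computable (\<lambda>x. out s (sym x {}) (\<lambda>_. length x))"
proof -
  obtain p where p: "ogood s p" using cout_correct by blast
  \<comment> \<open>Output begins at \<open>n + 1\<close>, since cell \<open>n\<close> must stay
    blank for clamped reads beyond the input. The tail puts the head on the first output cell; using
    counter 3 as scratch there also leaves it at 0, so no step follows the code.\<close>
  let ?c = "Seq (cp 2 1 3) (Seq (Inc 2) (Seq (cout (\<lambda>_. 1) 3 s) (Seq (clr 0) (Seq (cp 0 1 3) (Inc 0)))))"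
  let ?G = "obnd s + olen s + [:2, 1:]"
  let ?q = "pcompose (p + [:9, 18:]) ?G"
  show ?thesis
  proof (rule polytime_computable_com)
    show "wf_com ?c" by (auto intro!: wf_cp wf_cout simp: regs_def)
    fix x :: "bool list"
    define n where "n = length x"
    define G where "G = poly ?G n"
    let ?a = "masked x {}" and ?o = "out s (sym x {}) (\<lambda>_. n)"
    let ?v = "(cnt n)(2 := Suc n, 3 := 0)"
    have w: "?v \<circ> (\<lambda>_. 1) = (\<lambda>_. n)" by (simp add: comp_def cnt_def)
    have X: "inp ?a (?v 1) = sym x {}" by (simp add: cnt_def n_def flip: inp_masked)
    have "length ?o \<le> poly (olen s) n" by (rule length_out) (auto simp: sym_def bit_symbol_def)
    then have G: "poly (obnd s) n \<le> G" "?v 2 + length (out s (inp ?a (?v 1)) (?v \<circ> (\<lambda>_. 1))) \<le> G" "n \<le> G"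
      "Suc n \<le> G"
      unfolding G_def X w by auto
    have o: "ok (\<lambda>_. 1) 3 ?a ?v n G" using G(4) masked_less by (auto simp: ok_def regs_def cnt_def)
    have r: "oregs (\<lambda>_. 1) 3" "?v 1 < ?v 2" by (auto simp: oregs_def regs_def cnt_def)
    from ogoodE[OF p o r G(1,2)] obtain v1 where
      "sem (cout (\<lambda>_. 1) 3 s) (?a, ?v) = (over ?a (?v 2) ?o, v1)"
      and s2: "same2 3 ?v v1" "\<And>i. v1 i \<le> G" and t: "time (cout (\<lambda>_. 1) 3 s) (?a, ?v) \<le> poly p G"
      unfolding X w by blast
    then have v1: "sem (cout (\<lambda>_. 1) 3 s) (?a, ?v) = (over ?a (Suc n) ?o, v1)" by simp
    have v11: "v1 1 = n" using s2(1) by (simp add: same2_def cnt_def)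
    have init: "sem (Inc 2) (sem (cp 2 1 3) (?a, cnt n)) = (?a, ?v)"
      by (auto simp: sem_cp cnt_def fun_eq_iff)
    let ?T = "Seq (clr 0) (Seq (cp 0 1 3) (Inc 0))"
    have T: "sem ?T (b, u) = (b, u(0 := Suc (u 1), 3 := 0))" "time ?T (b, u) = 5 + 2 * u 0 + 2 * u 3 + 7 * u 1" for b u
      by (auto simp: sem_clr sem_cp time_clr time_cp fun_eq_iff)
    have se: "sem ?c (?a, cnt n) = (over ?a (Suc n) ?o, v1(0 := Suc n, 3 := 0))"
      unfolding sem.simps(5)[of "cp 2 1 3"] sem.simps(5)[of "Inc 2"] sem.simps(5)[of "cout _ _ _"] init v1 T v11 ..
    have "time ?c (?a, cnt n) = 3 + 7 * n + (1 + (time (cout (\<lambda>_. 1) 3 s) (?a, ?v) + (5 + 2 * v1 0 + 2 * v1 3 + 7 * v1 1)))"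
      unfolding time.simps(5)[of "cp 2 1 3"] time.simps(5)[of "Inc 2"] time.simps(5)[of "cout _ _ _"] init v1 T
      by (simp add: time_cp cnt_def)
    then have "time ?c (?a, cnt n) \<le> poly p G + 9 + 18 * G"
      using t s2(2)[of 0] s2(2)[of 3] s2(2)[of 1] G by linarith
    then have "time ?c (?a, cnt n) \<le> poly ?q n" by (simp add: poly_pcompose G_def)
    moreover have "over ?a (Suc n) ?o (int (Suc n) + int (length ?o)) = 0"
      by (simp add: over_def masked_def n_def)
    moreover have "\<forall>i<length ?o. over ?a (Suc n) ?o (int (Suc n) + int i) = bit_symbol (?o ! i)"
      by (auto simp: over_def)
    ultimately show "let s' = (masked x {}, cnt (length x)); s'' = sem ?c s' in
      time ?c s' \<le> poly ?q (length x) \<and> snd s'' 3 = 0 \<and>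
      (\<forall>i < length (out s (sym x {}) (\<lambda>_. length x)). fst s'' (int (snd s'' 0) + int i) =
         bit_symbol (out s (sym x {}) (\<lambda>_. length x) ! i)) \<and>
      fst s'' (int (snd s'' 0) + int (length (out s (sym x {}) (\<lambda>_. length x)))) = 0"
      using se unfolding n_def Let_def by (simp del: sem.simps time.simps)
  qed
qed

theorem NP_exp:
  "{x. \<exists>Y \<subseteq> {..<length x}. eval e (sym x Y) (\<lambda>_. length x) \<noteq> 0} \<in> NP"
proof -
  obtain p where p: "good e p" using cexp_correct by blast
  \<comment> \<open>The value is computed into counter 3, the one that decides acceptance.\<close>
  let ?c = "cexp (\<lambda>_. 1) 3 e"
  let ?G = "bnd e + [:1, 1:]"
  have *: "snd (sem ?c (masked x Y, cnt (length x))) 3 = eval e (sym x Y) (\<lambda>_. length x) \<and>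
      time ?c (masked x Y, cnt (length x)) \<le> poly (pcompose p ?G) (length x)" for x Y
  proof -
    define n where "n = length x"
    have o: "ok (\<lambda>_. 1) 3 (masked x Y) (cnt n) n (poly ?G n)"
      by (auto simp: ok_def regs_def cnt_def masked_less)
    have w: "cnt n \<circ> (\<lambda>_. 1) = (\<lambda>_. n)" by (simp add: comp_def cnt_def)
    have X: "inp (masked x Y) (cnt n 1) = sym x Y" by (simp add: cnt_def n_def flip: inp_masked)
    have "poly (bnd e) n \<le> poly ?G n" by simp
    from goodE[OF p o this] obtain v' where "sem ?c (masked x Y, cnt n) = (masked x Y, v')"
      "v' 3 = eval e (sym x Y) (\<lambda>_. n)" "time ?c (masked x Y, cnt n) \<le> poly p (poly ?G n)"
      unfolding X w by blast
    then show ?thesis unfolding n_def by (simp only: poly_pcompose snd_conv)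
  qed
  have regs: "regs (\<lambda>_. 1) 3" by (simp add: regs_def)
  have "{x. \<exists>Y \<subseteq> {..<length x}. snd (sem ?c (masked x Y, cnt (length x))) 3 \<noteq> 0} \<in> NP"
    by (rule NP_com[of ?c "pcompose p ?G"]) (use * in \<open>blast intro: wf_cexp[of "\<lambda>_. 1" 3] regs\<close>)+
  then show ?thesis by (simp only: *)
qed

section \<open>Roman Vertex Cover is in NP\<close>

text \<open>Formulas are expressions, and every nonzero value counts as true.\<close>

definition holds :: "exp \<Rightarrow> env \<Rightarrow> env \<Rightarrow> bool" where
  "holds e X v \<longleftrightarrow> eval e X v \<noteq> 0"

definition eNot :: "exp \<Rightarrow> exp" where "eNot e = Sub (C 1) e"
definition eBool :: "exp \<Rightarrow> exp" where "eBool e = eNot (eNot e)"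
definition eAnd :: "exp \<Rightarrow> exp \<Rightarrow> exp" where "eAnd e f = Mul e f"
definition eOr :: "exp \<Rightarrow> exp \<Rightarrow> exp" where "eOr e f = Add e f"
definition eImp :: "exp \<Rightarrow> exp \<Rightarrow> exp" where "eImp e f = eOr (eNot e) f"
definition eLt :: "exp \<Rightarrow> exp \<Rightarrow> exp" where "eLt e f = Sub f e"
definition eLe :: "exp \<Rightarrow> exp \<Rightarrow> exp" where "eLe e f = eNot (Sub e f)"
definition eEq :: "exp \<Rightarrow> exp \<Rightarrow> exp" where "eEq e f = eAnd (eLe e f) (eLe f e)"
definition eEx :: "nat \<Rightarrow> exp \<Rightarrow> exp \<Rightarrow> exp" where "eEx k e f = Sum k e f"
definition eAll :: "nat \<Rightarrow> exp \<Rightarrow> exp \<Rightarrow> exp" where "eAll k e f = eNot (eEx k e (eNot f))"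

lemma holds_simps [simp]:
  "holds (eNot e) X v \<longleftrightarrow> \<not> holds e X v"
  "holds (eBool e) X v \<longleftrightarrow> holds e X v"
  "holds (eAnd e f) X v \<longleftrightarrow> holds e X v \<and> holds f X v"
  "holds (eOr e f) X v \<longleftrightarrow> holds e X v \<or> holds f X v"
  "holds (eImp e f) X v \<longleftrightarrow> (holds e X v \<longrightarrow> holds f X v)"
  "holds (eLt e f) X v \<longleftrightarrow> eval e X v < eval f X v"
  "holds (eLe e f) X v \<longleftrightarrow> eval e X v \<le> eval f X v"
  "holds (eEq e f) X v \<longleftrightarrow> eval e X v = eval f X v"
  "holds (eEx k e f) X v \<longleftrightarrow> (\<exists>i < eval e X v. holds f X (v(k := i)))"
  by (auto simp: holds_def eNot_def eBool_def eAnd_def eOr_def eImp_def eLt_def eLe_def eEq_def eEx_def)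

lemma holds_eAll [simp]:
  "holds (eAll k e f) X v \<longleftrightarrow> (\<forall>i < eval e X v. holds f X (v(k := i)))"
  by (simp add: eAll_def)

lemma eval_eBool [simp]: "eval (eBool e) X v = of_bool (holds e X v)"
  by (auto simp: eBool_def eNot_def holds_def)

subsection \<open>Powers of two\<close>

definition pow2 :: "nat \<Rightarrow> bool" where "pow2 j \<longleftrightarrow> (\<exists>t. j = 2 ^ t)"

text \<open>\<open>lg (Suc k)\<close> is the number of binary digits of \<open>k\<close>. Counting
  powers of two needs only a bounded sum.\<close>

definition lg :: "nat \<Rightarrow> nat" where "lg m = (\<Sum>i<m. of_bool (pow2 i))"

text \<open>Bounded quantifiers, products and equality suffice here, so this can be written as an
  expression. For the converse take \<open>d = j\<close>: it is 1 or even, and in the latter case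
  its half inherits the condition.\<close>

lemma pow2_iff_divisors:
  "pow2 j \<longleftrightarrow> 0 < j \<and> (\<forall>d < Suc j. \<forall>e < Suc j. d * e = j \<longrightarrow> d = 1 \<or> (\<exists>h < Suc d. d = 2 * h))"
  (is "_ \<longleftrightarrow> ?R j")
proof
  assume "pow2 j"
  then obtain t where t: "j = 2 ^ t" by (auto simp: pow2_def)
  have "d = 1 \<or> (\<exists>h < Suc d. d = 2 * h)" if "d * e = j" for d e
  proof -
    have "d dvd 2 ^ t" using that t by (metis dvd_triv_left)
    then obtain s where "d = 2 ^ s" using divides_primepow_nat[OF two_is_prime_nat] by auto
    then show ?thesis by (cases s) auto
  qed
  then show "?R j" using t by auto
next
  assume "?R j"
  then show "pow2 j"
  proof (induction j rule: less_induct)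
    case (less j)
    from less.prems have "j = 1 \<or> (\<exists>h < Suc j. j = 2 * h)" by (metis lessI mult.right_neutral not_less_eq One_nat_def neq0_conv less_Suc0)
    then show ?case
    proof
      assume "j = 1" then show ?thesis by (auto simp: pow2_def intro: exI[of _ 0])
    next
      assume "\<exists>h < Suc j. j = 2 * h"
      then obtain h where h: "j = 2 * h" by blast
      have "?R h"
      proof (intro conjI allI impI)
        show "0 < h" using less.prems h by simp
        fix d e assume "d < Suc h" "e < Suc h" "d * e = h"
        then have "d < Suc j" "2 * e < Suc j" "d * (2 * e) = j" using h by auto
        then show "d = 1 \<or> (\<exists>h < Suc d. d = 2 * h)" using less.prems by blast
      qed
      then have "pow2 h" using less.IH[of h] h less.prems by simp
      then obtain t where "h = 2 ^ t" by (auto simp: pow2_def)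
      then have "j = 2 ^ Suc t" using h by simp
      then show ?thesis unfolding pow2_def by blast
    qed
  qed
qed

lemma lg_Suc: "lg (Suc m) = lg m + of_bool (pow2 m)"
  by (simp add: lg_def)

lemma less_lg_iff: "t < lg m \<longleftrightarrow> 2 ^ t < m"
proof (induction m arbitrary: t)
  case (Suc m)
  show ?case
  proof (cases "pow2 m")
    case True
    then obtain s where s: "m = 2 ^ s" by (auto simp: pow2_def)
    have "t < lg m \<longleftrightarrow> t < s" for t using Suc s by simp
    then have "lg m = s" by (metis nat_neq_iff)
    then show ?thesis using True s by (simp add: lg_Suc less_Suc_eq_le)
  next
    case False
    then have "2 ^ t \<noteq> m" by (auto simp: pow2_def)
    then show ?thesis using False Suc by (simp add: lg_Suc less_Suc_eq)
  qed
qed (simp add: lg_def)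

lemma lg_pow2: "lg (2 ^ t) = t"
  using less_lg_iff[of _ "2 ^ t"] by (metis nat_neq_iff one_less_numeral_iff power_strict_increasing_iff semiring_norm(76))

text \<open>Expressions cannot form \<open>2 ^ t\<close>, so a sum over exponents is traded for a
  sum over the powers \<open>j\<close> themselves, with \<open>lg j\<close> recovering the
  exponent.\<close>

lemma sum_pow2: "(\<Sum>j<m. of_bool (pow2 j) * (g (lg j) * j)) = (\<Sum>t<lg m. g t * 2 ^ t)" for g :: "nat \<Rightarrow> nat"
proof (induction m)
  case (Suc m)
  then show ?case by (auto simp: lg_Suc pow2_def lg_pow2)
qed (simp add: lg_def)

lemma concat_pow2:
  "concat (map (\<lambda>j. if pow2 j then [f j] else []) [0..<m]) = map (\<lambda>t. f (2 ^ t)) [0..<lg m]"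
proof (induction m)
  case (Suc m)
  then show ?case by (auto simp: lg_Suc pow2_def lg_pow2)
qed (simp add: lg_def)

lemma binary_eq_map: "binary k = map (\<lambda>t. odd (k div 2 ^ t)) [0..<lg (Suc k)]"
proof (induction k rule: less_induct)
  case (less k)
  show ?case
  proof (cases "k = 0")
    case True
    then show ?thesis by (simp add: binary.simps lg_def pow2_def)
  next
    case False
    have "t < lg (Suc k) \<longleftrightarrow> t < Suc (lg (Suc (k div 2)))" for t
    proof (cases t)
      case (Suc s)
      have "2 * 2 ^ s \<le> k \<longleftrightarrow> 2 ^ s \<le> k div 2" by auto
      then show ?thesis unfolding Suc Suc_less_eq less_lg_iff by (simp add: less_Suc_eq_le)
    qed (use False in \<open>simp add: less_lg_iff\<close>)
    then have "lg (Suc k) = Suc (lg (Suc (k div 2)))" by (metis nat_neq_iff)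
    moreover have "binary k = odd k # binary (k div 2)" using False by (subst binary.simps) simp
    ultimately show ?thesis using less[of "k div 2"] False
      by (simp add: map_upt_Suc div_mult2_eq del: upt_Suc)
  qed
qed

primrec nval :: "bool list \<Rightarrow> nat" where
  "nval [] = 0"
| "nval (b # bs) = of_bool b + 2 * nval bs"

lemma nval_sum: "nval bs = (\<Sum>t<length bs. of_bool (bs ! t) * 2 ^ t)"
  by (induction bs) (auto simp: sum.lessThan_Suc_shift sum_distrib_left ac_simps
      simp del: sum.lessThan_Suc sum_mult_of_bool_eq sum_of_bool_mult_eq)

lemma binary_nval: "bs = [] \<or> last bs \<Longrightarrow> binary (nval bs) = bs"
proof (induction bs)
  case (Cons b bs)
  have pos: "0 < nval cs" if "cs \<noteq> []" "last cs" for cs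
    using that by (induction cs) (auto split: if_splits)
  show ?case using Cons pos[of "b # bs"] by (subst binary.simps) (auto split: if_splits)
qed (simp add: binary.simps)

lemma nval_binary: "nval (binary k) = k"
proof (induction k rule: less_induct)
  case (less k)
  show ?case
  proof (cases "k = 0")
    case False
    then have "nval (binary k) = of_bool (odd k) + 2 * (k div 2)"
      using less[of "k div 2"] by (subst binary.simps) simp
    then show ?thesis by (cases "even k") auto
  qed (simp add: binary.simps)
qed

lemma last_binary: "binary k = [] \<or> last (binary k)"
proof (induction k rule: less_induct)
  case (less k)
  show ?case
  proof (cases "k = 0")
    case False
    then have "binary k = odd k # binary (k div 2)" by (subst binary.simps) simp
    moreover have "k = 1" if "binary (k div 2) = []" "k \<noteq> 0"
      using nval_binary[of "k div 2"] that by simp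
    ultimately show ?thesis using less[of "k div 2"] False by auto
  qed (simp add: binary.simps)
qed

text \<open>\<open>nval bs\<close> may be exponential, but the right-hand side never forms it. A set
  bit at \<open>t \<ge> lg (Suc w)\<close> alone contributes \<open>2 ^ t > w\<close>; without such
  a bit only powers \<open>2 ^ t \<le> w\<close> are summed.\<close>

lemma le_nval_iff:
  "w \<le> nval bs \<longleftrightarrow> (\<exists>t < length bs. bs ! t \<and> lg (Suc w) \<le> t) \<or>
     w \<le> (\<Sum>t<lg (Suc w). of_bool (t < length bs \<and> bs ! t) * 2 ^ t)"
proof (cases "\<exists>t < length bs. bs ! t \<and> lg (Suc w) \<le> t")
  case True
  then obtain t where t: "t < length bs" "bs ! t" "lg (Suc w) \<le> t" by blast
  then have "w < 2 ^ t" using less_lg_iff[of t "Suc w"] by auto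
  also have "2 ^ t = of_bool (bs ! t) * (2::nat) ^ t" using t by simp
  also have "\<dots> \<le> (\<Sum>t<length bs. of_bool (bs ! t) * (2::nat) ^ t)"
    using t by (intro member_le_sum) auto
  finally show ?thesis using True by (simp add: nval_sum)
next
  case False
  have "nval bs = (\<Sum>t<lg (Suc w). of_bool (t < length bs \<and> bs ! t) * 2 ^ t)"
  proof -
    have "(\<Sum>t<length bs. of_bool (bs ! t) * (2::nat) ^ t) =
      (\<Sum>t\<in>{t. t < length bs \<and> bs ! t}. 2 ^ t)"
      by (rule sum.mono_neutral_cong_right) auto
    also have "\<dots> = (\<Sum>t<lg (Suc w). of_bool (t < length bs \<and> bs ! t) * 2 ^ t)"
      using False by (intro sum.mono_neutral_cong_left) (auto simp: not_le)
    finally show ?thesis unfolding nval_sum .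
  qed
  show ?thesis unfolding \<open>nval bs = _\<close> using False by blast
qed

definition ePow2 :: "nat \<Rightarrow> exp \<Rightarrow> exp" where
  "ePow2 k e = eAnd (eLt (C 0) e)
     (eAll k (Add e (C 1)) (eAll (k+1) (Add e (C 1)) (eImp (eEq (Mul (V k) (V (k+1))) e)
       (eOr (eEq (V k) (C 1)) (eEx (k+2) (Add (V k) (C 1)) (eEq (V k) (Mul (C 2) (V (k+2)))))))))"

text \<open>The hypotheses say that \<open>e\<close> does not depend on the variables bound around
  it; \<open>k + 2\<close> is bound only where \<open>e\<close> no longer occurs.\<close>

lemma holds_ePow2:
  assumes "\<And>i j l. eval e X (v(k := i)) = eval e X v" "\<And>i j l. eval e X (v(k := i, k+1 := j)) = eval e X v"
  shows "holds (ePow2 k e) X v \<longleftrightarrow> pow2 (eval e X v)"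
  using assms unfolding ePow2_def pow2_iff_divisors by simp

subsection \<open>Decoding instances\<close>

lemma nth_adjacency_matrix:
  assumes "i < n" "j < n"
  shows "adjacency_matrix n E ! (i * n + j) \<longleftrightarrow> {i, j} \<in> E"
proof -
  have "concat (map (\<lambda>i. map (\<lambda>j. {i, j} \<in> E) [0..<n]) [0..<m]) ! (i * n + j) \<longleftrightarrow> {i, j} \<in> E"
    if "i < m" for m
    using that
  proof (induction m)
    case (Suc m)
    have len: "length (concat (map (\<lambda>i. map (\<lambda>j. {i, j} \<in> E) [0..<n]) [0..<m])) = m * n"
      by (simp add: length_concat comp_def sum_list_triv)
    show ?case
    proof (cases "i < m")
      case True
      then have "i * n + j < m * n"
        using assms mult_le_mono1[of "Suc i" m n] by simp
      then show ?thesis using Suc True len by (simp add: nth_append)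
    next
      case False
      then have "i = m" using Suc by simp
      then show ?thesis using assms len by (simp add: nth_append)
    qed
  qed simp
  then show ?thesis using assms by (simp add: adjacency_matrix_def)
qed

definition header :: "nat \<Rightarrow> nat" where "header n = n + 1 + n * n"

text \<open>Singles out the encodings of graphs: symmetry and the empty diagonal make the matrix
  come from edges, and the last clause forbids leading zeros of the number, which would make a
  string encode nothing.\<close>

definition instance_shape :: "bool list \<Rightarrow> nat \<Rightarrow> bool" where
  "instance_shape x n \<longleftrightarrow> n < length x \<and> (\<forall>i<n. x ! i) \<and> \<not> x ! n \<and> header n \<le> length x \<and>
     (\<forall>i<n. \<forall>j<n. x ! (n + 1 + (i * n + j)) \<longrightarrow> x ! (n + 1 + (j * n + i))) \<and>
     (\<forall>i<n. \<not> x ! (n + 1 + (i * n + i))) \<and>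
     (length x = header n \<or> x ! (length x - 1))"

lemma index_bound: "i < n \<Longrightarrow> j < n \<Longrightarrow> i * n + j < n * (n :: nat)"
  using mult_le_mono1[of "Suc i" n n] by simp

lemma encode_shape:
  assumes "graph {..<n} E" and x: "x = encode_instance n E k"
  shows "instance_shape x n" "nval (drop (header n) x) = k"
    "\<And>i j. i < n \<Longrightarrow> j < n \<Longrightarrow> x ! (n + 1 + (i * n + j)) \<longleftrightarrow> {i, j} \<in> E"
proof -
  have len: "length x = header n + length (binary k)"
    by (simp add: x encode_instance_def length_adjacency_matrix header_def)
  show adj: "x ! (n + 1 + (i * n + j)) \<longleftrightarrow> {i, j} \<in> E" if "i < n" "j < n" for i j
    using that index_bound[OF that]
    by (simp add: x encode_instance_def nth_append length_adjacency_matrix nth_adjacency_matrix)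
  have dr: "drop (header n) x = binary k"
    by (simp add: x encode_instance_def header_def length_adjacency_matrix)
  then show "nval (drop (header n) x) = k" by (simp add: nval_binary)
  have "card {i, i} = 1" for i :: nat by simp
  then have irr: "{i, i} \<notin> E" for i using assms(1) unfolding graph_def by fastforce
  have "x ! (length x - 1)" if "length x \<noteq> header n"
  proof -
    have "binary k \<noteq> []" using that len by auto
    then have "last x" using dr last_binary[of k] by (metis last_drop drop_eq_Nil not_le)
    then show ?thesis using that len by (subst last_conv_nth[symmetric]) auto
  qed
  moreover have "n < length x" "\<forall>i<n. x ! i" "\<not> x ! n"
    by (auto simp: x encode_instance_def nth_append)
  ultimately show "instance_shape x n"
    using len irr adj unfolding instance_shape_def by (auto simp: insert_commute)
qed

lemma shape_encode:
  assumes "instance_shape x n"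
  defines "E \<equiv> {{i, j} | i j. i < n \<and> j < n \<and> x ! (n + 1 + (i * n + j))}"
  shows "graph {..<n} E" "x = encode_instance n E (nval (drop (header n) x))"
proof -
  note sh = assms(1)[unfolded instance_shape_def]
  show g: "graph {..<n} E"
    unfolding graph_def
  proof (intro conjI ballI)
    fix e assume "e \<in> E"
    then obtain i j where ij: "e = {i, j}" "i < n" "j < n" "x ! (n + 1 + (i * n + j))"
      unfolding E_def by blast
    then have "i \<noteq> j" using sh by metis
    then show "card e = 2" using ij by simp
    show "e \<subseteq> {..<n}" using ij by simp
  qed simp
  have adj: "{i, j} \<in> E \<longleftrightarrow> x ! (n + 1 + (i * n + j))" if "i < n" "j < n" for i j
  proof
    assume "{i, j} \<in> E"
    then obtain k l where kl: "{i, j} = {k, l}" "k < n" "l < n" "x ! (n + 1 + (k * n + l))"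
      unfolding E_def by blast
    from kl(1) have "i = k \<and> j = l \<or> i = l \<and> j = k" by (simp add: doubleton_eq_iff)
    then show "x ! (n + 1 + (i * n + j))" using kl sh by blast
  qed (use that E_def in blast)
  have le: "header n \<le> length x" using sh by blast
  then have "n * n \<le> length x - Suc n" by (simp add: header_def)
  moreover have "n < length x" "\<forall>i<n. x ! i" "\<not> x ! n" "length x = header n \<or> x ! (length x - 1)"
    using sh by blast+
  ultimately have hd: "n < length x" "\<forall>i<n. x ! i" "\<not> x ! n" "n * n \<le> length x - Suc n"
    "header n \<le> length x" "length x = header n \<or> x ! (length x - 1)"
    using le by blast+
  have "drop (header n) x = [] \<or> last (drop (header n) x)"
  proof (cases "length x = header n")
    case False
    then show ?thesis using hd by (simp add: last_drop last_conv_nth)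
  qed simp
  then have bin: "binary (nval (drop (header n) x)) = drop (header n) x" by (rule binary_nval)
  have 1: "take n x = replicate n True"
    using hd by (intro nth_equalityI) auto
  have 2: "take (n * n) (drop (Suc n) x) = adjacency_matrix n E"
  proof (rule nth_equalityI)
    show "length (take (n * n) (drop (Suc n) x)) = length (adjacency_matrix n E)"
      using hd by (simp add: length_adjacency_matrix)
    fix p assume "p < length (take (n * n) (drop (Suc n) x))"
    then have p: "p < n * n" by simp
    then have n: "0 < n" by (cases n) auto
    have ij: "p div n < n" "p mod n < n" using p n by (auto simp: less_mult_imp_div_less)
    have "x ! (Suc n + p) = ({p div n, p mod n} \<in> E)" using adj[OF ij] by simp
    then show "take (n * n) (drop (Suc n) x) ! p = adjacency_matrix n E ! p"
      using nth_adjacency_matrix[OF ij, of E] p hd by simp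
  qed
  have "x = take n x @ x ! n # drop (Suc n) x" by (rule id_take_nth_drop[OF hd(1)])
  also have "drop (Suc n) x = take (n * n) (drop (Suc n) x) @ drop (header n) x"
    using append_take_drop_id[of "n * n" "drop (Suc n) x"] by (simp add: header_def add.commute)
  finally show "x = encode_instance n E (nval (drop (header n) x))"
    using 1 2 bin hd by (simp add: encode_instance_def)
qed

subsection \<open>The weight of the cheapest cover with given vertices\<close>

lemma card_uncovered:
  fixes n :: nat
  assumes "graph {..<n} E"
  shows "card {e \<in> E. e \<inter> R = {}} =
    (\<Sum>i<n. \<Sum>j<i. of_bool ({i, j} \<in> E \<and> i \<notin> R \<and> j \<notin> R))"
proof -
  let ?S = "Sigma {..<n} (\<lambda>i. {j. j < i \<and> {i, j} \<in> E \<and> i \<notin> R \<and> j \<notin> R})"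
  have "{e \<in> E. e \<inter> R = {}} = (\<lambda>(i, j). {i, j}) ` ?S"
  proof (intro equalityI subsetI)
    fix e assume e: "e \<in> {e \<in> E. e \<inter> R = {}}"
    then obtain a b where ab: "e = {a, b}" "a \<noteq> b" "a < n" "b < n"
      using assms unfolding graph_def by (auto simp: card_2_iff)
    then have "b < a \<or> a < b" by auto
    then obtain c d where cd: "e = {c, d}" "d < c" "c < n"
      by (rule disjE) (use ab that[of a b] that[of b a] in \<open>auto simp: insert_commute\<close>)
    then have "c \<notin> R" "d \<notin> R" "{c, d} \<in> E" using e by auto
    then have "(c, d) \<in> ?S" using cd by simp
    then show "e \<in> (\<lambda>(i, j). {i, j}) ` ?S" using cd by blast
  qed auto
  moreover have "inj_on (\<lambda>(i, j). {i, j}) ?S"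
  proof (rule inj_onI)
    fix p q assume pq: "p \<in> ?S" "q \<in> ?S" "(\<lambda>(i, j). {i, j}) p = (\<lambda>(i, j). {i, j}) q"
    obtain a b c d where *: "p = (a, b)" "q = (c, d)" by fastforce
    then have "b < a" "d < c" "{a, b} = {c, d}" using pq by auto
    then show "p = q" unfolding * doubleton_eq_iff by auto
  qed
  ultimately have "card {e \<in> E. e \<inter> R = {}} = card ?S" by (simp add: card_image)
  also have "\<dots> = (\<Sum>i<n. card {j. j < i \<and> {i, j} \<in> E \<and> i \<notin> R \<and> j \<notin> R})"
    by (rule card_SigmaI) auto
  also have "\<dots> = (\<Sum>i<n. \<Sum>j<i. of_bool ({i, j} \<in> E \<and> i \<notin> R \<and> j \<notin> R))"
    by (intro sum.cong refl) (simp add: sum_of_bool_eq lessThan_def Collect_conj_eq)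
  finally show ?thesis .
qed

text \<open>For fixed \<open>R2\<close> the cheapest \<open>R1\<close> consists of the uncovered
  edges, so only vertices have to be guessed.\<close>

lemma has_rvc_iff:
  assumes "graph U E"
  shows "has_rvc_of_weight_at_most U E k \<longleftrightarrow>
    (\<exists>R \<subseteq> U. card {e \<in> E. e \<inter> R = {}} + 2 * card R \<le> k)" (is "_ \<longleftrightarrow> ?R")
proof
  have "E \<subseteq> Pow U" using assms by (auto simp: graph_def)
  then have fin: "finite E" using assms by (auto simp: graph_def intro: finite_subset)
  assume "has_rvc_of_weight_at_most U E k"
  then obtain R1 R2 where R: "roman_vertex_cover U E R1 R2" "card R1 + 2 * card R2 \<le> k"
    by (auto simp: has_rvc_of_weight_at_most_def rvc_weight_def)
  then have "{e \<in> E. e \<inter> R2 = {}} \<subseteq> R1" "finite R1"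
    using fin by (auto simp: roman_vertex_cover_def intro: finite_subset)
  then have "card {e \<in> E. e \<inter> R2 = {}} \<le> card R1" by (rule card_mono[rotated])
  then show ?R
    using R by (intro exI[of _ R2]) (auto simp: roman_vertex_cover_def)
next
  assume ?R
  then obtain R where "R \<subseteq> U" "card {e \<in> E. e \<inter> R = {}} + 2 * card R \<le> k" by blast
  then show "has_rvc_of_weight_at_most U E k"
    unfolding has_rvc_of_weight_at_most_def rvc_weight_def roman_vertex_cover_def
    by (intro exI[of _ "{e \<in> E. e \<inter> R = {}}"] exI[of _ R]) auto
qed

definition cover_weight :: "bool list \<Rightarrow> nat \<Rightarrow> nat set \<Rightarrow> nat" where
  "cover_weight x n R = 2 * (\<Sum>i<n. of_bool (i \<in> R)) +
     (\<Sum>i<n. \<Sum>j<i. of_bool (x ! (n + 1 + (i * n + j)) \<and> i \<notin> R \<and> j \<notin> R))"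

lemma cover_weight_eq:
  assumes "graph {..<n} E" "R \<subseteq> {..<n}"
    and "\<And>i j. i < n \<Longrightarrow> j < n \<Longrightarrow> x ! (n + 1 + (i * n + j)) \<longleftrightarrow> {i, j} \<in> E"
  shows "cover_weight x n R = card {e \<in> E. e \<inter> R = {}} + 2 * card R"
proof -
  have "(\<Sum>i<n. of_bool (i \<in> R)) = card R"
    using assms(2) by (simp add: sum_of_bool_eq Int_absorb1)
  moreover have "(\<Sum>i<n. \<Sum>j<i. of_bool (x ! (n + 1 + (i * n + j)) \<and> i \<notin> R \<and> j \<notin> R)) =
     (\<Sum>i<n. \<Sum>j<i. of_bool ({i, j} \<in> E \<and> i \<notin> R \<and> j \<notin> R) :: nat)"
    using assms(3) by (intro sum.cong refl) auto
  ultimately show ?thesis by (simp add: cover_weight_def card_uncovered[OF assms(1)])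
qed

text \<open>Vertex \<open>i\<close> is represented by position \<open>i\<close> of the unary prefix,
  so a set of marked input positions serves as the guess; marks from \<open>n\<close> on do not
  affect the weight.\<close>

lemma Roman_Vertex_Cover_iff:
  "x \<in> Roman_Vertex_Cover \<longleftrightarrow> (\<exists>Y \<subseteq> {..<length x}. \<exists>n < length x.
     instance_shape x n \<and> cover_weight x n Y \<le> nval (drop (header n) x))" (is "_ \<longleftrightarrow> ?R")
proof
  assume "x \<in> Roman_Vertex_Cover"
  then obtain n E k where x: "x = encode_instance n E k" and g: "graph {..<n} E"
    and c: "has_rvc_of_weight_at_most {..<n} E k" by (auto simp: Roman_Vertex_Cover_def)
  obtain R where R: "R \<subseteq> {..<n}" "card {e \<in> E. e \<inter> R = {}} + 2 * card R \<le> k"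
    using c has_rvc_iff[OF g] by auto
  note sh = encode_shape[OF g x]
  have n: "n < length x" using sh(1) by (simp add: instance_shape_def)
  then have "R \<subseteq> {..<length x}" using R by force
  moreover have "cover_weight x n R \<le> nval (drop (header n) x)"
    using cover_weight_eq[OF g R(1) sh(3)] R sh(2) by simp
  ultimately show ?R
    using n sh(1) by blast
next
  assume ?R
  then obtain Y n where sh: "instance_shape x n" and w: "cover_weight x n Y \<le> nval (drop (header n) x)"
    by blast
  define E where "E = {{i, j} | i j. i < n \<and> j < n \<and> x ! (n + 1 + (i * n + j))}"
  let ?k = "nval (drop (header n) x)" and ?R = "Y \<inter> {..<n}"
  have g: "graph {..<n} E" and x: "x = encode_instance n E ?k"
    using shape_encode[OF sh] unfolding E_def by blast+
  have "cover_weight x n ?R = cover_weight x n Y"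
    unfolding cover_weight_def by (intro arg_cong2[of _ _ _ _ "(+)"] arg_cong2[of _ _ _ _ "(*)"] sum.cong refl) auto
  then have "card {e \<in> E. e \<inter> ?R = {}} + 2 * card ?R \<le> ?k"
    using cover_weight_eq[OF g _ encode_shape(3)[OF g x], of ?R] w by simp
  then have "has_rvc_of_weight_at_most {..<n} E ?k"
    unfolding has_rvc_iff[OF g] by (intro exI[of _ ?R]) simp
  then have "encode_instance n E ?k \<in> Roman_Vertex_Cover"
    using g unfolding Roman_Vertex_Cover_def by blast
  then show "x \<in> Roman_Vertex_Cover" by (subst x)
qed

subsection \<open>The verifier\<close>

text \<open>2 and 4 are the plain and the marked symbol of \<open>True\<close>. The blank read
  outside the input makes the formula false.\<close>

definition eBit :: "exp \<Rightarrow> exp" where "eBit e = eOr (eEq (In e) (C 2)) (eEq (In e) (C 4))"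

lemma holds_eBit [simp]:
  "holds (eBit e) (sym x Y) v \<longleftrightarrow> eval e (sym x Y) v < length x \<and> x ! eval e (sym x Y) v"
  by (auto simp: eBit_def sym_def bit_symbol_def)

definition eMask :: "exp \<Rightarrow> exp" where "eMask e = eLt (C 2) (In e)"

lemma holds_eMask [simp]:
  "holds (eMask e) (sym x Y) v \<longleftrightarrow> eval e (sym x Y) v < length x \<and> eval e (sym x Y) v \<in> Y"
  by (auto simp: eMask_def sym_def bit_symbol_def)

abbreviation eN :: exp where "eN \<equiv> V 1"

definition eAdj :: "exp \<Rightarrow> exp \<Rightarrow> exp" where
  "eAdj e f = eBit (Add (Add eN (C 1)) (Add (Mul e eN) f))"

definition eHeader :: exp where "eHeader = Add (Add eN (C 1)) (Mul eN eN)"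

definition eShape :: exp where
  "eShape = eAnd (eAll 2 eN (eBit (V 2))) (eAnd (eNot (eBit eN)) (eAnd (eLe eHeader (V 0))
     (eAnd (eAll 2 eN (eAll 3 eN (eImp (eAdj (V 2) (V 3)) (eAdj (V 3) (V 2)))))
     (eAnd (eAll 2 eN (eNot (eAdj (V 2) (V 2))))
       (eOr (eEq (V 0) eHeader) (eBit (Sub (V 0) (C 1))))))))"

definition eWeight :: exp where
  "eWeight = Add (Mul (C 2) (Sum 2 eN (eBool (eMask (V 2)))))
     (Sum 2 eN (Sum 3 (V 2) (eBool (eAnd (eAdj (V 2) (V 3))
        (eAnd (eNot (eMask (V 2))) (eNot (eMask (V 3))))))))"

definition eLg :: "exp \<Rightarrow> exp" where
  "eLg e = Sum 5 e (eBool (ePow2 6 (V 5)))"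

lemma eval_eLg [simp]: "eval (eLg e) X v = lg (eval e X v)"
  by (simp add: eLg_def lg_def holds_ePow2)

text \<open>The right-hand side of \<open>le_nval_iff\<close> with variable 2 as \<open>w\<close>,
  its sum over exponents rewritten by \<open>sum_pow2\<close>. Bit \<open>t\<close> of the bound is
  at position \<open>header n + t\<close>.\<close>

definition eWithin :: exp where
  "eWithin = eOr
     (eEx 3 (Sub (V 0) eHeader) (eAnd (eBit (Add eHeader (V 3))) (eLe (eLg (Add (V 2) (C 1))) (V 3))))
     (eLe (V 2) (Sum 3 (Add (V 2) (C 1)) (Mul (eBool (ePow2 6 (V 3)))
        (Mul (eBool (eBit (Add eHeader (eLg (V 3))))) (V 3)))))"

text \<open>Variable 2 is bound to the weight by a quantifier over all candidates.\<close>

definition verifier :: exp where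
  "verifier = eEx 1 (V 0) (eAnd eShape (eEx 2 (Add eWeight (C 1)) (eAnd (eEq (V 2) eWeight) eWithin)))"

lemma eval_eHeader [simp]: "eval eHeader X v = header (v 1)"
  by (simp add: eHeader_def header_def)

lemma holds_eShape:
  assumes "v 0 = length x" "v 1 = n" "n < length x"
  shows "holds eShape (sym x Y) v \<longleftrightarrow> instance_shape x n"
proof (cases "header n \<le> length x")
  case True
  have "n + 1 + (i * n + j) < length x" if "i < n" "j < n" for i j
    using index_bound[OF that] True by (simp add: header_def)
  moreover have "length x - Suc 0 < length x" using assms by simp
  ultimately show ?thesis using assms True
    by (auto simp: eShape_def eAdj_def instance_shape_def)
qed (use assms in \<open>auto simp: eShape_def instance_shape_def\<close>)

lemma eval_eWeight:
  assumes "v 1 = n" "instance_shape x n"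
  shows "eval eWeight (sym x Y) v = cover_weight x n Y"
proof -
  have sh: "header n \<le> length x" "n < length x" using assms(2) by (auto simp: instance_shape_def)
  have "n + 1 + (i * n + j) < length x" if "i < n" "j < n" for i j
    using index_bound[OF that] sh by (simp add: header_def)
  then show ?thesis using assms(1) sh unfolding cover_weight_def eWeight_def eAdj_def
    by (auto intro!: arg_cong2[of _ _ _ _ "(+)"] arg_cong2[of _ _ _ _ "(*)"] sum.cong)
qed

lemma holds_eWithin:
  assumes "v 0 = length x" "v 1 = n" "header n \<le> length x"
  shows "holds eWithin (sym x Y) v \<longleftrightarrow> v 2 \<le> nval (drop (header n) x)"
proof -
  let ?b = "drop (header n) x"
  have b: "header n + t < length x \<and> x ! (header n + t) \<longleftrightarrow> t < length ?b \<and> ?b ! t" for t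
    by (auto simp: nth_append less_diff_conv add.commute)
  have "(\<Sum>j<Suc (v 2). of_bool (pow2 j) * (of_bool (header n + lg j < length x \<and> x ! (header n + lg j)) * j)) =
      (\<Sum>t<lg (Suc (v 2)). of_bool (t < length ?b \<and> ?b ! t) * 2 ^ t)"
    unfolding b by (rule sum_pow2)
  moreover have "(\<exists>t<length x - header n. (header n + t < length x \<and> x ! (header n + t)) \<and> lg (Suc (v 2)) \<le> t) \<longleftrightarrow>
      (\<exists>t < length ?b. ?b ! t \<and> lg (Suc (v 2)) \<le> t)"
    unfolding b by auto
  ultimately show ?thesis using assms
    unfolding le_nval_iff eWithin_def by (simp add: holds_ePow2 del: sum.lessThan_Suc)
qed

lemma holds_verifier:
  "holds verifier (sym x Y) (\<lambda>_. length x) \<longleftrightarrow>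
     (\<exists>n < length x. instance_shape x n \<and> cover_weight x n Y \<le> nval (drop (header n) x))"
proof -
  have "holds eShape (sym x Y) ((\<lambda>_. length x)(1 := n)) \<longleftrightarrow> instance_shape x n" if "n < length x" for n
    using that by (intro holds_eShape) auto
  moreover have "(\<exists>w < Suc (eval eWeight (sym x Y) ((\<lambda>_. length x)(1 := n))).
      w = eval eWeight (sym x Y) ((\<lambda>_. length x)(1 := n, 2 := w)) \<and>
      holds eWithin (sym x Y) ((\<lambda>_. length x)(1 := n, 2 := w))) \<longleftrightarrow>
      cover_weight x n Y \<le> nval (drop (header n) x)" if "instance_shape x n" for n
  proof -
    have "header n \<le> length x" using that by (simp add: instance_shape_def)
    then show ?thesis using that by (auto simp: eval_eWeight holds_eWithin)
  qed
  ultimately show ?thesis unfolding verifier_def by auto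
qed

theorem Roman_Vertex_Cover_in_NP: "Roman_Vertex_Cover \<in> NP"
proof -
  have "Roman_Vertex_Cover = {x. \<exists>Y \<subseteq> {..<length x}. eval verifier (sym x Y) (\<lambda>_. length x) \<noteq> 0}"
    by (simp only: holds_verifier[unfolded holds_def] Roman_Vertex_Cover_iff[symmetric] Collect_mem_eq)
  then show ?thesis using NP_exp[of verifier] by (rule ssubst)
qed

section \<open>From binary constraints to Roman vertex covers\<close>

lemma card_shifted:
  fixes M :: nat
  assumes "A \<subseteq> {..<M}"
  shows "card ((\<lambda>u. {u, u + M}) ` A) = card A"
proof (rule card_image, rule inj_onI)
  fix u w assume "u \<in> A" "w \<in> A" "{u, u + M} = {w, w + M}"
  then show "u = w" using assms by (auto simp: doubleton_eq_iff)
qed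

text \<open>
  A pendant edge at every vertex makes leaving a vertex out cost 1 and taking it cost 2; the
  uncovered edges of the original graph can be paid for by one endpoint each.
\<close>

lemma rvc_pendant:
  fixes M :: nat
  assumes F: "graph {..<M} F" and "m \<le> M"
  defines "E \<equiv> F \<union> (\<lambda>u. {u, u + M}) ` {..<M}"
  shows "graph {..<2 * M} E"
    and "has_rvc_of_weight_at_most {..<2 * M} E (2 * M - m) \<longleftrightarrow>
      (\<exists>I \<subseteq> {..<M}. card I = m \<and> (\<forall>e \<in> F. \<not> e \<subseteq> I))"
proof -
  let ?p = "\<lambda>u. {u, u + M}"
  have Fsub: "e \<subseteq> {..<M}" "card e = 2" if "e \<in> F" for e
    using F that by (auto simp: graph_def)
  show g: "graph {..<2 * M} E"
    using Fsub unfolding graph_def E_def by (fastforce simp: card_insert_if)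
  let ?cover = "\<exists>R \<subseteq> {..<2 * M}. card {e \<in> E. e \<inter> R = {}} + 2 * card R \<le> 2 * M - m"
    and ?indep = "\<exists>I \<subseteq> {..<M}. card I = m \<and> (\<forall>e \<in> F. \<not> e \<subseteq> I)"
  have "F \<subseteq> Pow {..<M}" using Fsub by auto
  then have finF: "finite F" by (rule finite_subset) simp
  show "has_rvc_of_weight_at_most {..<2 * M} E (2 * M - m) \<longleftrightarrow>
      ?indep"
    unfolding has_rvc_iff[OF g]
  proof
    assume ?cover
    then obtain R where R: "R \<subseteq> {..<2 * M}" and w: "card {e \<in> E. e \<inter> R = {}} + 2 * card R \<le> 2 * M - m"
      by blast
    have finR: "finite R" using R finite_subset by blast
    let ?S = "R \<inter> {..<M}" and ?H = "R \<inter> {M..}"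
    let ?T = "{..<M} - R" and ?U = "{e \<in> F. e \<inter> R = {}}"
    \<comment> \<open>These split the vertices below \<open>M\<close> outside \<open>R\<close> by
      whether their pendant edge is uncovered. Those in \<open>?A\<close> pay 1 for that edge, those
      in \<open>?B\<close> pay 2 for the leaf \<open>u + M\<close>, so each of them pays at least
      1.\<close>
    let ?A = "{u \<in> ?T. u + M \<notin> R}" and ?B = "{u \<in> ?T. u + M \<in> R}"
    have cR: "card R = card ?S + card ?H"
      using finR by (subst card_Un_disjoint[symmetric]) (auto intro: arg_cong[of _ _ card])
    have cT: "card ?T + card ?S = M"
    proof -
      have "card (?T \<union> ?S) = card ?T + card ?S" using finR by (intro card_Un_disjoint) auto
      moreover have "?T \<union> ?S = {..<M}" by auto
      ultimately show ?thesis by simp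
    qed
    have cAB: "card ?T = card ?A + card ?B"
      by (subst card_Un_disjoint[symmetric]) (auto intro: arg_cong[of _ _ card])
    have cB: "card ?B \<le> card ?H"
      by (rule card_inj_on_le[of "\<lambda>u. u + M"]) (use finR in auto)
    have "card ?U + card ?A = card ?U + card (?p ` ?A)"
      by (subst card_shifted) auto
    also have "\<dots> = card (?U \<union> ?p ` ?A)"
    proof (rule card_Un_disjoint[symmetric])
      show "?U \<inter> ?p ` ?A = {}" using Fsub(1) by fastforce
    qed (use finF in auto)
    also have "\<dots> \<le> card {e \<in> E. e \<inter> R = {}}"
      by (rule card_mono) (use finF in \<open>auto simp: E_def\<close>)
    finally have "card ?U + card ?S + m \<le> M" using w cR cT cAB cB \<open>m \<le> M\<close> by linarith
    \<comment> \<open>One endpoint of each uncovered edge of \<open>F\<close>, added to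
      \<open>?S\<close>, gives a vertex cover of \<open>F\<close> with at most \<open>M - m\<close>
      vertices; its complement is independent.\<close>
    define f where "f e = (SOME u. u \<in> e)" for e :: "nat set"
    have f: "f e \<in> e" if "e \<in> F" for e
    proof -
      have "e \<noteq> {}" using Fsub(2)[OF that] by auto
      then show ?thesis unfolding f_def by (simp add: some_in_eq)
    qed
    let ?C = "?S \<union> f ` ?U"
    have "card ?C \<le> card ?S + card (f ` ?U)" by (rule card_Un_le)
    also have "card (f ` ?U) \<le> card ?U" using finF by (intro card_image_le) auto
    finally have "card ?C + m \<le> M" using \<open>card ?U + card ?S + m \<le> M\<close> by linarith
    moreover have "M - card ?C \<le> card ({..<M} - ?C)"
      using finR finF diff_card_le_card_Diff[of ?C "{..<M}"] by simp
    ultimately have "m \<le> card ({..<M} - ?C)" by linarith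
    from obtain_subset_with_card_n[OF this] obtain I where I: "I \<subseteq> {..<M} - ?C" "card I = m" .
    have "\<not> e \<subseteq> I" if e: "e \<in> F" for e
    proof
      assume sub: "e \<subseteq> I"
      then have "e \<inter> R = {}" using I(1) by blast
      then have "f e \<in> ?C" using e by blast
      then show False using f[OF e] sub I(1) by blast
    qed
    then show ?indep using I by blast
  next
    assume ?indep
    then obtain I where I: "I \<subseteq> {..<M}" "card I = m" "\<And>e. e \<in> F \<Longrightarrow> \<not> e \<subseteq> I" by blast
    \<comment> \<open>Taking the vertices outside \<open>I\<close> covers all of \<open>F\<close>,
      and only the pendant edges at \<open>I\<close> remain: the weight is at most
      \<open>m + 2 * (M - m)\<close>.\<close>
    let ?R = "{..<M} - I"
    have finI: "finite I" using I(1) finite_subset by blast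
    have "{e \<in> E. e \<inter> ?R = {}} \<subseteq> ?p ` I"
    proof
      fix e assume e: "e \<in> {e \<in> E. e \<inter> ?R = {}}"
      then have "e \<notin> F" using I(3)[of e] Fsub(1)[of e] by blast
      then obtain u where "u < M" "e = {u, u + M}" using e unfolding E_def by auto
      then show "e \<in> ?p ` I" using e by auto
    qed
    then have "card {e \<in> E. e \<inter> ?R = {}} \<le> card (?p ` I)" using finI by (intro card_mono) auto
    also have "\<dots> = m" using I by (simp add: card_shifted)
    finally have "card {e \<in> E. e \<inter> ?R = {}} + 2 * card ?R \<le> 2 * M - m"
      using I finI \<open>m \<le> M\<close> by (simp add: card_Diff_subset)
    then show ?cover
      by (intro exI[of _ ?R]) auto
  qed
qed

text \<open>
  Vertex \<open>g * c + a\<close> stands for the assignment of the value \<open>a < c\<close> to the variable \<open>g < m\<close>.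
\<close>

definition solution :: "nat \<Rightarrow> nat \<Rightarrow> (nat \<Rightarrow> nat \<Rightarrow> bool) \<Rightarrow> (nat \<Rightarrow> nat) \<Rightarrow> bool" where
  "solution m c Cf \<sigma> \<longleftrightarrow> (\<forall>g<m. \<sigma> g < c) \<and>
     (\<forall>g<m. \<forall>h<m. g \<noteq> h \<longrightarrow> \<not> Cf (g * c + \<sigma> g) (h * c + \<sigma> h))"

text \<open>\<open>Cf\<close> need not be symmetric, as it will relate a cell to one of the next
  time; hence both orders. Vertex \<open>u + M\<close> is the leaf pendant at
  \<open>u\<close>.\<close>

definition conflict_graph :: "nat \<Rightarrow> (nat \<Rightarrow> nat \<Rightarrow> bool) \<Rightarrow> nat set set" where
  "conflict_graph M Cf = {{i, j} | i j. i < 2 * M \<and> j < 2 * M \<and> i \<noteq> j \<and>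
     (i < M \<and> j < M \<and> (Cf i j \<or> Cf j i) \<or> j = i + M \<or> i = j + M)}"

text \<open>Values of one variable exclude each other, so an independent set has at most one vertex
  per group. With \<open>m\<close> vertices in \<open>m\<close> groups it has exactly one in each,
  which is an assignment.\<close>

lemma conflict_graph:
  fixes Cf :: "nat \<Rightarrow> nat \<Rightarrow> bool"
  assumes c: "0 < c" and grp: "\<And>u w. u < m * c \<Longrightarrow> w < m * c \<Longrightarrow> u div c = w div c \<Longrightarrow> Cf u w"
  defines "E \<equiv> conflict_graph (m * c) Cf"
  shows "graph {..<2 * (m * c)} E"
    and "has_rvc_of_weight_at_most {..<2 * (m * c)} E (2 * (m * c) - m) \<longleftrightarrow>
      (\<exists>\<sigma>. solution m c Cf \<sigma>)"
proof -
  let ?M = "m * c"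
  define F where "F = {{i, j} | i j. i < ?M \<and> j < ?M \<and> i \<noteq> j \<and> (Cf i j \<or> Cf j i)}"
  have F: "graph {..<?M} F"
    unfolding graph_def F_def by (auto simp: card_insert_if)
  have E: "E = F \<union> (\<lambda>u. {u, u + ?M}) ` {..<?M}"
  proof (intro equalityI subsetI)
    fix e assume "e \<in> E"
    then obtain i j where e: "e = {i, j}" "i < 2 * ?M" "j < 2 * ?M" "i \<noteq> j"
      "i < ?M \<and> j < ?M \<and> (Cf i j \<or> Cf j i) \<or> j = i + ?M \<or> i = j + ?M"
      unfolding E_def conflict_graph_def by blast
    from e(5) show "e \<in> F \<union> (\<lambda>u. {u, u + ?M}) ` {..<?M}"
    proof (elim disjE)
      assume "i < ?M \<and> j < ?M \<and> (Cf i j \<or> Cf j i)"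
      then show ?thesis using e unfolding F_def by blast
    next
      assume "j = i + ?M"
      then have "i < ?M" "e = {i, i + ?M}" using e(1,3) by (linarith, simp)
      then show ?thesis by blast
    next
      assume "i = j + ?M"
      then have "j < ?M" "e = {j, j + ?M}" using e(1,2) by (linarith, auto)
      then show ?thesis by blast
    qed
  next
    fix e assume "e \<in> F \<union> (\<lambda>u. {u, u + ?M}) ` {..<?M}"
    then show "e \<in> E"
    proof
      assume "e \<in> F"
      then obtain i j where "e = {i, j}" "i < ?M" "j < ?M" "i \<noteq> j" "Cf i j \<or> Cf j i"
        unfolding F_def by blast
      then show ?thesis unfolding E_def conflict_graph_def
        by (intro CollectI exI[of _ i] exI[of _ j]) auto
    next
      assume "e \<in> (\<lambda>u. {u, u + ?M}) ` {..<?M}"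
      then obtain u where u: "e = {u, u + ?M}" "u < ?M" by auto
      then have "u < 2 * ?M \<and> u + ?M < 2 * ?M \<and> u \<noteq> u + ?M" by linarith
      with u(1) show ?thesis unfolding E_def conflict_graph_def by blast
    qed
  qed
  have mM: "m \<le> ?M" using c by simp
  show "graph {..<2 * ?M} E" unfolding E by (rule rvc_pendant(1)[OF F mM])
  have indep: "(\<forall>e \<in> F. \<not> e \<subseteq> I) \<longleftrightarrow> (\<forall>u \<in> I. \<forall>w \<in> I. u \<noteq> w \<longrightarrow> \<not> Cf u w)" if "I \<subseteq> {..<?M}" for I
  proof
    assume *: "\<forall>e \<in> F. \<not> e \<subseteq> I"
    show "\<forall>u \<in> I. \<forall>w \<in> I. u \<noteq> w \<longrightarrow> \<not> Cf u w"
    proof (intro ballI impI notI)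
      fix u w assume "u \<in> I" "w \<in> I" "u \<noteq> w" "Cf u w"
      moreover from this have "{u, w} \<in> F" using that unfolding F_def by auto
      ultimately show False using * by auto
    qed
  next
    assume *: "\<forall>u \<in> I. \<forall>w \<in> I. u \<noteq> w \<longrightarrow> \<not> Cf u w"
    show "\<forall>e \<in> F. \<not> e \<subseteq> I"
    proof (intro ballI notI)
      fix e assume "e \<in> F" "e \<subseteq> I"
      then obtain i j where "i \<in> I" "j \<in> I" "i \<noteq> j" "Cf i j \<or> Cf j i" unfolding F_def by auto
      with * show False by metis
    qed
  qed
  have div: "(g * c + a) div c = g" "(g * c + a) mod c = a" if "a < c" for g a
    using that by auto
  have lt: "g * c + a < ?M" if "g < m" "a < c" for g a
    using mult_le_mono1[of "Suc g" m c] that by simp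
  show "has_rvc_of_weight_at_most {..<2 * ?M} E (2 * ?M - m) \<longleftrightarrow>
      (\<exists>\<sigma>. solution m c Cf \<sigma>)"
    unfolding E rvc_pendant(2)[OF F mM]
  proof
    assume "\<exists>I \<subseteq> {..<?M}. card I = m \<and> (\<forall>e \<in> F. \<not> e \<subseteq> I)"
    then obtain I where I: "I \<subseteq> {..<?M}" "card I = m" "\<forall>u \<in> I. \<forall>w \<in> I. u \<noteq> w \<longrightarrow> \<not> Cf u w"
      using indep by blast
    have inj: "inj_on (\<lambda>u. u div c) I"
    proof (rule inj_onI, rule ccontr)
      fix u w assume uw: "u \<in> I" "w \<in> I" "u div c = w div c" "u \<noteq> w"
      then have "u < ?M" "w < ?M" using I(1) by auto
      then have "Cf u w" using uw(3) by (rule grp)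
      then show False using I(3) uw by blast
    qed
    have sub: "(\<lambda>u. u div c) ` I \<subseteq> {..<m}"
      using I(1) by (auto simp: less_mult_imp_div_less)
    have "(\<lambda>u. u div c) ` I = {..<m}"
      using sub card_image[OF inj] I(2) by (intro card_subset_eq) auto
    then have "\<forall>g<m. \<exists>u \<in> I. u div c = g" by (metis imageE lessThan_iff)
    then obtain s where s: "\<And>g. g < m \<Longrightarrow> s g \<in> I \<and> s g div c = g" by metis
    have sg: "g * c + s g mod c = s g" if "g < m" for g
      using s[OF that] div_mult_mod_eq[of "s g" c] by simp
    show "\<exists>\<sigma>. solution m c Cf \<sigma>"
      unfolding solution_def
    proof (intro exI[of _ "\<lambda>g. s g mod c"] conjI allI impI)
      fix g h assume gh: "g < m" "h < m" "g \<noteq> h"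
      then have "s g \<noteq> s h" using s by metis
      then show "\<not> Cf (g * c + s g mod c) (h * c + s h mod c)"
        unfolding sg[OF gh(1)] sg[OF gh(2)] using I(3) s gh by blast
    qed (use c in auto)
  next
    assume "\<exists>\<sigma>. solution m c Cf \<sigma>"
    then obtain \<sigma> where \<sigma>: "\<And>g. g < m \<Longrightarrow> \<sigma> g < c"
      "\<And>g h. g < m \<Longrightarrow> h < m \<Longrightarrow> g \<noteq> h \<Longrightarrow> \<not> Cf (g * c + \<sigma> g) (h * c + \<sigma> h)"
      unfolding solution_def by blast
    let ?I = "(\<lambda>g. g * c + \<sigma> g) ` {..<m}"
    have "inj_on (\<lambda>g. g * c + \<sigma> g) {..<m}"
      using \<sigma>(1) div(1) by (intro inj_onI) (metis lessThan_iff)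
    then have "card ?I = m" by (simp add: card_image)
    moreover have sub: "?I \<subseteq> {..<?M}" using lt \<sigma>(1) by auto
    moreover have "\<forall>u \<in> ?I. \<forall>w \<in> ?I. u \<noteq> w \<longrightarrow> \<not> Cf u w" using \<sigma>(2) by auto
    then have "\<forall>e \<in> F. \<not> e \<subseteq> ?I" unfolding indep[OF sub] .
    ultimately show "\<exists>I \<subseteq> {..<?M}. card I = m \<and> (\<forall>e \<in> F. \<not> e \<subseteq> I)"
      by (intro exI[of _ ?I] conjI)
  qed
qed

section \<open>Computations as solutions of local constraints\<close>

type_synonym cell = "transition \<times> nat list \<times> bool list"

definition src :: "transition \<Rightarrow> nat" where "src = fst"
definition rds :: "transition \<Rightarrow> nat list" where "rds l = fst (snd l)"
definition tgt :: "transition \<Rightarrow> nat" where "tgt l = fst (snd (snd l))"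
definition acts :: "transition \<Rightarrow> (nat \<times> int) list" where "acts l = snd (snd (snd l))"

definition symbols :: "tm \<Rightarrow> nat set" where
  "symbols M = {0, 1, 2} \<union> (\<Union>l \<in> program M. set (rds l) \<union> fst ` set (acts l))"

definition states :: "tm \<Rightarrow> nat set" where
  "states M = {start_state M} \<union> src ` program M \<union> tgt ` program M"

definition idle :: "tm \<Rightarrow> transition \<Rightarrow> bool" where
  "idle M l \<longleftrightarrow> (\<nexists>q' as. (src l, rds l, q', as) \<in> program M)"

text \<open>
  Every configuration has a label: an applicable transition, or a transition that changes nothing
  if the configuration is halting. So computations can be prolonged to a fixed length.
\<close>

definition labels :: "tm \<Rightarrow> transition set" where
  "labels M = program M \<union> {l. idle M l \<and> src l \<in> states M \<and> set (rds l) \<subseteq> symbols M \<and>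
     length (rds l) = num_tapes M \<and> tgt l = src l \<and> acts l = map (\<lambda>s. (s, 0)) (rds l)}"

definition cells :: "tm \<Rightarrow> cell set" where
  "cells M = labels M \<times> {ss. set ss \<subseteq> symbols M \<and> length ss = num_tapes M}
     \<times> {hs :: bool list. set hs \<subseteq> UNIV \<and> length hs = num_tapes M}"

lemma transition_eq: "l = (src l, rds l, tgt l, acts l)"
  by (simp add: src_def rds_def tgt_def acts_def)

lemma program_wf:
  assumes "wf_tm M" "l \<in> program M"
  shows "length (rds l) = num_tapes M" "length (acts l) = num_tapes M"
    "(w, d) \<in> set (acts l) \<Longrightarrow> d \<in> {-1, 0, 1}"
proof -
  have *: "(src l, rds l, tgt l, acts l) \<in> program M" using assms(2) transition_eq by metis
  show "length (rds l) = num_tapes M" "length (acts l) = num_tapes M"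
    using assms(1) * unfolding wf_tm_def by auto
  show "(w, d) \<in> set (acts l) \<Longrightarrow> d \<in> {-1, 0, 1}"
    using assms(1) * unfolding wf_tm_def by fastforce
qed

lemma finite_cells:
  assumes "wf_tm M"
  shows "finite (cells M)"
proof -
  have fp: "finite (program M)" using assms by (simp add: wf_tm_def)
  then have fs: "finite (symbols M)" and fq: "finite (states M)"
    by (auto simp: symbols_def states_def)
  let ?L = "{ss. set ss \<subseteq> symbols M \<and> length ss = num_tapes M}"
  have fl: "finite ?L" using fs by (rule finite_lists_length_eq)
  have "labels M \<subseteq> program M \<union> (\<lambda>(q, rs). (q, rs, q, map (\<lambda>s. (s, 0)) rs)) ` (states M \<times> ?L)"
    unfolding labels_def by (auto simp: src_def rds_def tgt_def acts_def image_iff)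
  then have "finite (labels M)" using fp fq fl by (auto intro: finite_subset)
  moreover have "finite {hs :: bool list. set hs \<subseteq> UNIV \<and> length hs = num_tapes M}"
    by (rule finite_lists_length_eq) simp
  ultimately show ?thesis unfolding cells_def using fl by auto
qed

context
  fixes M :: tm and x :: "bool list" and T :: nat
  assumes wf: "wf_tm M" and T: "0 < T"
begin

lemma labels_wf:
  assumes "l \<in> labels M"
  shows "length (rds l) = num_tapes M" "length (acts l) = num_tapes M" "set (rds l) \<subseteq> symbols M"
    "fst ` set (acts l) \<subseteq> symbols M" "i < num_tapes M \<Longrightarrow> snd (acts l ! i) \<in> {-1, 0, 1}"
    "src l \<in> states M" "tgt l \<in> states M"
proof -
  show len: "length (rds l) = num_tapes M" "length (acts l) = num_tapes M"
    using assms program_wf(1,2)[OF wf, of l] unfolding labels_def by auto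
  show "set (rds l) \<subseteq> symbols M"
  proof (cases "l \<in> program M")
    case True
    then show ?thesis unfolding symbols_def by blast
  qed (use assms in \<open>auto simp: labels_def\<close>)
  show "fst ` set (acts l) \<subseteq> symbols M"
  proof (cases "l \<in> program M")
    case True
    then show ?thesis unfolding symbols_def by blast
  next
    case False
    then have "fst ` set (acts l) = set (rds l)" using assms by (force simp: labels_def)
    then show ?thesis using \<open>set (rds l) \<subseteq> symbols M\<close> by simp
  qed
  show "src l \<in> states M" "tgt l \<in> states M"
    using assms unfolding labels_def by (auto simp: states_def)
  show "snd (acts l ! i) \<in> {-1, 0, 1}" if "i < num_tapes M"
  proof (cases "l \<in> program M")
    case True
    have "(fst (acts l ! i), snd (acts l ! i)) \<in> set (acts l)" using that len by simp
    then show ?thesis using program_wf(3)[OF wf True] by blast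
  next
    case False
    then show ?thesis using assms that len unfolding labels_def by auto
  qed
qed

definition input_symbol :: "int \<Rightarrow> nat" where
  "input_symbol p = (if 0 \<le> p \<and> p < int (length x) then bit_symbol (x ! nat p) else 0)"

text \<open>
  The cell \<open>(l, ss, hs)\<close> at \<open>(t, p)\<close> describes position \<open>p - T\<close> at time \<open>t\<close>: \<open>ss ! i\<close> is the symbol on
  tape \<open>i\<close>, \<open>hs ! i\<close> tells whether its head is there, and \<open>l\<close> is the label used at time \<open>t\<close>.
\<close>

definition bad_cell :: "nat \<Rightarrow> nat \<Rightarrow> cell \<Rightarrow> bool" where
  "bad_cell t p c \<longleftrightarrow> (case c of (l, ss, hs) \<Rightarrow>
     (\<exists>i<num_tapes M. hs ! i \<and> ss ! i \<noteq> rds l ! i) \<or>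
     t = 0 \<and> (src l \<noteq> start_state M \<or> ss ! 0 \<noteq> input_symbol (int p - int T) \<or>
       (\<exists>i<num_tapes M. 0 < i \<and> ss ! i \<noteq> 0) \<or> (\<exists>i<num_tapes M. hs ! i \<noteq> (p = T))) \<or>
     Suc t = T \<and> (src l \<noteq> accept_state M \<or> \<not> idle M l))"

text \<open>A head must appear where its action sends it. That it appears nowhere else follows
  because two cells of one time may not both carry the flag of a tape.\<close>

definition bad_pair :: "nat \<Rightarrow> nat \<Rightarrow> cell \<Rightarrow> nat \<Rightarrow> nat \<Rightarrow> cell \<Rightarrow> bool" where
  "bad_pair t p c t' p' c' \<longleftrightarrow> (case c of (l, ss, hs) \<Rightarrow> case c' of (l', ss', hs') \<Rightarrow>
     t' = t \<and> (l \<noteq> l' \<or> (\<exists>i<num_tapes M. hs ! i \<and> hs' ! i)) \<or>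
     t' = Suc t \<and> (tgt l \<noteq> src l' \<or>
       p' = p \<and> (\<exists>i<num_tapes M. ss' ! i \<noteq> (if hs ! i then fst (acts l ! i) else ss ! i)) \<or>
       (\<exists>i<num_tapes M. hs ! i \<and> int p' = int p + snd (acts l ! i) \<and> \<not> hs' ! i)))"

definition consistent :: "(nat \<Rightarrow> nat \<Rightarrow> cell) \<Rightarrow> bool" where
  "consistent \<sigma> \<longleftrightarrow>
     (\<forall>t<T. \<forall>p<2*T. \<sigma> t p \<in> cells M \<and> \<not> bad_cell t p (\<sigma> t p)) \<and>
     (\<forall>t<T. \<forall>p<2*T. \<forall>t'<T. \<forall>p'<2*T. (t, p) \<noteq> (t', p') \<longrightarrow>
        \<not> bad_pair t p (\<sigma> t p) t' p' (\<sigma> t' p'))"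

fun next_config :: "config \<Rightarrow> transition \<Rightarrow> config" where
  "next_config (q, ts) l = (tgt l, map2 act ts (acts l))"

definition matches :: "config \<Rightarrow> transition \<Rightarrow> bool" where
  "matches c l \<longleftrightarrow> l \<in> labels M \<and> fst c = src l \<and> map scanned (snd c) = rds l"

definition accepting_run :: "(nat \<Rightarrow> config) \<Rightarrow> (nat \<Rightarrow> transition) \<Rightarrow> bool" where
  "accepting_run R L \<longleftrightarrow> R 0 = initial M x \<and> (\<forall>t<T. matches (R t) (L t)) \<and>
     (\<forall>t. R (Suc t) = next_config (R t) (L t)) \<and>
     src (L (T - 1)) = accept_state M \<and> idle M (L (T - 1))"

lemma act_eq: "act tp a = ((fst tp)(snd tp := fst a), snd tp + snd a)"
  by (cases tp; cases a) simp

lemma scanned_eq: "scanned tp = fst tp (snd tp)"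
  by (cases tp) simp

lemma idle_next: 
  assumes "matches c l" "l \<notin> program M"
  shows "next_config c l = c"
proof -
  obtain q ts where c: "c = (q, ts)" by fastforce
  have l: "tgt l = src l" "acts l = map (\<lambda>s. (s, 0)) (rds l)"
    using assms unfolding matches_def labels_def by auto
  have "acts l = map (\<lambda>s. (s, 0)) (map scanned ts)"
    using assms(1) l unfolding matches_def c by simp
  then have "map2 act ts (acts l) = ts"
    by (intro nth_equalityI) (simp_all add: act_eq scanned_eq)
  then show ?thesis using assms l unfolding matches_def c by simp
qed

lemma program_next:
  assumes "matches c l" "l \<in> program M"
  shows "(c, next_config c l) \<in> step M"
proof -
  obtain q ts where c: "c = (q, ts)" by fastforce
  have "(src l, rds l, tgt l, acts l) \<in> program M" using assms(2) transition_eq by metis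
  then show ?thesis using assms(1) unfolding matches_def c step_def by auto
qed

lemma halting_idle:
  assumes "fst c = src l" "map scanned (snd c) = rds l"
  shows "halting M c \<longleftrightarrow> idle M l"
  using assms unfolding halting_def idle_def step_def by (cases c) auto

lemma initial_tapes:
  "length (snd (initial M x)) = num_tapes M"
  "i < num_tapes M \<Longrightarrow> snd (initial M x) ! i = (if i = 0 then input_symbol else (\<lambda>_. 0), 0)"
  using wf by (auto simp: initial_def wf_tm_def input_tape_def input_symbol_def fun_eq_iff nth_Cons')

text \<open>Keeps states and symbols within the finite sets from which idle labels and cells are
  formed.\<close>

definition well :: "config \<Rightarrow> bool" where
  "well c \<longleftrightarrow> fst c \<in> states M \<and> length (snd c) = num_tapes M \<and>
     (\<forall>i<num_tapes M. \<forall>p. fst (snd c ! i) p \<in> symbols M)"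

lemma well_initial: "well (initial M x)"
proof -
  have "input_symbol p \<in> symbols M" for p by (auto simp: input_symbol_def bit_symbol_def symbols_def)
  then have "fst (snd (initial M x) ! i) p \<in> symbols M" if "i < num_tapes M" for i p
    using that by (simp add: initial_tapes symbols_def)
  moreover have "fst (initial M x) = start_state M" by (simp add: initial_def)
  ultimately show ?thesis unfolding well_def using initial_tapes(1)
    by (auto simp: states_def)
qed

lemma next_tapes:
  assumes "length (snd c) = num_tapes M" "l \<in> labels M"
  shows "fst (next_config c l) = tgt l" "length (snd (next_config c l)) = num_tapes M"
    "i < num_tapes M \<Longrightarrow> snd (next_config c l) ! i =
      ((fst (snd c ! i))(snd (snd c ! i) := fst (acts l ! i)), snd (snd c ! i) + snd (acts l ! i))"
  using assms labels_wf(2)[OF assms(2)] by (cases c; simp add: act_eq)+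

lemma well_next:
  assumes "well c" "l \<in> labels M"
  shows "well (next_config c l)"
proof -
  have len: "length (snd c) = num_tapes M" using assms by (simp add: well_def)
  note n = next_tapes[OF len assms(2)]
  have "fst (snd (next_config c l) ! i) p \<in> symbols M" if i: "i < num_tapes M" for i p
  proof -
    have "acts l ! i \<in> set (acts l)" using i labels_wf(2)[OF assms(2)] by simp
    then have "fst (acts l ! i) \<in> symbols M" using labels_wf(4)[OF assms(2)] by blast
    moreover have "fst (snd c ! i) p \<in> symbols M" using assms(1) i len unfolding well_def by simp
    ultimately show ?thesis using n(3)[OF i] by simp
  qed
  then show ?thesis using n(1,2) labels_wf(7)[OF assms(2)]
    unfolding well_def by auto
qed

lemma step_label:
  assumes "(c, d) \<in> step M"
  shows "\<exists>l \<in> program M. matches c l \<and> d = next_config c l"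
proof -
  obtain q ts q' as where *: "c = (q, ts)" "d = (q', map2 act ts as)"
    "(q, map scanned ts, q', as) \<in> program M" using assms by (auto simp: step_def)
  then show ?thesis
    by (intro bexI[of _ "(q, map scanned ts, q', as)"])
      (auto simp: matches_def labels_def src_def rds_def tgt_def acts_def)
qed

lemma halting_label:
  assumes "halting M c" "well c"
  shows "\<exists>l. matches c l \<and> next_config c l = c \<and> idle M l \<and> src l = fst c"
proof -
  let ?rs = "map scanned (snd c)"
  let ?l = "(fst c, ?rs, fst c, map (\<lambda>s. (s, 0)) ?rs) :: transition"
  have id: "idle M ?l" using assms(1) halting_idle[of c ?l] by (simp add: src_def rds_def)
  have "scanned tp \<in> symbols M" if "tp \<in> set (snd c)" for tp
    using assms(2) that unfolding well_def scanned_eq by (metis in_set_conv_nth)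
  then have "?l \<in> labels M"
    using id assms(2) unfolding labels_def well_def
    by (auto simp: src_def rds_def tgt_def acts_def)
  then have m: "matches c ?l" by (simp add: matches_def src_def rds_def)
  moreover have "?l \<notin> program M" using id unfolding idle_def by (auto simp: src_def rds_def)
  ultimately show ?thesis using id idle_next[OF m] by (intro exI[of _ ?l]) (simp add: src_def)
qed

text \<open>Paths are shorter than \<open>T\<close>, so an accepting one can be padded with the idle
  label of its last configuration. Conversely, idle labels change nothing, and an idle label at time
  \<open>T - 1\<close> certifies halting.\<close>

lemma accepts_iff_run:
  assumes bound: "\<And>n c. (initial M x, c) \<in> step M ^^ n \<Longrightarrow> n < T"
  shows "accepts M x \<longleftrightarrow> (\<exists>R L. accepting_run R L)"
proof
  assume "\<exists>R L. accepting_run R L"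
  then obtain R L where r: "accepting_run R L" by blast
  have reach: "t < T \<Longrightarrow> (initial M x, R t) \<in> (step M)\<^sup>*" for t
  proof (induction t)
    case (Suc t)
    have m: "matches (R t) (L t)" "R (Suc t) = next_config (R t) (L t)"
      using r Suc.prems by (auto simp: accepting_run_def)
    then have "(R t, R (Suc t)) \<in> (step M)\<^sup>*"
      using program_next[of "R t" "L t"] idle_next[of "R t" "L t"] by (cases "L t \<in> program M") auto
    then show ?case using Suc by (meson Suc_lessD rtrancl_trans)
  qed (use r in \<open>simp add: accepting_run_def\<close>)
  have m: "matches (R (T - 1)) (L (T - 1))" "src (L (T - 1)) = accept_state M" "idle M (L (T - 1))"
    using r T by (auto simp: accepting_run_def)
  then have "halting M (R (T - 1))" "fst (R (T - 1)) = accept_state M"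
    using halting_idle[of "R (T - 1)" "L (T - 1)"] unfolding matches_def by auto
  then show "accepts M x" using reach[of "T - 1"] T
    unfolding accepts_def by (intro exI[of _ "R (T - 1)"]) simp
next
  assume "accepts M x"
  then obtain d n where d: "(initial M x, d) \<in> step M ^^ n" "halting M d" "fst d = accept_state M"
    by (auto simp: accepts_def dest: rtrancl_imp_relpow)
  have n: "n < T" using bound d(1) by blast
  obtain f where f: "f 0 = initial M x" "f n = d" "\<And>i. i < n \<Longrightarrow> (f i, f (Suc i)) \<in> step M"
    using d(1) unfolding relpow_fun_conv by blast
  have "\<exists>l. i < n \<longrightarrow> matches (f i) l \<and> f (Suc i) = next_config (f i) l" for i
    using f(3) step_label by blast
  then obtain l where l: "\<And>i. i < n \<Longrightarrow> matches (f i) (l i) \<and> f (Suc i) = next_config (f i) (l i)"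
    by metis
  have "well (f i)" if "i \<le> n" for i
    using that
  proof (induction i)
    case (Suc i)
    then show ?case using l[of i] well_next[of "f i" "l i"] by (simp add: matches_def)
  qed (simp add: f well_initial)
  then have "well d" using f(2) by blast
  from halting_label[OF d(2) this] obtain e where
    e: "matches d e" "next_config d e = d" "idle M e" "src e = fst d" by blast
  let ?R = "\<lambda>t. if t < n then f t else d" and ?L = "\<lambda>t. if t < n then l t else e"
  have "?R (Suc t) = next_config (?R t) (?L t)" for t
    using l[of t] e(2) f(2) by (auto simp: less_Suc_eq not_less_eq)
  moreover have "matches (?R t) (?L t)" for t using l e by auto
  moreover have "?R 0 = initial M x" using f by (cases n) auto
  moreover have "\<not> T - 1 < n" using n by simp
  ultimately have "accepting_run ?R ?L" using e d(3) unfolding accepting_run_def by auto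
  then show "\<exists>R L. accepting_run R L" by blast
qed

definition cell_of :: "(nat \<Rightarrow> config) \<Rightarrow> (nat \<Rightarrow> transition) \<Rightarrow> nat \<Rightarrow> nat \<Rightarrow> cell" where
  "cell_of R L t p = (L t, map (\<lambda>tp. fst tp (int p - int T)) (snd (R t)),
     map (\<lambda>tp. snd tp = int p - int T) (snd (R t)))"

lemma run_consistent:
  assumes r: "accepting_run R L"
  shows "consistent (cell_of R L)"
proof -
  have m: "matches (R t) (L t)" if "t < T" for t using r that by (simp add: accepting_run_def)
  have nx: "R (Suc t) = next_config (R t) (L t)" for t using r by (simp add: accepting_run_def)
  have w: "t < T \<Longrightarrow> well (R t)" for t
  proof (induction t)
    case 0
    then show ?case using r well_initial by (simp add: accepting_run_def)
  next
    case (Suc t)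
    then show ?case using well_next m nx by (simp add: matches_def)
  qed
  have len: "length (snd (R t)) = num_tapes M" if "t < T" for t using w[OF that] by (simp add: well_def)
  have lab: "L t \<in> labels M" if "t < T" for t using m[OF that] by (simp add: matches_def)
  have rd: "rds (L t) ! i = fst (snd (R t) ! i) (snd (snd (R t) ! i))" if "t < T" "i < num_tapes M" for t i
  proof -
    have "rds (L t) = map scanned (snd (R t))" using m[OF that(1)] by (simp add: matches_def)
    then show ?thesis using that len by (cases "snd (R t) ! i") simp
  qed
  show ?thesis
    unfolding consistent_def
  proof (intro conjI allI impI)
    fix t p assume tp: "t < T" "p < 2 * T"
    have "set (map (\<lambda>tp. fst tp q) (snd (R t))) \<subseteq> symbols M" for q
    proof
      fix s assume "s \<in> set (map (\<lambda>tp. fst tp q) (snd (R t)))"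
      then obtain i where "i < num_tapes M" "s = fst (snd (R t) ! i) q"
        using len[OF tp(1)] unfolding in_set_conv_nth by auto
      then show "s \<in> symbols M" using w[OF tp(1)] by (simp add: well_def)
    qed
    then show "cell_of R L t p \<in> cells M"
      using len[OF tp(1)] lab[OF tp(1)] unfolding cells_def cell_of_def by simp
    show "\<not> bad_cell t p (cell_of R L t p)"
    proof (cases "t = 0")
      case True
      have C0: "R 0 = initial M x" using r by (simp add: accepting_run_def)
      have src0: "src (L 0) = start_state M"
        using m[OF T] C0 by (simp add: matches_def initial_def)
      have K: "0 < num_tapes M" using wf by (simp add: wf_tm_def)
      have acc: "Suc 0 = T \<Longrightarrow> src (L 0) = accept_state M \<and> idle M (L 0)"
        using r by (auto simp: accepting_run_def)
      show ?thesis
        using len[OF T] rd[OF T] src0 K acc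
        unfolding bad_cell_def cell_of_def True C0
        by (auto simp: initial_tapes)
    next
      case False
      have acc: "Suc t = T \<Longrightarrow> src (L t) = accept_state M \<and> idle M (L t)"
        using r by (auto simp: accepting_run_def)
      then show ?thesis
        using False len[OF tp(1)] rd[OF tp(1)] unfolding bad_cell_def cell_of_def by auto
    qed
  next
    fix t p t' p' assume tp: "t < T" "p < 2 * T" "t' < T" "p' < 2 * T" "(t, p) \<noteq> (t', p')"
    show "\<not> bad_pair t p (cell_of R L t p) t' p' (cell_of R L t' p')"
    proof (cases "t' = Suc t")
      case True
      have "src (L (Suc t)) = tgt (L t)"
        using m[OF tp(3)] nx[of t] next_tapes(1)[OF len lab] tp(1) by (simp add: True matches_def)
      then show ?thesis
        using len[OF tp(1)] next_tapes[OF len[OF tp(1)] lab[OF tp(1)]]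
        unfolding bad_pair_def cell_of_def True nx[of t] by auto
    next
      case False
      then show ?thesis using tp len[OF tp(1)] unfolding bad_pair_def cell_of_def by auto
    qed
  qed
qed

lemma consistent_run:
  assumes c: "consistent \<sigma>"
  shows "\<exists>R L. accepting_run R L"
proof -
  \<comment> \<open>All cells of one time agree on the label, so column 0 may stand for the
    row.\<close>
  define L where "L t = fst (\<sigma> t 0)" for t
  define S where "S t p = fst (snd (\<sigma> t p))" for t p
  define H where "H t p = snd (snd (\<sigma> t p))" for t p
  have \<sigma>: "\<sigma> t p = (fst (\<sigma> t p), S t p, H t p)" for t p by (simp add: S_def H_def)
  have cell: "\<sigma> t p \<in> cells M" "\<not> bad_cell t p (\<sigma> t p)" if "t < T" "p < 2 * T" for t p
    using c that by (auto simp: consistent_def)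
  have pair: "\<not> bad_pair t p (\<sigma> t p) t' p' (\<sigma> t' p')"
    if "t < T" "p < 2 * T" "t' < T" "p' < 2 * T" "(t, p) \<noteq> (t', p')" for t p t' p'
    using c that by (auto simp: consistent_def)
  have L: "fst (\<sigma> t p) = L t" if "t < T" "p < 2 * T" for t p
  proof (cases "p = 0")
    case False
    then have "\<not> bad_pair t p (\<sigma> t p) t 0 (\<sigma> t 0)" using pair that T by auto
    then show ?thesis by (auto simp: bad_pair_def L_def split: prod.splits)
  qed (simp add: L_def)
  have \<sigma>L: "\<sigma> t p = (L t, S t p, H t p)" if "t < T" "p < 2 * T" for t p
    using \<sigma>[of t p] L[OF that] by simp
  have lab: "L t \<in> labels M" if "t < T" for t
    using cell(1)[OF that, of 0] T unfolding L_def cells_def by auto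
  define R where "R = rec_nat (initial M x) (\<lambda>t c. next_config c (L t))"
  have R: "R 0 = initial M x" "R (Suc t) = next_config (R t) (L t)" for t by (simp_all add: R_def)
  have K: "0 < num_tapes M" using wf by (simp add: wf_tm_def)
  \<comment> \<open>The bound on the head positions keeps them in the window from \<open>- T\<close>
    to \<open>T - 1\<close>, so the cell that has to receive a head always exists.\<close>
  have inv: "t < T \<Longrightarrow> fst (R t) = src (L t) \<and> length (snd (R t)) = num_tapes M \<and>
    (\<forall>i<num_tapes M. \<bar>snd (snd (R t) ! i)\<bar> \<le> int t \<and> (\<forall>p<2*T.
       S t p ! i = fst (snd (R t) ! i) (int p - int T) \<and>
       (H t p ! i \<longleftrightarrow> snd (snd (R t) ! i) = int p - int T)))" for t
  proof (induction t)
    case 0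
    have b: "\<not> bad_cell 0 p (L 0, S 0 p, H 0 p)" if "p < 2 * T" for p
      using cell(2)[OF T that] \<sigma>L[OF T that] by simp
    show ?case
    proof (intro conjI allI impI)
      show "fst (R 0) = src (L 0)" using b[of 0] T unfolding bad_cell_def R by (auto simp: initial_def)
      show "length (snd (R 0)) = num_tapes M" using initial_tapes by (simp add: R)
      fix i assume i: "i < num_tapes M"
      then show "\<bar>snd (snd (R 0) ! i)\<bar> \<le> int 0" by (simp add: R initial_tapes)
      fix p assume p: "p < 2 * T"
      show "S 0 p ! i = fst (snd (R 0) ! i) (int p - int T)"
        using b[OF p] i unfolding bad_cell_def R by (cases "i = 0") (auto simp: initial_tapes)
      show "H 0 p ! i \<longleftrightarrow> snd (snd (R 0) ! i) = int p - int T"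
        using b[OF p] i unfolding bad_cell_def R by (auto simp: initial_tapes)
    qed
  next
    case (Suc t)
    then have t: "t < T" and t': "Suc t < T" by auto
    from Suc.IH[OF t] have len: "length (snd (R t)) = num_tapes M"
      and hd: "\<And>i. i < num_tapes M \<Longrightarrow> \<bar>snd (snd (R t) ! i)\<bar> \<le> int t"
      and S: "\<And>i p. i < num_tapes M \<Longrightarrow> p < 2 * T \<Longrightarrow> S t p ! i = fst (snd (R t) ! i) (int p - int T)"
      and H: "\<And>i p. i < num_tapes M \<Longrightarrow> p < 2 * T \<Longrightarrow> H t p ! i \<longleftrightarrow> snd (snd (R t) ! i) = int p - int T"
      by auto
    note nt = next_tapes[OF len lab[OF t], folded R(2)]
    have b: "\<not> bad_pair t p (L t, S t p, H t p) (Suc t) p' (L (Suc t), S (Suc t) p', H (Suc t) p')"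
      if "p < 2 * T" "p' < 2 * T" for p p'
      using pair[OF t that(1) t' that(2)] \<sigma>L[OF t that(1)] \<sigma>L[OF t' that(2)] by simp
    have uniq: "\<not> (H (Suc t) p ! i \<and> H (Suc t) p' ! i)"
      if "p < 2 * T" "p' < 2 * T" "p \<noteq> p'" "i < num_tapes M" for p p' i
      using pair[OF t' that(1) t' that(2)] that \<sigma>L[OF t' that(1)] \<sigma>L[OF t' that(2)]
      unfolding bad_pair_def by auto
    show ?case
    proof (intro conjI allI impI)
      show "fst (R (Suc t)) = src (L (Suc t))" using b[of 0 0] T nt(1) unfolding bad_pair_def by auto
      show "length (snd (R (Suc t))) = num_tapes M" by (rule nt(2))
      fix i assume i: "i < num_tapes M"
      let ?h = "snd (snd (R t) ! i)" and ?d = "snd (acts (L t) ! i)"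
      have d: "?d \<in> {-1, 0, 1}" using labels_wf(5)[OF lab[OF t] i] .
      have h': "snd (snd (R (Suc t)) ! i) = ?h + ?d" using nt(3)[OF i] by simp
      show hb: "\<bar>snd (snd (R (Suc t)) ! i)\<bar> \<le> int (Suc t)" using h' hd[OF i] d by auto
      define p0 where "p0 = nat (?h + int T)"
      have p0: "p0 < 2 * T" "int p0 = ?h + int T" using hd[OF i] t by (auto simp: p0_def)
      define p1 where "p1 = nat (?h + ?d + int T)"
      have p1: "p1 < 2 * T" "int p1 = ?h + ?d + int T" using hb t' unfolding h' by (auto simp: p1_def)
      have "H t p0 ! i" using H[OF i p0(1)] p0(2) by simp
      then have H1: "H (Suc t) p1 ! i"
        using b[OF p0(1) p1(1)] i p0 p1 unfolding bad_pair_def by auto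
      fix p assume p: "p < 2 * T"
      have "S (Suc t) p ! i = (if H t p ! i then fst (acts (L t) ! i) else S t p ! i)"
        using b[OF p p] i unfolding bad_pair_def by auto
      then show "S (Suc t) p ! i = fst (snd (R (Suc t)) ! i) (int p - int T)"
        using S[OF i p] H[OF i p] nt(3)[OF i] by auto
      show "H (Suc t) p ! i \<longleftrightarrow> snd (snd (R (Suc t)) ! i) = int p - int T"
      proof (cases "p = p1")
        case True
        then show ?thesis using H1 h' p1 by simp
      next
        case False
        then have "\<not> H (Suc t) p ! i" using uniq[OF p p1(1) False i] H1 by blast
        then show ?thesis using False h' p1 by auto
      qed
    qed
  qed
  have "matches (R t) (L t)" if t: "t < T" for t
  proof -
    note I = inv[OF t]
    have "map scanned (snd (R t)) = rds (L t)"
    proof (rule nth_equalityI)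
      show "length (map scanned (snd (R t))) = length (rds (L t))"
        using I labels_wf(1)[OF lab[OF t]] by simp
      fix i assume "i < length (map scanned (snd (R t)))"
      then have i: "i < num_tapes M" using I by simp
      let ?h = "snd (snd (R t) ! i)"
      have "\<bar>?h\<bar> \<le> int t" using I i by blast
      then have p: "nat (?h + int T) < 2 * T" "int (nat (?h + int T)) = ?h + int T" using t by auto
      have S: "S t (nat (?h + int T)) ! i = fst (snd (R t) ! i) ?h"
        and H: "H t (nat (?h + int T)) ! i" using I i p by auto
      have "S t (nat (?h + int T)) ! i = rds (L t) ! i"
        using cell(2)[OF t p(1)] \<sigma>L[OF t p(1)] H i unfolding bad_cell_def by auto
      then show "map scanned (snd (R t)) ! i = rds (L t) ! i"
        using S i I by (cases "snd (R t) ! i") auto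
    qed
    then show ?thesis using I lab[OF t] by (simp add: matches_def)
  qed
  moreover have "src (L (T - 1)) = accept_state M \<and> idle M (L (T - 1))"
    using cell(2)[of "T - 1" 0] \<sigma>L[of "T - 1" 0] T unfolding bad_cell_def by auto
  ultimately have "accepting_run R L" using R by (auto simp: accepting_run_def)
  then show ?thesis by blast
qed

theorem accepts_iff_consistent:
  assumes "\<And>n c. (initial M x, c) \<in> step M ^^ n \<Longrightarrow> n < T"
  shows "accepts M x \<longleftrightarrow> (\<exists>\<sigma>. consistent \<sigma>)"
proof -
  have "accepts M x \<longleftrightarrow> (\<exists>R L. accepting_run R L)"
    by (rule accepts_iff_run) (rule assms)
  then show ?thesis using run_consistent consistent_run by blast
qed

end

section \<open>The reduction\<close>

definition eConst :: "bool \<Rightarrow> exp" where "eConst b = C (of_bool b)"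

definition eOrs :: "exp list \<Rightarrow> exp" where "eOrs es = foldr eOr es (C 0)"

lemma holds_eConst [simp]: "holds (eConst b) X v \<longleftrightarrow> b"
  by (simp add: holds_def eConst_def)

lemma holds_eOrs [simp]: "holds (eOrs es) X v \<longleftrightarrow> (\<exists>e \<in> set es. holds e X v)"
  by (induction es) (auto simp: eOrs_def holds_def eOr_def)

text \<open>By Horner's scheme, with variable 0 as the argument.\<close>

lemma exp_of_poly: "\<exists>e. \<forall>X v. eval e X v = poly p (v 0)"
proof (induction p)
  case 0
  show ?case by (rule exI[of _ "C 0"]) simp
next
  case (pCons a p)
  then obtain e where "\<forall>X v. eval e X v = poly p (v 0)" by blast
  then show ?case by (intro exI[of _ "Add (C a) (Mul (V 0) e)"]) simp
qed

text \<open>Bit extraction without division: variable 3 searches for the quotient by the power of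
  two in variable 1, and variable 4 witnesses that it is odd.\<close>

definition eOddDiv :: "exp \<Rightarrow> exp" where
  "eOddDiv e = eEx 3 (Add e (C 1)) (eAnd (eLe (Mul (V 3) (V 1)) e)
     (eAnd (eLt e (Mul (Add (V 3) (C 1)) (V 1)))
       (eEx 4 (Add (V 3) (C 1)) (eEq (V 3) (Add (Mul (C 2) (V 4)) (C 1))))))"

text \<open>\<open>For\<close> over a truth value is a conditional, as it runs once or not at all.
  Powers of two come in increasing order, which matches least significant bit first.\<close>

definition oBinary :: "exp \<Rightarrow> oexp" where
  "oBinary e = For 1 (Add e (C 1)) (For 2 (eBool (ePow2 3 (V 1))) (Emit (eOddDiv e)))"

lemma odd_div_iff:
  assumes "0 < (j :: nat)"
  shows "(\<exists>q < Suc k. q * j \<le> k \<and> k < Suc q * j \<and> (\<exists>h < Suc q. q = Suc (2 * h))) \<longleftrightarrow> odd (k div j)"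
proof
  assume "\<exists>q < Suc k. q * j \<le> k \<and> k < Suc q * j \<and> (\<exists>h < Suc q. q = Suc (2 * h))"
  then obtain q h where "q * j \<le> k" "k < Suc q * j" "q = Suc (2 * h)" by blast
  then have q: "q * j \<le> k" "k < Suc q * j" "odd q" by simp_all
  then have "k div j = q" by (intro div_nat_eqI) (auto simp: ac_simps)
  then show "odd (k div j)" using q by simp
next
  assume "odd (k div j)"
  then obtain h where h: "k div j = Suc (2 * h)" by (auto elim: oddE)
  have "k div j < Suc k" by (simp add: less_Suc_eq_le)
  moreover have "k div j * j \<le> k" by simp
  moreover have "\<exists>h < Suc (k div j). k div j = Suc (2 * h)" using h by (intro exI[of _ h]) simp
  moreover have "k < Suc (k div j) * j"
    using assms dividend_less_div_times[of j k] by (simp add: ac_simps)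
  ultimately show "\<exists>q < Suc k. q * j \<le> k \<and> k < Suc q * j \<and> (\<exists>h < Suc q. q = Suc (2 * h))"
    by blast
qed

lemma out_oBinary:
  assumes "\<And>w. w 0 = v 0 \<Longrightarrow> eval e X w = k"
  shows "out (oBinary e) X v = binary k"
proof -
  have "eval (eOddDiv e) X w \<noteq> 0 \<longleftrightarrow> odd (k div w 1)" if "w 0 = v 0" "pow2 (w 1)" for w
  proof -
    have "0 < w 1" using that(2) by (auto simp: pow2_def)
    moreover have "holds (eOddDiv e) X w \<longleftrightarrow>
        (\<exists>q < Suc k. q * w 1 \<le> k \<and> k < Suc q * w 1 \<and> (\<exists>h < Suc q. q = Suc (2 * h)))"
      using that(1) by (simp add: eOddDiv_def assms)
    ultimately show ?thesis using odd_div_iff unfolding holds_def by simp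
  qed
  then have "out (For 2 (eBool (ePow2 3 (V 1))) (Emit (eOddDiv e))) X (v(1 := j)) =
      (if pow2 j then [odd (k div j)] else [])" for j
    by (simp add: holds_ePow2)
  then have "out (oBinary e) X v = concat (map (\<lambda>j. if pow2 j then [odd (k div j)] else []) [0..<Suc k])"
    unfolding oBinary_def out.simps(3)[of 1] by (simp add: assms del: upt_Suc out.simps)
  then show ?thesis by (simp only: concat_pow2 binary_eq_map)
qed

text \<open>Expressions offer neither quotient nor remainder, so an index is decoded by searching
  for its three components.\<close>

lemma decode_ex:
  fixes c P T :: nat
  assumes "0 < c" "0 < P"
  shows "(\<exists>t<T. \<exists>p<P. \<exists>a<c. u = (t * P + p) * c + a \<and> Q t p a) \<longleftrightarrow>
    u < T * P * c \<and> Q (u div c div P) (u div c mod P) (u mod c)"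
proof
  assume "\<exists>t<T. \<exists>p<P. \<exists>a<c. u = (t * P + p) * c + a \<and> Q t p a"
  then obtain t p a where *: "t < T" "p < P" "a < c" "u = (t * P + p) * c + a" "Q t p a" by blast
  have "t * P + p < T * P" using *(1,2) mult_le_mono1[of "Suc t" T P] by simp
  then have "u < T * P * c" using *(3,4) mult_le_mono1[of "Suc (t * P + p)" "T * P" c] by simp
  then show "u < T * P * c \<and> Q (u div c div P) (u div c mod P) (u mod c)"
    using * by simp
next
  assume *: "u < T * P * c \<and> Q (u div c div P) (u div c mod P) (u mod c)"
  then have "u div c div P < T" by (simp add: less_mult_imp_div_less)
  moreover have "u = (u div c div P * P + u div c mod P) * c + u mod c" by simp
  moreover have "u div c mod P < P" "u mod c < c" using assms by auto
  ultimately show "\<exists>t<T. \<exists>p<P. \<exists>a<c. u = (t * P + p) * c + a \<and> Q t p a" using * by blast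
qed

context
  fixes M :: tm and c :: nat and h :: "nat \<Rightarrow> cell" and eT :: exp and T :: "nat \<Rightarrow> nat"
  assumes wf: "wf_tm M" and c: "0 < c" and h: "h ` {..<c} = cells M"
    and eT: "\<And>X v. eval eT X v = T (v 0)" and T: "\<And>n. 0 < T n"
begin

text \<open>A disjunction over the \<open>c\<close> contents, unfolded while the expression is
  built. The factor \<open>eBool (eLe eT p)\<close> yields the blank left of the origin, where
  truncated subtraction would read the first symbol. The clause
  \<open>hs ! i \<noteq> (p = T)\<close> is split by the two truth values of the flag.\<close>

definition eBad1 :: "exp \<Rightarrow> exp \<Rightarrow> exp \<Rightarrow> exp" where
  "eBad1 t p a = eOrs (map (\<lambda>b. eAnd (eEq a (C b)) (case h b of (l, ss, hs) \<Rightarrow>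
     eOr (eConst (\<exists>i<num_tapes M. hs ! i \<and> ss ! i \<noteq> rds l ! i)) (eOr
       (eAnd (eEq t (C 0)) (eOr (eConst (src l \<noteq> start_state M)) (eOr
         (eNot (eEq (C (ss ! 0)) (Mul (eBool (eLe eT p)) (In (Sub p eT))))) (eOr
         (eConst (\<exists>i<num_tapes M. 0 < i \<and> ss ! i \<noteq> 0)) (eOr
         (eAnd (eConst (\<exists>i<num_tapes M. hs ! i)) (eNot (eEq p eT)))
         (eAnd (eConst (\<exists>i<num_tapes M. \<not> hs ! i)) (eEq p eT)))))))
       (eAnd (eEq (Add t (C 1)) eT) (eConst (src l \<noteq> accept_state M \<or> \<not> idle M l)))))) [0..<c])"

text \<open>Head moves are split by their value 0, 1 or -1. As there are no negative numbers, a move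
  to the left is phrased as \<open>p = p' + 1\<close>.\<close>

definition eBad2 :: "exp \<Rightarrow> exp \<Rightarrow> exp \<Rightarrow> exp \<Rightarrow> exp \<Rightarrow> exp \<Rightarrow> exp" where
  "eBad2 t p a t' p' a' = eOrs (map (\<lambda>(b, b'). eAnd (eEq a (C b)) (eAnd (eEq a' (C b'))
     (case h b of (l, ss, hs) \<Rightarrow> case h b' of (l', ss', hs') \<Rightarrow>
       eOr (eAnd (eEq t' t) (eConst (l \<noteq> l' \<or> (\<exists>i<num_tapes M. hs ! i \<and> hs' ! i))))
       (eAnd (eEq t' (Add t (C 1))) (eOr (eConst (tgt l \<noteq> src l')) (eOr
         (eAnd (eEq p' p) (eConst (\<exists>i<num_tapes M. ss' ! i \<noteq> (if hs ! i then fst (acts l ! i) else ss ! i)))) (eOr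
         (eAnd (eEq p' p) (eConst (\<exists>i<num_tapes M. hs ! i \<and> snd (acts l ! i) = 0 \<and> \<not> hs' ! i))) (eOr
         (eAnd (eEq p' (Add p (C 1))) (eConst (\<exists>i<num_tapes M. hs ! i \<and> snd (acts l ! i) = 1 \<and> \<not> hs' ! i)))
         (eAnd (eEq p (Add p' (C 1))) (eConst (\<exists>i<num_tapes M. hs ! i \<and> snd (acts l ! i) = -1 \<and> \<not> hs' ! i)))))))))))
     (List.product [0..<c] [0..<c]))"

lemma holds_eBad1:
  assumes "v 0 = length x" "eval a (sym x {}) v < c"
  shows "holds (eBad1 t p a) (sym x {}) v \<longleftrightarrow>
    bad_cell M x (T (length x)) (eval t (sym x {}) v) (eval p (sym x {}) v) (h (eval a (sym x {}) v))"
proof -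
  let ?X = "sym x {}"
  obtain l ss hs where hs: "h (eval a ?X v) = (l, ss, hs)" by (metis prod_cases3)
  have inp: "eval (Mul (eBool (eLe eT p)) (In (Sub p eT))) ?X v =
      input_symbol x (int (eval p ?X v) - int (T (length x)))"
    using assms(1) unfolding input_symbol_def[OF wf T]
    by (auto simp: eT sym_def nat_diff_distrib' of_nat_diff)
  show ?thesis
    using assms unfolding eBad1_def bad_cell_def[OF wf T]
    by (auto simp: hs eT inp simp del: eval.simps(3,5,6))
qed

lemma holds_eBad2:
  assumes "eval a X v < c" "eval a' X v < c"
  shows "holds (eBad2 t p a t' p' a') X v \<longleftrightarrow>
    bad_pair M (eval t X v) (eval p X v) (h (eval a X v)) (eval t' X v) (eval p' X v) (h (eval a' X v))"
proof -
  obtain l ss hs where hs: "h (eval a X v) = (l, ss, hs)" by (metis prod_cases3)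
  obtain l' ss' hs' where hs': "h (eval a' X v) = (l', ss', hs')" by (metis prod_cases3)
  have "(l, ss, hs) \<in> cells M" using h assms(1) hs by force
  then have "l \<in> labels M" by (simp add: cells_def)
  then have d: "snd (acts l ! i) \<in> {-1, 0, 1}" if "i < num_tapes M" for i
    using labels_wf(5)[OF wf _ _ that] T by blast
  define Q where "Q d \<longleftrightarrow> (\<exists>i<num_tapes M. hs ! i \<and> snd (acts l ! i) = d \<and> \<not> hs' ! i)" for d
  have Q: "(\<exists>i<num_tapes M. hs ! i \<and> int y = int z + snd (acts l ! i) \<and> \<not> hs' ! i) \<longleftrightarrow>
      y = z \<and> Q 0 \<or> y = Suc z \<and> Q 1 \<or> z = Suc y \<and> Q (-1)" (is "?l \<longleftrightarrow> ?r") for y z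
  proof
    assume ?l
    then obtain i where i: "i < num_tapes M" "hs ! i" "int y = int z + snd (acts l ! i)" "\<not> hs' ! i" by blast
    from d[OF i(1)] show ?r using i unfolding Q_def by force
  next
    assume ?r
    then show ?l unfolding Q_def by force
  qed
  \<comment> \<open>\<open>bad_pair_def\<close> carries the context assumption \<open>0 < T\<close>;
    it is discharged at \<open>T = 1\<close>.\<close>
  show ?thesis
    using assms unfolding eBad2_def bad_pair_def[OF wf zero_less_one]
    by (simp add: hs hs' Q Q_def[symmetric] set_product)
qed

text \<open>Unary constraints become binary ones by letting a bad cell conflict with everything. The
  first clause makes the values of one cell exclude each other, as the lemma
  \<open>conflict_graph\<close> demands.\<close>

definition cell_conflict :: "bool list \<Rightarrow> nat \<Rightarrow> nat \<Rightarrow> nat \<Rightarrow> nat \<Rightarrow> nat \<Rightarrow> nat \<Rightarrow> bool" where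
  "cell_conflict x t p a t' p' a' \<longleftrightarrow> t = t' \<and> p = p' \<or> bad_cell M x (T (length x)) t p (h a) \<or>
     bad_cell M x (T (length x)) t' p' (h a') \<or> bad_pair M t p (h a) t' p' (h a')"

definition conflict :: "bool list \<Rightarrow> nat \<Rightarrow> nat \<Rightarrow> bool" where
  "conflict x u w = (let P = 2 * T (length x) in
     cell_conflict x (u div c div P) (u div c mod P) (u mod c) (w div c div P) (w div c mod P) (w mod c))"

abbreviation eP :: exp where "eP \<equiv> Mul (C 2) eT"

text \<open>Variables 3 to 8 hold the two decoded triples, so \<open>u\<close> and \<open>w\<close>
  may refer to smaller variables only.\<close>

definition eConflict :: "exp \<Rightarrow> exp \<Rightarrow> exp" where
  "eConflict u w = eEx 3 eT (eEx 4 eP (eEx 5 (C c)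
     (eAnd (eEq u (Add (Mul (Add (Mul (V 3) eP) (V 4)) (C c)) (V 5)))
     (eEx 6 eT (eEx 7 eP (eEx 8 (C c)
     (eAnd (eEq w (Add (Mul (Add (Mul (V 6) eP) (V 7)) (C c)) (V 8)))
       (eOr (eAnd (eEq (V 3) (V 6)) (eEq (V 4) (V 7))) (eOr (eBad1 (V 3) (V 4) (V 5))
         (eOr (eBad1 (V 6) (V 7) (V 8)) (eBad2 (V 3) (V 4) (V 5) (V 6) (V 7) (V 8))))))))))))"

lemma holds_eConflict:
  assumes "v 0 = length x" "i \<in> {1, 2}" "j \<in> {1, 2}"
    and "v i < T (length x) * (2 * T (length x)) * c" "v j < T (length x) * (2 * T (length x)) * c"
  shows "holds (eConflict (V i) (V j)) (sym x {}) v \<longleftrightarrow> conflict x (v i) (v j)"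
proof -
  let ?X = "sym x {}" and ?n = "length x"
  let ?T = "T ?n" and ?P = "2 * T ?n"
  have P: "0 < ?P" using T by simp
  have ij: "i \<noteq> 0" "i < 3" "j \<noteq> 0" "j < 3" using assms(2,3) by auto
  have "holds (eOr (eAnd (eEq (V 3) (V 6)) (eEq (V 4) (V 7))) (eOr (eBad1 (V 3) (V 4) (V 5))
         (eOr (eBad1 (V 6) (V 7) (V 8)) (eBad2 (V 3) (V 4) (V 5) (V 6) (V 7) (V 8))))) ?X w \<longleftrightarrow>
      cell_conflict x (w 3) (w 4) (w 5) (w 6) (w 7) (w 8)"
    if "w 0 = ?n" "w 5 < c" "w 8 < c" for w
    using that by (simp add: holds_eBad1 holds_eBad2 cell_conflict_def)
  then have "holds (eConflict (V i) (V j)) ?X v \<longleftrightarrow>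
      (\<exists>t<?T. \<exists>p<?P. \<exists>a<c. v i = (t * ?P + p) * c + a \<and>
      (\<exists>t'<?T. \<exists>p'<?P. \<exists>a'<c. v j = (t' * ?P + p') * c + a' \<and> cell_conflict x t p a t' p' a'))"
    using ij assms(1) unfolding eConflict_def by (simp add: eT del: holds_simps(4) cong: conj_cong)
  then show ?thesis
    using assms(4,5) unfolding decode_ex[OF c P] conflict_def Let_def by simp
qed

definition eEdge :: exp where
  "eEdge = eAnd (eNot (eEq (V 1) (V 2))) (eOr
     (eAnd (eAnd (eLt (V 1) (Mul (Mul eT eP) (C c))) (eLt (V 2) (Mul (Mul eT eP) (C c))))
       (eOr (eConflict (V 1) (V 2)) (eConflict (V 2) (V 1))))
     (eOr (eEq (V 2) (Add (V 1) (Mul (Mul eT eP) (C c)))) (eEq (V 1) (Add (V 2) (Mul (Mul eT eP) (C c))))))"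

definition reduction :: oexp where
  "reduction = (let N = Mul (C 2) (Mul (Mul eT eP) (C c)) in
     Cat (For 1 N (Emit (C 1))) (Cat (Emit (C 0)) (Cat (For 1 N (For 2 N (Emit eEdge)))
       (oBinary (Sub N (Mul eT eP))))))"

definition tableau_size :: "nat \<Rightarrow> nat" where "tableau_size n = T n * (2 * T n)"

lemma conflict_graph_iff:
  assumes "i < 2 * m" "j < 2 * m"
  shows "{i, j} \<in> conflict_graph m Cf \<longleftrightarrow> i \<noteq> j \<and>
     (i < m \<and> j < m \<and> (Cf i j \<or> Cf j i) \<or> j = i + m \<or> i = j + m)"
  using assms unfolding conflict_graph_def by (auto simp: doubleton_eq_iff)

lemma out_reduction:
  "out reduction (sym x {}) (\<lambda>_. length x) = encode_instance (2 * (tableau_size (length x) * c))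
     (conflict_graph (tableau_size (length x) * c) (conflict x))
     (2 * (tableau_size (length x) * c) - tableau_size (length x))"
proof -
  let ?X = "sym x {}" and ?v = "\<lambda>_ :: nat. length x"
  define m where "m = tableau_size (length x)"
  have m: "m = T (length x) * (2 * T (length x))" by (simp add: m_def tableau_size_def)
  have edge: "eval eEdge ?X (?v(1 := i, 2 := j)) \<noteq> 0 \<longleftrightarrow> {i, j} \<in> conflict_graph (m * c) (conflict x)"
    if "i < 2 * (m * c)" "j < 2 * (m * c)" for i j
    unfolding holds_def[symmetric] eEdge_def conflict_graph_iff[OF that]
    by (simp add: eT holds_eConflict m cong: conj_cong)
  have "out (For 1 (Mul (C 2) (Mul (Mul eT eP) (C c))) (Emit (C 1))) ?X ?v = replicate (2 * (m * c)) True"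
    by (simp add: eT m map_replicate_const concat_map_singleton)
  moreover have "out (For 1 (Mul (C 2) (Mul (Mul eT eP) (C c)))
      (For 2 (Mul (C 2) (Mul (Mul eT eP) (C c))) (Emit eEdge))) ?X ?v =
      adjacency_matrix (2 * (m * c)) (conflict_graph (m * c) (conflict x))"
  proof -
    define e where "e = Mul (C 2) (Mul (Mul eT eP) (C c))"
    have e: "eval e ?X w = 2 * (m * c)" if "w 0 = length x" for w
      using that by (simp add: e_def eT m)
    have "out (For 2 e (Emit eEdge)) ?X (?v(1 := i)) =
        map (\<lambda>j. {i, j} \<in> conflict_graph (m * c) (conflict x)) [0..<2 * (m * c)]"
      if "i < 2 * (m * c)" for i
      using that unfolding out.simps concat_map_singleton
      by (intro map_cong) (auto simp: e edge[simplified])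
    then show ?thesis
      unfolding adjacency_matrix_def e_def[symmetric] out.simps(3)[of 1] e[OF refl]
      by (intro arg_cong[of _ _ concat] map_cong) auto
  qed
  moreover have "out (oBinary (Sub (Mul (C 2) (Mul (Mul eT eP) (C c))) (Mul eT eP))) ?X ?v =
      binary (2 * (m * c) - m)"
    by (rule out_oBinary) (simp add: eT m)
  ultimately show ?thesis
    by (simp add: reduction_def Let_def encode_instance_def m_def[symmetric] del: out.simps(3))
qed

text \<open>Constraint variable \<open>t * P + p\<close> is the cell at time \<open>t\<close> in
  column \<open>p\<close>, and the value \<open>a\<close> names the content
  \<open>h a\<close>.\<close>

lemma consistent_iff:
  "(\<exists>\<sigma>. consistent M x (T (length x)) \<sigma>) \<longleftrightarrow>
   (\<exists>\<sigma>. solution (tableau_size (length x)) c (conflict x) \<sigma>)"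
proof -
  define N P m where "N = T (length x)" and "P = 2 * N" and "m = tableau_size (length x)"
  have pos: "0 < N" "0 < P" "1 < m" "m = N * P"
  proof -
    show "0 < N" "0 < P" using T by (simp_all add: N_def P_def)
    show "m = N * P" by (simp add: m_def tableau_size_def N_def P_def)
    moreover have "1 * 2 \<le> N * P" using \<open>0 < N\<close> by (intro mult_le_mono) (auto simp: P_def)
    ultimately show "1 < m" by simp
  qed
  note cons = consistent_def[OF wf pos(1), folded P_def]
  have code: "t * P + p < m" if "t < N" "p < P" for t p
    using mult_le_mono1[of "Suc t" N P] that pos(4) by simp
  have cf: "conflict x (g * c + a) (g' * c + a') \<longleftrightarrow>
      cell_conflict x (g div P) (g mod P) a (g' div P) (g' mod P) a'" if "a < c" "a' < c" for g g' a a'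
    using that by (simp add: conflict_def Let_def N_def P_def)
  have dm: "g = g'" if "g div P = g' div P" "g mod P = g' mod P" for g g'
    using that by (metis div_mult_mod_eq)
  show ?thesis
    unfolding N_def[symmetric] m_def[symmetric]
  proof
    assume "\<exists>\<sigma>. consistent M x N \<sigma>"
    then obtain \<sigma> where \<sigma>: "consistent M x N \<sigma>" by blast
    have c1: "\<sigma> t p \<in> cells M" "\<not> bad_cell M x N t p (\<sigma> t p)" if "t < N" "p < P" for t p
      using \<sigma> that unfolding cons by blast+
    have c2: "\<not> bad_pair M t p (\<sigma> t p) t' p' (\<sigma> t' p')"
      if "t < N" "p < P" "t' < N" "p' < P" "(t, p) \<noteq> (t', p')" for t p t' p'
      using \<sigma> that unfolding cons by blast
    have dv: "g div P < N" "g mod P < P" if "g < m" for g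
      using that pos by (auto simp: less_mult_imp_div_less)
    have "\<exists>a<c. h a = \<sigma> (g div P) (g mod P)" if "g < m" for g
    proof -
      have "\<sigma> (g div P) (g mod P) \<in> h ` {..<c}" using c1(1)[OF dv[OF that]] unfolding h .
      then show ?thesis by auto
    qed
    then obtain s where s: "\<And>g. g < m \<Longrightarrow> s g < c \<and> h (s g) = \<sigma> (g div P) (g mod P)" by metis
    have "\<not> conflict x (g * c + s g) (g' * c + s g')" if g: "g < m" "g' < m" "g \<noteq> g'" for g g'
    proof -
      have ne: "\<not> (g div P = g' div P \<and> g mod P = g' mod P)" using dm[of g g'] g(3) by blast
      have sg: "s g < c" "h (s g) = \<sigma> (g div P) (g mod P)" and sg': "s g' < c" "h (s g') = \<sigma> (g' div P) (g' mod P)"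
        using s g by auto
      have "\<not> bad_cell M x N (g div P) (g mod P) (h (s g))" "\<not> bad_cell M x N (g' div P) (g' mod P) (h (s g'))"
        unfolding sg(2) sg'(2) using c1(2) dv g by blast+
      moreover have "\<not> bad_pair M (g div P) (g mod P) (h (s g)) (g' div P) (g' mod P) (h (s g'))"
        unfolding sg(2) sg'(2) using c2 dv g ne by (metis prod.inject)
      ultimately show ?thesis
        using ne unfolding cf[OF sg(1) sg'(1)] cell_conflict_def N_def by blast
    qed
    then show "\<exists>\<sigma>. solution m c (conflict x) \<sigma>"
      using s unfolding solution_def by blast
  next
    assume "\<exists>\<sigma>. solution m c (conflict x) \<sigma>"
    then obtain s where s: "\<And>g. g < m \<Longrightarrow> s g < c"
      and cs: "\<And>g g'. g < m \<Longrightarrow> g' < m \<Longrightarrow> g \<noteq> g' \<Longrightarrow> \<not> conflict x (g * c + s g) (g' * c + s g')"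
      unfolding solution_def by blast
    let ?\<sigma> = "\<lambda>t p. h (s (t * P + p))"
    have ncc: "\<not> cell_conflict x t p (s (t * P + p)) t' p' (s (t' * P + p'))"
      if "t < N" "p < P" "t' < N" "p' < P" "(t, p) \<noteq> (t', p')" for t p t' p'
    proof -
      have "t * P + p \<noteq> t' * P + p'"
      proof
        assume eq: "t * P + p = t' * P + p'"
        have "t = (t * P + p) div P" "p = (t * P + p) mod P" using that by auto
        moreover have "t' = (t' * P + p') div P" "p' = (t' * P + p') mod P" using that by auto
        ultimately show False using eq that(5) by metis
      qed
      then have "\<not> conflict x ((t * P + p) * c + s (t * P + p)) ((t' * P + p') * c + s (t' * P + p'))"
        using cs code that by blast
      then show ?thesis using that code s by (simp add: cf)
    qed
    have "consistent M x N ?\<sigma>"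
      unfolding cons
    proof (intro conjI allI impI)
      fix t p assume tp: "t < N" "p < P"
      have "s (t * P + p) < c" using s code tp by blast
      then show "?\<sigma> t p \<in> cells M" using h by blast
      \<comment> \<open>A bad cell shows up only through a conflict with some other cell;
        \<open>P = 2 * N\<close> guarantees another one in the same row.\<close>
      have "(if p = 0 then 1 else 0) < P" "p \<noteq> (if p = 0 then 1 else 0)"
        using pos(1) by (auto simp: P_def)
      then obtain p' where "p' < P" "p \<noteq> p'" by blast
      then show "\<not> bad_cell M x N t p (?\<sigma> t p)"
        using ncc[OF tp tp(1), of p'] by (auto simp: cell_conflict_def N_def)
    next
      fix t p t' p' assume tp: "t < N" "p < P" "t' < N" "p' < P" "(t, p) \<noteq> (t', p')"
      then show "\<not> bad_pair M t p (?\<sigma> t p) t' p' (?\<sigma> t' p')"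
        using ncc[OF tp] by (auto simp: cell_conflict_def)
    qed
    then show "\<exists>\<sigma>. consistent M x N \<sigma>" by blast
  qed
qed

lemma reduction_correct:
  assumes "\<And>n d. (initial M x, d) \<in> step M ^^ n \<Longrightarrow> n < T (length x)"
  shows "accepts M x \<longleftrightarrow> out reduction (sym x {}) (\<lambda>_. length x) \<in> Roman_Vertex_Cover"
proof -
  define m where "m = tableau_size (length x)"
  let ?E = "conflict_graph (m * c) (conflict x)"
  have "conflict x u w" if "u < m * c" "w < m * c" "u div c = w div c" for u w
    using that by (simp add: conflict_def cell_conflict_def Let_def)
  note cg = conflict_graph[where m = m and Cf = "conflict x", OF c this]
  have "accepts M x \<longleftrightarrow> (\<exists>\<sigma>. consistent M x (T (length x)) \<sigma>)"
    by (rule accepts_iff_consistent[OF wf T]) (rule assms)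
  also have "\<dots> \<longleftrightarrow> has_rvc_of_weight_at_most {..<2 * (m * c)} ?E (2 * (m * c) - m)"
    unfolding consistent_iff m_def[symmetric] by (rule cg(2)[symmetric])
  \<comment> \<open>As encodings are injective, membership of the encoded string speaks about this
    very graph and bound.\<close>
  also have "\<dots> \<longleftrightarrow> encode_instance (2 * (m * c)) ?E (2 * (m * c) - m) \<in> Roman_Vertex_Cover"
    using cg(1) encode_instance_inject[OF cg(1)] unfolding Roman_Vertex_Cover_def by blast
  finally show ?thesis unfolding out_reduction m_def .
qed

end

theorem Roman_Vertex_Cover_NP_hard: "NP_hard Roman_Vertex_Cover"
  unfolding NP_hard_def
proof
  fix L assume "L \<in> NP"
  then obtain M and p :: "nat poly" where wf: "wf_tm M" and L: "L = {x. accepts M x}"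
    and bound: "\<And>x n d. (initial M x, d) \<in> step M ^^ n \<Longrightarrow> n \<le> poly p (length x)"
    unfolding NP_def by blast
  obtain e where e: "\<And>X v. eval e X v = poly p (v 0)" using exp_of_poly by blast
  \<comment> \<open>One more than the time bound, since \<open>n\<close> steps pass through
    \<open>n + 1\<close> configurations.\<close>
  define T where "T n = Suc (poly p n)" for n
  have eT: "eval (Add e (C 1)) X v = T (v 0)" for X v by (simp add: e T_def)
  have T: "0 < T n" for n by (simp add: T_def)
  define c where "c = card (cells M)"
  \<comment> \<open>Any numbering of the contents will do: it depends on \<open>M\<close> alone and
    is built into the expression.\<close>
  obtain h where "bij_betw h {0..<c} (cells M)"
    using ex_bij_betw_nat_finite[OF finite_cells[OF wf]] unfolding c_def by blast
  then have h: "h ` {..<c} = cells M" by (simp add: bij_betw_def atLeast0LessThan)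
  \<comment> \<open>With blanks under all heads, the start state either gives an idle label or
    matches a transition of the program.\<close>
  have "cells M \<noteq> {}"
  proof -
    let ?rs = "replicate (num_tapes M) (0 :: nat)"
    let ?l = "(start_state M, ?rs, start_state M, map (\<lambda>s. (s, 0)) ?rs) :: transition"
    have "labels M \<noteq> {}"
    proof (cases "idle M ?l")
      case True
      then have "?l \<in> labels M"
        by (auto simp: labels_def src_def rds_def tgt_def acts_def states_def symbols_def)
      then show ?thesis by blast
    next
      case False
      then show ?thesis by (auto simp: labels_def idle_def)
    qed
    then obtain l where "l \<in> labels M" by blast
    then have "(l, ?rs, replicate (num_tapes M) True) \<in> cells M"
      by (auto simp: cells_def symbols_def)
    then show ?thesis by blast
  qed
  then have c: "0 < c" using finite_cells[OF wf] unfolding c_def by (simp add: card_gt_0_iff)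
  let ?f = "\<lambda>x. out (reduction M c h (Add e (C 1))) (sym x {}) (\<lambda>_. length x)"
  have "x \<in> L \<longleftrightarrow> ?f x \<in> Roman_Vertex_Cover" for x
  proof -
    have "accepts M x \<longleftrightarrow> ?f x \<in> Roman_Vertex_Cover"
      by (rule reduction_correct[OF wf c h eT T]) (use bound in \<open>auto simp: T_def less_Suc_eq_le\<close>)
    then show ?thesis by (simp add: L)
  qed
  then show "polytime_reducible L Roman_Vertex_Cover"
    unfolding polytime_reducible_def using polytime_computable_out by blast
qed

theorem theorem23: "NP_complete Roman_Vertex_Cover"
  using Roman_Vertex_Cover_in_NP Roman_Vertex_Cover_NP_hard by (simp add: NP_complete_def)

end
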